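(* Let $u$ be the unique viscosity solution on $[0,T)$ of $u_t+F(Du,D^2u)+k|Du|=0$ with obstacles $u^-,u^+$ and initial condition $u_0$. Then $u$ is uniformly continuous in space. Moreover, for all $x,y\in\mathbb R^n$ and $t\in[0,T)$, $$|u(x,t)-u(y,t)|\le\omega\big(e^{Lt}|x-y|\big).$$
   Context: $\mathcal S_n$ is the set of real symmetric $n\times n$ matrices; $Du$, $D^2u$ denote derivatives in the space variable only; $T>0$ is fixed. $F:\mathbb R^n\times\mathcal S_n\to\mathbb R$ satisfies: (i) $F$ is continuous on $(\mathbb R^n\setminus\{0\})\times\mathcal S_n$; (ii) $F$ is geometric: $F(\lambda p,\lambda X+\sigma p\otimes p)=\lambda F(p,X)$ for all $\lambda>0$, $\sigma\in\mathbb R$; (iii) if $X\le Y$ then $F(p,X)\ge F(p,Y)$. $F^\ast$ and $F_\ast$ denote the upper and lower semicontinuous envelopes of $F$. Standing assumptions: $k:\mathbb R^n\times[0,\infty)\to\mathbb R$ is Lipschitz with Lipschitz constant $L$; the obstacles $u^-\le u^+$ are bounded uniformly continuous functions $\mathbb R^n\times[0,\infty)\to\mathbb R$; $u_0:\mathbb R^n\to\mathbb R$ is uniformly continuous with $u^-(\cdot,0)\le u_0\le u^+(\cdot,0)$; $\omega$ is a common modulus of continuity (a nondecreasing function $[0,\infty)\to[0,\infty)$ with $\omega(r)\to0$ as $r\to0$) for $u_0$, $u^-$ and $u^+$. Viscosity subsolution on $[0,T)$ with obstacles $u^-,u^+$ and initial condition $u_0$: a function $u$ on $\mathbb R^n\times[0,T)$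 that is upper semicontinuous, satisfies $u^-\le u\le u^+$, satisfies $u(\cdot,0)\le u_0$, and such that whenever $\varphi$ is a $C^2$ function of $(x,t)$, $(\hat x,\hat t)\in\mathbb R^n\times(0,T)$ is a maximizer of $u-\varphi$ and $u(\hat x,\hat t)>u^-(\hat x,\hat t)$, one has $\varphi_t+F_\ast(D\varphi,D^2\varphi)+k|D\varphi|\le 0$ at $(\hat x,\hat t)$. Viscosity supersolution: lower semicontinuous, $u^-\le u\le u^+$, $u(\cdot,0)\ge u_0$, and whenever $\varphi$ is $C^2$, $(\hat x,\hat t)\in\mathbb R^n\times(0,T)$ is a minimizer of $u-\varphi$ and $u(\hat x,\hat t)<u^+(\hat x,\hat t)$, one has $\varphi_t+F^\ast(D\varphi,D^2\varphi)+k|D\varphi|\ge 0$ at $(\hat x,\hat t)$. A solution is both a sub- and a supersolution. *)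

theory Defs
  imports "HOL-Analysis.Analysis"
begin

section \<open>Symmetric matrices\<close>

definition sym_matrices :: "(real^'n^'n) set" where
  "sym_matrices = {X. transpose X = X}"

definition loewner_le :: "real^'n^'n \<Rightarrow> real^'n^'n \<Rightarrow> bool" where
  "loewner_le X Y \<longleftrightarrow> (\<forall>v. v \<bullet> (X *v v) \<le> v \<bullet> (Y *v v))"

definition outer_prod :: "real^'n \<Rightarrow> real^'n \<Rightarrow> real^'n^'n" where
  "outer_prod p q = (\<chi> i j. p $ i * q $ j)"


section \<open>Semicontinuity\<close>

definition usc_on :: "'a::topological_space set \<Rightarrow> ('a \<Rightarrow> real) \<Rightarrow> bool" where
  "usc_on S f \<longleftrightarrow> (\<forall>x\<in>S. \<forall>c. f x < c \<longrightarrow> (\<forall>\<^sub>F y in at x within S. f y < c))"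

definition lsc_on :: "'a::topological_space set \<Rightarrow> ('a \<Rightarrow> real) \<Rightarrow> bool" where
  "lsc_on S f \<longleftrightarrow> (\<forall>x\<in>S. \<forall>c. c < f x \<longrightarrow> (\<forall>\<^sub>F y in at x within S. c < f y))"

text \<open>
  Semicontinuous envelopes, relative to \<open>S\<close>, of a function on \<open>S\<close>. The point \<open>x\<close> itself is part of
  the neighbourhoods. The values are extended reals because a function that is locally unbounded near
  a point (as a geometric operator may be near zero gradient) has an infinite envelope there.
\<close>

definition usc_envelope_on :: "'a::metric_space set \<Rightarrow> ('a \<Rightarrow> real) \<Rightarrow> 'a \<Rightarrow> ereal" where
  "usc_envelope_on S f x = (INF r\<in>{0<..}. SUP y\<in>S \<inter> ball x r. ereal (f y))"

definition lsc_envelope_on :: "'a::metric_space set \<Rightarrow> ('a \<Rightarrow> real) \<Rightarrow> 'a \<Rightarrow> ereal" where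
  "lsc_envelope_on S f x = (SUP r\<in>{0<..}. INF y\<in>S \<inter> ball x r. ereal (f y))"

definition F_upper :: "(real^'n \<Rightarrow> real^'n^'n \<Rightarrow> real) \<Rightarrow> real^'n \<Rightarrow> real^'n^'n \<Rightarrow> ereal" where
  "F_upper F p X = usc_envelope_on (UNIV \<times> sym_matrices) (\<lambda>(q, Y). F q Y) (p, X)"

definition F_lower :: "(real^'n \<Rightarrow> real^'n^'n \<Rightarrow> real) \<Rightarrow> real^'n \<Rightarrow> real^'n^'n \<Rightarrow> ereal" where
  "F_lower F p X = lsc_envelope_on (UNIV \<times> sym_matrices) (\<lambda>(q, Y). F q Y) (p, X)"


section \<open>Derivatives of test functions\<close>

definition C2 :: "('a::real_normed_vector \<Rightarrow> real) \<Rightarrow> bool" where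
  "C2 f \<longleftrightarrow> (\<exists>(f' :: 'a \<Rightarrow> ('a \<Rightarrow>\<^sub>L real)) (f'' :: 'a \<Rightarrow> ('a \<Rightarrow>\<^sub>L ('a \<Rightarrow>\<^sub>L real))).
     (\<forall>z. (f has_derivative blinfun_apply (f' z)) (at z)) \<and>
     (\<forall>z. (f' has_derivative blinfun_apply (f'' z)) (at z)) \<and>
     continuous_on UNIV f'')"

definition partial_deriv :: "'n \<Rightarrow> (real^'n \<Rightarrow> real) \<Rightarrow> real^'n \<Rightarrow> real" where
  "partial_deriv i f x = deriv (\<lambda>s. f (x + s *\<^sub>R axis i 1)) 0"

definition grad :: "(real^'n \<Rightarrow> real) \<Rightarrow> real^'n \<Rightarrow> real^'n" where
  "grad f x = (\<chi> i. partial_deriv i f x)"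

definition hessian :: "(real^'n \<Rightarrow> real) \<Rightarrow> real^'n \<Rightarrow> real^'n^'n" where
  "hessian f x = (\<chi> i j. partial_deriv i (partial_deriv j f) x)"


section \<open>Viscosity solutions of the obstacle problem\<close>

text \<open>
  Functions of space and time are curried total functions; only their values for times in
  \<open>{0..<T}\<close> matter below. Test functions are \<open>C\<^sup>2\<close> on the whole of space-time, and \<open>u - \<phi>\<close> is
  extremal over the whole domain of \<open>u\<close>.
\<close>

definition viscosity_subsolution ::
  "real \<Rightarrow> (real^'n \<Rightarrow> real^'n^'n \<Rightarrow> real) \<Rightarrow> (real^'n \<Rightarrow> real \<Rightarrow> real) \<Rightarrow>
   (real^'n \<Rightarrow> real \<Rightarrow> real) \<Rightarrow> (real^'n \<Rightarrow> real \<Rightarrow> real) \<Rightarrow> (real^'n \<Rightarrow> real) \<Rightarrow>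
   (real^'n \<Rightarrow> real \<Rightarrow> real) \<Rightarrow> bool" where
  "viscosity_subsolution T F k um up u0 u \<longleftrightarrow>
     usc_on (UNIV \<times> {0..<T}) (\<lambda>(x, t). u x t) \<and>
     (\<forall>x. \<forall>t\<in>{0..<T}. um x t \<le> u x t \<and> u x t \<le> up x t) \<and>
     (\<forall>x. u x 0 \<le> u0 x) \<and>
     (\<forall>\<phi> :: real^'n \<Rightarrow> real \<Rightarrow> real. \<forall>x. \<forall>t\<in>{0<..<T}.
        C2 (\<lambda>(y, s). \<phi> y s) \<and>
        (\<forall>y. \<forall>s\<in>{0..<T}. u y s - \<phi> y s \<le> u x t - \<phi> x t) \<and>
        um x t < u x t \<longrightarrow>
        ereal (deriv (\<lambda>s. \<phi> x s) t)
          + F_lower F (grad (\<lambda>y. \<phi> y t) x) (hessian (\<lambda>y. \<phi> y t) x)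
          + ereal (k x t * norm (grad (\<lambda>y. \<phi> y t) x)) \<le> 0)"

definition viscosity_supersolution ::
  "real \<Rightarrow> (real^'n \<Rightarrow> real^'n^'n \<Rightarrow> real) \<Rightarrow> (real^'n \<Rightarrow> real \<Rightarrow> real) \<Rightarrow>
   (real^'n \<Rightarrow> real \<Rightarrow> real) \<Rightarrow> (real^'n \<Rightarrow> real \<Rightarrow> real) \<Rightarrow> (real^'n \<Rightarrow> real) \<Rightarrow>
   (real^'n \<Rightarrow> real \<Rightarrow> real) \<Rightarrow> bool" where
  "viscosity_supersolution T F k um up u0 u \<longleftrightarrow>
     lsc_on (UNIV \<times> {0..<T}) (\<lambda>(x, t). u x t) \<and>
     (\<forall>x. \<forall>t\<in>{0..<T}. um x t \<le> u x t \<and> u x t \<le> up x t) \<and>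
     (\<forall>x. u0 x \<le> u x 0) \<and>
     (\<forall>\<phi> :: real^'n \<Rightarrow> real \<Rightarrow> real. \<forall>x. \<forall>t\<in>{0<..<T}.
        C2 (\<lambda>(y, s). \<phi> y s) \<and>
        (\<forall>y. \<forall>s\<in>{0..<T}. u x t - \<phi> x t \<le> u y s - \<phi> y s) \<and>
        u x t < up x t \<longrightarrow>
        ereal (deriv (\<lambda>s. \<phi> x s) t)
          + F_upper F (grad (\<lambda>y. \<phi> y t) x) (hessian (\<lambda>y. \<phi> y t) x)
          + ereal (k x t * norm (grad (\<lambda>y. \<phi> y t) x)) \<ge> 0)"

definition viscosity_solution ::
  "real \<Rightarrow> (real^'n \<Rightarrow> real^'n^'n \<Rightarrow> real) \<Rightarrow> (real^'n \<Rightarrow> real \<Rightarrow> real) \<Rightarrow>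
   (real^'n \<Rightarrow> real \<Rightarrow> real) \<Rightarrow> (real^'n \<Rightarrow> real \<Rightarrow> real) \<Rightarrow> (real^'n \<Rightarrow> real) \<Rightarrow>
   (real^'n \<Rightarrow> real \<Rightarrow> real) \<Rightarrow> bool" where
  "viscosity_solution T F k um up u0 u \<longleftrightarrow>
     viscosity_subsolution T F k um up u0 u \<and> viscosity_supersolution T F k um up u0 u"

text \<open>Uniqueness is on \<open>{0..<T}\<close>, since the values of \<open>u\<close> at other times carry no information.\<close>

definition unique_viscosity_solution ::
  "real \<Rightarrow> (real^'n \<Rightarrow> real^'n^'n \<Rightarrow> real) \<Rightarrow> (real^'n \<Rightarrow> real \<Rightarrow> real) \<Rightarrow>
   (real^'n \<Rightarrow> real \<Rightarrow> real) \<Rightarrow> (real^'n \<Rightarrow> real \<Rightarrow> real) \<Rightarrow> (real^'n \<Rightarrow> real) \<Rightarrow>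
   (real^'n \<Rightarrow> real \<Rightarrow> real) \<Rightarrow> bool" where
  "unique_viscosity_solution T F k um up u0 u \<longleftrightarrow>
     viscosity_solution T F k um up u0 u \<and>
     (\<forall>v. viscosity_solution T F k um up u0 v \<longrightarrow> (\<forall>x. \<forall>t\<in>{0..<T}. v x t = u x t))"


section \<open>Moduli of continuity\<close>

definition is_modulus :: "(real \<Rightarrow> real) \<Rightarrow> bool" where
  "is_modulus \<omega> \<longleftrightarrow> mono_on {0..} \<omega> \<and> (\<forall>r\<ge>0. 0 \<le> \<omega> r) \<and> (\<omega> \<longlongrightarrow> 0) (at_right 0)"

definition modulus_of_continuity_on ::
  "'a::metric_space set \<Rightarrow> ('a \<Rightarrow> real) \<Rightarrow> (real \<Rightarrow> real) \<Rightarrow> bool" where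
  "modulus_of_continuity_on S f \<omega> \<longleftrightarrow> is_modulus \<omega> \<and> (\<forall>x\<in>S. \<forall>y\<in>S. \<bar>f x - f y\<bar> \<le> \<omega> (dist x y))"

end

theory Submission
  imports Defs
begin

text \<open>
  The solution is identified with the greatest element \<open>W\<close> of a class of strong subsolutions, and \<open>W\<close>
  inherits the modulus from an invariance of this class; no doubling of variables is needed. A strong
  subsolution satisfies the differential inequality where its test function has nonzero gradient, and
  at critical points of the test function only test functions \<open>A \<theta>(c|x - x0|\<^sup>2)\<close> are used, where
  \<open>\<theta>\<close> is so flat at \<open>0\<close> that \<open>F\<close>, however singular at zero gradient, is controlled along it.

  If \<open>w\<close> is a strong subsolution, so is the maximum of the lower obstacle and
  \<open>sup {w(x + exp(-Lt) h, t) | |h| \<le> r} - \<omega>(r)\<close>: at a contact point the gradient of the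
  test function points along \<open>h\<close>, so the shrinking of the balls pays for the variation of \<open>k\<close>.
  Hence \<open>|W(x,t) - W(y,t)| \<le> \<omega>(exp(Lt)|x - y|)\<close>. Barriers built from \<open>\<theta>\<close> then give continuity in
  time, Perron's bump argument shows that \<open>W\<close> is a viscosity solution, and uniqueness gives \<open>u = W\<close>.
\<close>

section \<open>Quadratic polynomials in space-time\<close>

text \<open>Uniqueness is a hypothesis, so it is enough to exhibit one viscosity solution with the
  modulus. The obstacle is that \<open>F\<close> may be unbounded near zero gradient:
  \<open>F_lower\<close> can then be minus infinity, and an inequality for it carries no information
  that would survive a supremum, a sup-convolution or a comparison with a barrier. For strong
  subsolutions the critical case reads \<open>a \<le> 0\<close> instead. This is stable, since along
  the flat profile the term with \<open>F\<close> tends to zero together with the gradient. The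
  profile is the integral of a small function \<open>g\<close>, chosen against the size of
  \<open>F d (mat 2)\<close> and \<open>F (- d) (mat (- 2))\<close>; the geometric scaling reduces
  the jet of every flat function to these two values. The price is paid at the end, where the
  inequality with \<open>F_lower\<close> at zero gradient has to be recovered for arbitrary C^2 test
  functions. Only subsolutions are ever transformed: the supersolution inequality comes from
  maximality.\<close>

definition poly2 :: "real \<Rightarrow> real^'n \<Rightarrow> real^'n^'n \<Rightarrow> real \<Rightarrow> real^'n \<Rightarrow> real \<Rightarrow> real" where
  "poly2 a p X K h \<tau> = a * \<tau> + p \<bullet> h + (h \<bullet> (X *v h)) / 2 + K * \<tau>\<^sup>2"

lemma poly2_zero [simp]: "poly2 a p X K 0 0 = 0"
  by (simp add: poly2_def)

lemma sym_matrices_inner: "X \<in> sym_matrices \<Longrightarrow> v \<bullet> (X *v w) = w \<bullet> (X *v v)"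
  by (metis (mono_tags, lifting) dot_lmul_matrix inner_commute mem_Collect_eq sym_matrices_def
      transpose_matrix_vector)

lemma sym_matrices_add: "X \<in> sym_matrices \<Longrightarrow> Y \<in> sym_matrices \<Longrightarrow> X + Y \<in> sym_matrices"
  by (auto simp: sym_matrices_def transpose_def vec_eq_iff)

lemma sym_matrices_diff: "X \<in> sym_matrices \<Longrightarrow> Y \<in> sym_matrices \<Longrightarrow> X - Y \<in> sym_matrices"
  by (auto simp: sym_matrices_def transpose_def vec_eq_iff)

lemma sym_matrices_scaleR: "X \<in> sym_matrices \<Longrightarrow> c *\<^sub>R X \<in> sym_matrices"
  by (auto simp: sym_matrices_def transpose_def vec_eq_iff)

lemma sym_matrices_mat: "mat c \<in> sym_matrices"
  by (auto simp: sym_matrices_def)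

lemma sym_matrices_zero: "0 \<in> sym_matrices"
  by (auto simp: sym_matrices_def transpose_def vec_eq_iff)

lemma sym_matrices_outer_prod: "outer_prod p p \<in> sym_matrices"
  by (auto simp: sym_matrices_def outer_prod_def transpose_def vec_eq_iff)

lemmas sym_matrices_intros =
  sym_matrices_add sym_matrices_diff sym_matrices_scaleR sym_matrices_mat sym_matrices_zero
  sym_matrices_outer_prod

lemma outer_prod_vector: "outer_prod p q *v v = (q \<bullet> v) *\<^sub>R p"
  by (simp add: outer_prod_def matrix_vector_mult_def inner_vec_def vec_eq_iff sum_distrib_left
      sum_distrib_right mult_ac)

lemma mat_vector: "mat c *v (v :: real^'n) = c *\<^sub>R v"
proof -
  have "mat c *v v = (\<chi> i. c * v $ i)"
    by (simp add: matrix_vector_mult_def mat_def vec_eq_iff if_distrib if_distribR sum.delta cong: if_cong)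
  then show ?thesis by (simp add: vec_eq_iff)
qed

lemma scaleR_matrix_vector: "(c *\<^sub>R (X :: real^'n^'m)) *v v = c *\<^sub>R (X *v v)"
  by (simp add: scaleR_matrix_vector_assoc)

lemma minus_matrix_vector: "(- (X :: real^'n^'m)) *v v = - (X *v v)"
  using scaleR_matrix_vector[of "-1" X v] by simp

lemma poly2_add_mat: "poly2 a p (X + mat c) K h \<tau> = poly2 a p X K h \<tau> + c / 2 * (norm h)\<^sup>2"
  by (simp add: poly2_def matrix_vector_mult_add_rdistrib mat_vector inner_add_right power2_norm_eq_inner
      add_divide_distrib)

text \<open>Re-expansion at another base point: by symmetry of \<open>X\<close> the cross terms
  become the gradient shift \<open>X *v k\<close>, while \<open>X\<close> and \<open>K\<close> stay.
  A test polynomial thus remains of the same kind when the contact point moves.\<close>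

lemma poly2_shift:
  assumes "X \<in> sym_matrices"
  shows "poly2 a p X K (h + k) (\<tau> + \<sigma>) =
    poly2 a p X K k \<sigma> + poly2 (a + 2 * K * \<sigma>) (p + X *v k) X K h \<tau>"
  using sym_matrices_inner[OF assms, of k h]
  by (simp add: poly2_def algebra_simps power2_eq_square inner_commute)

lemma linear_quadratic_nonneg:
  fixes \<alpha> \<beta> :: real
  assumes "\<forall>\<^sub>F s in nhds 0. 0 \<le> \<alpha> * s + \<beta> * s\<^sup>2"
  shows "\<alpha> = 0" "0 \<le> \<beta>"
proof -
  from assms obtain d where d: "d > 0" "\<And>s. \<bar>s\<bar> < d \<Longrightarrow> 0 \<le> \<alpha> * s + \<beta> * s\<^sup>2"
    by (auto simp: eventually_nhds_metric dist_real_def)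
  show "\<alpha> = 0"
  proof (rule ccontr)
    assume "\<alpha> \<noteq> 0"
    \<comment> \<open>The step goes against the sign of \<open>\<alpha>\<close> and is so short that
      the quadratic term gains at most half of what the linear term loses.\<close>
    define s where "s = min (d / 2) (\<bar>\<alpha>\<bar> / (2 * (\<bar>\<beta>\<bar> + 1)))"
    have "s \<le> d / 2" unfolding s_def by (rule min.cobounded1)
    moreover have "0 < s" using d(1) \<open>\<alpha> \<noteq> 0\<close> by (auto simp: s_def)
    ultimately have s: "0 < s" "s < d" using d(1) by auto
    have "s \<le> \<bar>\<alpha>\<bar> / (2 * (\<bar>\<beta>\<bar> + 1))" unfolding s_def by (rule min.cobounded2)
    then have "s * (\<bar>\<beta>\<bar> + 1) \<le> \<bar>\<alpha>\<bar> / (2 * (\<bar>\<beta>\<bar> + 1)) * (\<bar>\<beta>\<bar> + 1)"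
      by (intro mult_right_mono) auto
    moreover have "\<bar>\<alpha>\<bar> / (2 * B) * B = \<bar>\<alpha>\<bar> / 2" if "B > 0" for B :: real
      using that by simp
    ultimately have s3: "s * (\<bar>\<beta>\<bar> + 1) \<le> \<bar>\<alpha>\<bar> / 2" by (metis abs_ge_zero add_nonneg_pos zero_less_one)
    have "0 \<le> \<alpha> * (- sgn \<alpha> * s) + \<beta> * (- sgn \<alpha> * s)\<^sup>2"
      using s by (intro d) (auto simp: abs_mult sgn_if)
    also have "\<dots> = - \<bar>\<alpha>\<bar> * s + \<beta> * s\<^sup>2"
      using \<open>\<alpha> \<noteq> 0\<close> by (auto simp: sgn_if power2_eq_square)
    also have "\<beta> * s\<^sup>2 \<le> (s * (\<bar>\<beta>\<bar> + 1)) * s"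
      using mult_right_mono[of \<beta> "\<bar>\<beta>\<bar> + 1" "s\<^sup>2"] by (simp add: power2_eq_square mult_ac)
    also have "\<dots> \<le> \<bar>\<alpha>\<bar> / 2 * s" using s(1) s3 by (intro mult_right_mono) auto
    finally have "\<bar>\<alpha>\<bar> * s \<le> \<bar>\<alpha>\<bar> / 2 * s" by simp
    then show False using s(1) \<open>\<alpha> \<noteq> 0\<close> by simp
  qed
  then have "0 \<le> \<beta> * (d / 2)\<^sup>2" using d(2)[of "d / 2"] d(1) by simp
  then show "0 \<le> \<beta>" using d(1) by (simp add: zero_le_mult_iff)
qed

lemma eventually_nhds_line:
  fixes v :: "'a::real_normed_vector"
  assumes "eventually P (nhds (0::'a))"
  shows "\<forall>\<^sub>F s in nhds (0::real). P (s *\<^sub>R v)"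
proof -
  have "((\<lambda>s::real. s *\<^sub>R v) \<longlongrightarrow> 0 *\<^sub>R v) (nhds 0)"
    by (intro tendsto_intros tendsto_ident_at) (simp add: filterlim_ident)
  then show ?thesis using assms by (simp add: filterlim_iff)
qed

text \<open>Restriction to lines through the origin: the time axis gives \<open>a\<close>, the space
  lines give \<open>p\<close> and the ordering of the forms. First order terms agree because both
  signs of the parameter are available.\<close>

lemma poly2_le_imp:
  fixes X0 X :: "real^'n^'n"
  assumes "\<forall>\<^sub>F (h, \<tau>) in nhds 0. poly2 a0 p0 X0 K0 h \<tau> \<le> poly2 a p X K h \<tau>"
  shows "a = a0" "p = p0" "loewner_le X0 X"
proof -
  have "\<forall>\<^sub>F s in nhds 0. 0 \<le> (a - a0) * s + (K - K0) * s\<^sup>2"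
    using eventually_nhds_line[OF assms, of "(0, 1)"]
    by eventually_elim (auto simp: poly2_def algebra_simps)
  from linear_quadratic_nonneg(1)[OF this] show "a = a0" by simp
  have *: "\<forall>\<^sub>F s in nhds 0. 0 \<le> ((p - p0) \<bullet> v) * s + ((v \<bullet> (X *v v) - v \<bullet> (X0 *v v)) / 2) * s\<^sup>2" for v
    using eventually_nhds_line[OF assms, of "(v, 0)"]
    by eventually_elim (auto simp: poly2_def algebra_simps power2_eq_square diff_divide_distrib)
  have "(p - p0) \<bullet> (p - p0) = 0" by (rule linear_quadratic_nonneg(1)[OF *])
  then show "p = p0" by simp
  show "loewner_le X0 X"
    using linear_quadratic_nonneg(2)[OF *] by (auto simp: loewner_le_def)
qed

lemma matrix_vector_bound: "\<exists>c>0. \<forall>v. norm ((X :: real^'n^'n) *v v) \<le> c * norm v"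
proof -
  have "bounded_linear ((*v) X)" by (rule matrix_vector_mul_bounded_linear)
  from bounded_linear.pos_bounded[OF this] show ?thesis by (auto simp: mult.commute)
qed

lemma quadratic_form_bound: "\<exists>c>0. \<forall>v w. \<bar>v \<bullet> ((X :: real^'n^'n) *v w)\<bar> \<le> c * norm v * norm w"
proof -
  from matrix_vector_bound[of X] obtain c where c: "c > 0" "\<And>v. norm (X *v v) \<le> c * norm v" by auto
  have "\<bar>v \<bullet> (X *v w)\<bar> \<le> c * norm v * norm w" for v w
    using order_trans[OF Cauchy_Schwarz_ineq2[of v "X *v w"] mult_left_mono[OF c(2)[of w] norm_ge_zero[of v]]]
    by (simp add: mult_ac)
  with c(1) show ?thesis by blast
qed

lemma continuous_on_poly2: "continuous_on S (\<lambda>z. poly2 a p X K (fst z - x) (snd z - t))"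
  unfolding poly2_def
  by (intro continuous_intros linear_continuous_on_compose[where g = "(*v) X"] matrix_vector_mul_linear) simp


section \<open>Semicontinuous functions\<close>

text \<open>If no maximum existed, each point would have a neighbourhood on which \<open>f\<close>
  stays below some value of \<open>f\<close> on \<open>K\<close>. In a finite subcover the largest
  of these values is taken at a point of \<open>K\<close> that is covered as well, a
  contradiction.\<close>

lemma usc_on_attains_sup:
  fixes f :: "'a::metric_space \<Rightarrow> real"
  assumes "usc_on S f" "compact K" "K \<subseteq> S" "K \<noteq> {}"
  shows "\<exists>x\<in>K. \<forall>y\<in>K. f y \<le> f x"
proof (rule ccontr)
  assume "\<not> ?thesis"
  then have *: "\<forall>x\<in>K. \<exists>y\<in>K. f x < f y" by (auto simp: not_le)
  have "\<forall>x\<in>K. \<exists>U y. open U \<and> x \<in> U \<and> y \<in> K \<and> (\<forall>z\<in>U \<inter> S. f z < f y)"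
  proof
    fix x assume x: "x \<in> K"
    with * obtain y where y: "y \<in> K" "f x < f y" by auto
    with x assms have "\<forall>\<^sub>F z in at x within S. f z < f y" by (auto simp: usc_on_def)
    then obtain U where "open U" "x \<in> U" "\<And>z. z \<in> U \<Longrightarrow> z \<noteq> x \<Longrightarrow> z \<in> S \<Longrightarrow> f z < f y"
      by (auto simp: eventually_at_topological)
    with y show "\<exists>U y. open U \<and> x \<in> U \<and> y \<in> K \<and> (\<forall>z\<in>U \<inter> S. f z < f y)" by (metis IntD1 IntD2)
  qed
  then obtain U y where U: "\<And>x. x \<in> K \<Longrightarrow> open (U x) \<and> x \<in> U x \<and> y x \<in> K \<and> (\<forall>z\<in>U x \<inter> S. f z < f (y x))"
    by metis
  obtain C where C: "C \<subseteq> K" "finite C" "K \<subseteq> (\<Union>x\<in>C. U x)"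
    using compactE_image[OF assms(2), of K U] U by blast
  with assms(4) have ne: "C \<noteq> {}" by auto
  have "Max ((\<lambda>x. f (y x)) ` C) \<in> (\<lambda>x. f (y x)) ` C" using C(2) ne by (intro Max_in) auto
  then obtain x where x0: "x \<in> C" "f (y x) = Max ((\<lambda>x. f (y x)) ` C)" by auto
  then have x: "x \<in> C" "\<And>x'. x' \<in> C \<Longrightarrow> f (y x') \<le> f (y x)" using C(2) by auto
  have "y x \<in> K" using x C U by auto
  with C obtain x' where x': "x' \<in> C" "y x \<in> U x'" by auto
  then have "f (y x) < f (y x')" using U[of x'] C \<open>y x \<in> K\<close> assms(3) by auto
  with x(2)[OF x'(1)] show False by simp
qed

lemma usc_on_diff_continuous:
  fixes f :: "'a::metric_space \<Rightarrow> real"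
  assumes "usc_on S f" "continuous_on S g"
  shows "usc_on S (\<lambda>x. f x - g x)"
  unfolding usc_on_def
proof (intro ballI allI impI)
  fix x c assume x: "x \<in> S" "f x - g x < c"
  define e where "e = (c - (f x - g x)) / 2"
  have e: "e > 0" using x by (simp add: e_def)
  have "\<forall>\<^sub>F y in at x within S. f y < f x + e" using assms(1) x e by (auto simp: usc_on_def)
  moreover have "(g \<longlongrightarrow> g x) (at x within S)" using assms(2) x by (auto simp: continuous_on)
  then have "\<forall>\<^sub>F y in at x within S. g x - e < g y" using e by (auto intro: order_tendstoD)
  ultimately show "\<forall>\<^sub>F y in at x within S. f y - g y < c"
    by eventually_elim (auto simp: e_def field_simps)
qed

lemma continuous_on_imp_usc_on: "continuous_on S f \<Longrightarrow> usc_on S f"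
  unfolding usc_on_def continuous_on_def by (auto intro: order_tendstoD)

lemma continuous_on_imp_lsc_on: "continuous_on S f \<Longrightarrow> lsc_on S f"
  unfolding lsc_on_def continuous_on_def by (auto intro: order_tendstoD)

lemma usc_onD:
  assumes "usc_on S f" "x \<in> S" "f x < c"
  shows "\<exists>d>0. \<forall>y\<in>S. dist y x < d \<longrightarrow> f y < c"
proof -
  from assms have "\<forall>\<^sub>F y in at x within S. f y < c" by (auto simp: usc_on_def)
  then obtain d where "d > 0" "\<And>y. y \<in> S \<Longrightarrow> y \<noteq> x \<Longrightarrow> dist y x < d \<Longrightarrow> f y < c"
    by (auto simp: eventually_at)
  with assms(3) show ?thesis by metis
qed

lemma usc_onI:
  assumes "\<And>x c. x \<in> S \<Longrightarrow> f x < c \<Longrightarrow> \<exists>d>0. \<forall>y\<in>S. dist y x < d \<longrightarrow> f y < c"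
  shows "usc_on S f"
  unfolding usc_on_def eventually_at using assms by meson

section \<open>Functions that are flat relative to a given singularity\<close>

lemma integral_bounds:
  fixes g :: "real \<Rightarrow> real"
  assumes "continuous_on {a..b} g" "a \<le> b"
  shows "(\<And>s. s \<in> {a..b} \<Longrightarrow> g s \<le> M) \<Longrightarrow> integral {a..b} g \<le> (b - a) * M"
    and "(\<And>s. s \<in> {a..b} \<Longrightarrow> M \<le> g s) \<Longrightarrow> (b - a) * M \<le> integral {a..b} g"
proof -
  have i: "g integrable_on {a..b}" using assms by (intro integrable_continuous_real)
  have c: "integral {a..b} (\<lambda>_. M) = (b - a) * M" using assms(2) by simp
  show "integral {a..b} g \<le> (b - a) * M" if "\<And>s. s \<in> {a..b} \<Longrightarrow> g s \<le> M"
    using integral_le[OF i integrable_const_ivl[of M a b]] that c by auto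
  show "(b - a) * M \<le> integral {a..b} g" if "\<And>s. s \<in> {a..b} \<Longrightarrow> M \<le> g s"
    using integral_le[OF integrable_const_ivl[of M a b] i] that c by auto
qed

text \<open>Infimal convolution with the absolute value, the largest 1-Lipschitz function below
  \<open>b\<close>. It stays positive because a competitor \<open>r\<close> costs at least
  \<open>b (s / 2)\<close> if \<open>s / 2 \<le> r\<close>, and more than \<open>s / 2\<close>
  otherwise; the explicit bound is integrated later.\<close>

lemma lipschitz_positive_minorant:
  fixes b :: "real \<Rightarrow> real"
  assumes mono: "\<And>s t. 0 \<le> s \<Longrightarrow> s \<le> t \<Longrightarrow> b s \<le> b t"
    and pos: "\<And>s. 0 < s \<Longrightarrow> 0 < b s" and nonneg: "0 \<le> b 0"
  shows "\<exists>g. (\<forall>s\<ge>0. 0 \<le> g s \<and> g s \<le> b s) \<and>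
    (\<forall>s>0. 0 < min (b (s / 2)) (s / 2) \<and> min (b (s / 2)) (s / 2) \<le> g s) \<and>
    (\<forall>s\<ge>0. \<forall>t\<ge>0. g s \<le> g t + \<bar>s - t\<bar>)"
proof -
  define g where "g s = (INF r\<in>{0..}. b r + \<bar>s - r\<bar>)" for s :: real
  have b0: "0 \<le> b r" if "0 \<le> r" for r using pos[of r] nonneg that by (cases "r = 0") auto
  have bdd: "bdd_below ((\<lambda>r. b r + \<bar>s - r\<bar>) ` {0..})" for s
    by (intro bdd_belowI[of _ 0]) (auto intro!: add_nonneg_nonneg b0)
  have low: "g s \<le> b r + \<bar>s - r\<bar>" if "0 \<le> r" for s r
    unfolding g_def using that by (intro cINF_lower bdd) auto
  have great: "m \<le> g s" if "\<And>r. 0 \<le> r \<Longrightarrow> m \<le> b r + \<bar>s - r\<bar>" for m s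
    unfolding g_def using that by (intro cINF_greatest) auto
  have "g s \<le> b s" if "0 \<le> s" for s using low[of s s] that by simp
  moreover have "0 \<le> g s" for s by (intro great add_nonneg_nonneg b0) auto
  moreover have "0 < min (b (s / 2)) (s / 2)" if "0 < s" for s using that pos by auto
  moreover have "min (b (s / 2)) (s / 2) \<le> g s" if "0 < s" for s
  proof (rule great)
    fix r :: real assume r: "0 \<le> r"
    show "min (b (s / 2)) (s / 2) \<le> b r + \<bar>s - r\<bar>"
    proof (cases "s / 2 \<le> r")
      case True
      then have "b (s / 2) \<le> b r" using that by (intro mono) auto
      then show ?thesis by linarith
    next
      case False
      then show ?thesis using b0[OF r] by linarith
    qed
  qed
  moreover have "g s \<le> g t + \<bar>s - t\<bar>" for s t
  proof -
    have "g s - \<bar>s - t\<bar> \<le> g t"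
    proof (rule great)
      fix r :: real assume "0 \<le> r"
      from low[OF this, of s] show "g s - \<bar>s - t\<bar> \<le> b r + \<bar>t - r\<bar>" by linarith
    qed
    then show ?thesis by simp
  qed
  ultimately show ?thesis by blast
qed

text \<open>In the application \<open>m\<close> is the size of \<open>F\<close> near zero gradient,
  with no control as \<open>d\<close> tends to 0. The antiderivative of a 1-Lipschitz
  \<open>g\<close> that is small against the reciprocal of \<open>m\<close> is flat enough, and the
  Lipschitz bound yields the quadratic remainder in the upper estimate. The factor \<open>c\<close>
  is harmless: \<open>c * norm d \<le> 1\<close> makes c|d|^2 at most |d|, so the bound taken at
  radius c|d|^2 already includes \<open>m d\<close>.\<close>

lemma flat_function_exists:
  fixes m :: "'a::real_normed_vector \<Rightarrow> real"
  assumes bdd: "\<And>r. 0 < r \<Longrightarrow> bounded (m ` {d. r \<le> norm d \<and> norm d \<le> 1})"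
  obtains \<theta> g :: "real \<Rightarrow> real" where "\<theta> 0 = 0"
    "\<And>s t. 0 \<le> s \<Longrightarrow> s \<le> t \<Longrightarrow> \<theta> s \<le> \<theta> t"
    "\<And>s. 0 < s \<Longrightarrow> 0 < \<theta> s" "\<And>s. 0 < s \<Longrightarrow> 0 < g s" "\<And>s. 0 \<le> s \<Longrightarrow> g s \<le> s"
    "\<And>s s1. 0 \<le> s \<Longrightarrow> 0 \<le> s1 \<Longrightarrow> \<theta> s \<le> \<theta> s1 + g s1 * (s - s1) + (s - s1)\<^sup>2"
    "\<And>c d. 0 < c \<Longrightarrow> d \<noteq> 0 \<Longrightarrow> norm d \<le> 1 \<Longrightarrow> c * norm d \<le> 1 \<Longrightarrow>
      g (c * (norm d)\<^sup>2) * \<bar>m d\<bar> \<le> c * (norm d)\<^sup>2"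
proof -
  define S where "S r = {d :: 'a. r \<le> norm d \<and> norm d \<le> 1}" for r :: real
  define B where "B r = Sup (insert 0 ((\<lambda>d. \<bar>m d\<bar>) ` S r))" for r :: real
  have bdd': "bdd_above (insert 0 ((\<lambda>d. \<bar>m d\<bar>) ` S r))" if "0 < r" for r
  proof -
    from bdd[OF that] obtain C where "\<And>d. d \<in> S r \<Longrightarrow> \<bar>m d\<bar> \<le> C"
      by (auto simp: bounded_iff S_def)
    then show ?thesis by (auto intro!: bdd_aboveI[of _ "C"] simp: bdd_above_insert)
  qed
  have B0: "0 \<le> B r" if "0 < r" for r
    unfolding B_def using bdd'[OF that] by (intro cSup_upper) auto
  have B_ge: "\<bar>m d\<bar> \<le> B r" if "0 < r" "r \<le> norm d" "norm d \<le> 1" for r d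
    unfolding B_def using bdd'[OF that(1)] that by (intro cSup_upper) (auto simp: S_def)
  have B_anti: "B t \<le> B s" if "0 < s" "s \<le> t" for s t
    unfolding B_def using that by (intro cSup_subset_mono bdd') (auto simp: S_def)
  \<comment> \<open>\<open>B s\<close> bounds the absolute value of \<open>m\<close> for
    \<open>s \<le> norm d \<le> 1\<close>, so \<open>b s * \<bar>m d\<bar> \<le> s\<close> for such
    \<open>d\<close>. Since \<open>B\<close> decreases, \<open>b\<close> increases, as the Lipschitz
    minorant requires.\<close>
  define b where "b s = (if s \<le> 0 then 0 else s / (1 + B s))" for s :: real
  have b_mono: "b s \<le> b t" if "0 \<le> s" "s \<le> t" for s t
    using B_anti[of s t] B0[of t] B0[of s] that by (auto simp: b_def intro!: frac_le divide_nonneg_nonneg)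
  have b_pos: "0 < b s" if "0 < s" for s using B0[OF that] that by (auto simp: b_def)
  have b_le: "b s \<le> s" if "0 \<le> s" for s
    using B0[of s] that by (auto simp: b_def divide_le_eq mult_le_cancel_left1)
  have b_zero: "0 \<le> b 0" by (simp add: b_def)
  obtain g where "(\<forall>s\<ge>0. 0 \<le> g s \<and> g s \<le> b s) \<and>
    (\<forall>s>0. 0 < min (b (s / 2)) (s / 2) \<and> min (b (s / 2)) (s / 2) \<le> g s) \<and>
    (\<forall>s\<ge>0. \<forall>t\<ge>0. g s \<le> g t + \<bar>s - t\<bar>)"
    using lipschitz_positive_minorant[of b, OF b_mono b_pos b_zero] ..
  then have g: "\<And>s. 0 \<le> s \<Longrightarrow> 0 \<le> g s" "\<And>s. 0 \<le> s \<Longrightarrow> g s \<le> b s"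
    "\<And>s. 0 < s \<Longrightarrow> 0 < min (b (s / 2)) (s / 2)" "\<And>s. 0 < s \<Longrightarrow> min (b (s / 2)) (s / 2) \<le> g s"
    "\<And>s t. 0 \<le> s \<Longrightarrow> 0 \<le> t \<Longrightarrow> g s \<le> g t + \<bar>s - t\<bar>"
    by blast+
  have g_pos: "0 < g s" if "0 < s" for s using g(3,4)[OF that] by linarith
  have "1-lipschitz_on {0..} g"
  proof (rule lipschitz_onI)
    fix s t :: real assume "s \<in> {0..}" "t \<in> {0..}"
    then show "dist (g s) (g t) \<le> 1 * dist s t" using g(5)[of s t] g(5)[of t s] by (auto simp: dist_real_def)
  qed simp
  then have cont: "continuous_on {0..} g" by (rule lipschitz_on_continuous_on)
  then have cont': "continuous_on {s..t} g" if "0 \<le> s" for s t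
    by (rule continuous_on_subset) (use that in auto)
  define \<theta> where "\<theta> s = integral {0..s} g" for s
  have diff: "\<theta> t = \<theta> s + integral {s..t} g" if "0 \<le> s" "s \<le> t" for s t
    unfolding \<theta>_def using that
    by (intro Henstock_Kurzweil_Integration.integral_combine[symmetric] integrable_continuous_real cont') auto
  have mono: "\<theta> s \<le> \<theta> t" if "0 \<le> s" "s \<le> t" for s t
    using diff[OF that] integral_bounds(2)[OF cont'[OF that(1)] that(2), of 0] g(1) that by force
  have pos: "0 < \<theta> s" if s: "0 < s" for s
  proof -
    \<comment> \<open>The second half of the interval suffices: there the lower bound for
      \<open>g r\<close> involves \<open>b (r / 2)\<close>, which is at least
      \<open>b (s / 4)\<close>.\<close>
    define M where "M = min (b (s / 4)) (s / 4)"
    have "M \<le> g r" if "r \<in> {s/2..s}" for r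
    proof -
      have "b (s / 4) \<le> b (r / 2)" using s that by (intro b_mono) auto
      then show ?thesis using g(4)[of r] s that by (auto simp: M_def)
    qed
    then have "(s - s / 2) * M \<le> integral {s/2..s} g"
      using s by (intro integral_bounds(2) cont') auto
    moreover have "0 < M" using s b_pos by (auto simp: M_def)
    moreover have "0 \<le> \<theta> (s / 2)" using mono[of 0 "s / 2"] s by (simp add: \<theta>_def)
    moreover have "0 < (s - s / 2) * M" using s \<open>0 < M\<close> by simp
    ultimately show ?thesis using diff[of "s / 2" s] s by linarith
  qed
  have upper: "\<theta> s \<le> \<theta> s1 + g s1 * (s - s1) + (s - s1)\<^sup>2" if "0 \<le> s" "0 \<le> s1" for s s1
  proof (cases "s1 \<le> s")
    case True
    have "integral {s1..s} g \<le> (s - s1) * (g s1 + (s - s1))"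
    proof (intro integral_bounds(1) cont' True that)
      fix r assume "r \<in> {s1..s}"
      then show "g r \<le> g s1 + (s - s1)" using g(5)[of r s1] that by auto
    qed
    then show ?thesis using diff[OF that(2) True] by (simp add: algebra_simps power2_eq_square)
  next
    case False
    have "(s1 - s) * (g s1 - (s1 - s)) \<le> integral {s..s1} g"
    proof (intro integral_bounds(2) cont' that)
      fix r assume "r \<in> {s..s1}"
      then show "g s1 - (s1 - s) \<le> g r" using g(5)[of s1 r] that by auto
    qed (use False in auto)
    then show ?thesis using diff[OF that(1), of s1] False by (simp add: algebra_simps power2_eq_square)
  qed
  have flat: "g (c * (norm d)\<^sup>2) * \<bar>m d\<bar> \<le> c * (norm d)\<^sup>2"
    if "0 < c" "d \<noteq> 0" "norm d \<le> 1" "c * norm d \<le> 1" for c and d :: 'a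
  proof -
    let ?s = "c * (norm d)\<^sup>2"
    have s: "0 < ?s" "?s \<le> norm d"
      using that mult_right_mono[of "c * norm d" 1 "norm d"] by (auto simp: power2_eq_square mult_ac)
    have "g ?s * \<bar>m d\<bar> \<le> ?s / (1 + B ?s) * B ?s"
      using g(1,2)[of ?s] s B_ge[OF s that(3)] by (intro mult_mono) (auto simp: b_def)
    also have "\<dots> \<le> ?s * 1"
      using s B0[OF s(1)] by (auto simp: field_simps)
    finally show ?thesis by simp
  qed
  have "\<theta> 0 = 0" by (simp add: \<theta>_def)
  moreover have "g s \<le> s" if "0 \<le> s" for s using g(2)[OF that] b_le[OF that] by linarith
  ultimately show ?thesis using that[of \<theta> g, OF _ mono pos g_pos _ upper flat] by simp
qed

section \<open>Second order expansions of test functions\<close>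

lemma le_zero_if_le_all_mult:
  fixes D C :: real
  assumes "\<And>\<epsilon>. 0 < \<epsilon> \<Longrightarrow> D \<le> \<epsilon> * C" "0 \<le> C"
  shows "D \<le> 0"
proof (rule field_le_epsilon)
  fix e :: real assume "0 < e"
  then have "D \<le> e / (C + 1) * C" using assms by (intro assms(1)) auto
  also have "\<dots> \<le> e" using \<open>0 < e\<close> assms(2) by (auto simp: field_simps)
  finally show "D \<le> 0 + e" by simp
qed

lemma second_derivative_taylor:
  fixes f :: "'a::real_normed_vector \<Rightarrow> real" and f' :: "'a \<Rightarrow> 'a \<Rightarrow>\<^sub>L real"
    and B :: "'a \<Rightarrow>\<^sub>L 'a \<Rightarrow>\<^sub>L real"
  assumes f: "\<And>z. (f has_derivative blinfun_apply (f' z)) (at z)"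
    and B: "(f' has_derivative blinfun_apply B) (at z)" and "0 < \<epsilon>"
  shows "\<forall>\<^sub>F k in nhds 0. \<bar>f (z + k) - f z - f' z k - B k k / 2\<bar> \<le> \<epsilon> * (norm k)\<^sup>2"
proof -
  from B \<open>0 < \<epsilon>\<close> obtain d where d: "d > 0"
    "\<And>y. norm (y - z) < d \<Longrightarrow> norm (f' y - f' z - B (y - z)) \<le> \<epsilon> * norm (y - z)"
    unfolding has_derivative_at_alt by meson
  have "\<bar>f (z + k) - f z - f' z k - B k k / 2\<bar> \<le> \<epsilon> * (norm k)\<^sup>2" if k: "norm k < d" for k
  proof -
    \<comment> \<open>The remainder is \<open>\<psi> 1 - \<psi> 0\<close>, and the derivative of
      \<open>\<psi>\<close> is the error in the linearization of \<open>f'\<close> at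
      \<open>z\<close>, evaluated at \<open>k\<close>; so the mean value theorem reduces the claim
      to differentiability of \<open>f'\<close> at the single point \<open>z\<close>.\<close>
    define \<psi> where "\<psi> s = f (z + s *\<^sub>R k) - s * f' z k - s\<^sup>2 / 2 * B k k" for s
    have deriv: "(\<psi> has_real_derivative (f' (z + s *\<^sub>R k) k - f' z k - s * B k k)) (at s)" for s
      unfolding \<psi>_def has_field_derivative_def
      by (rule derivative_eq_intros has_derivative_compose[where g = f, OF _ f] refl)+
        (auto simp: fun_eq_iff blinfun.scaleR_right algebra_simps)
    obtain s where s: "0 < s" "s < 1" "\<psi> 1 - \<psi> 0 = f' (z + s *\<^sub>R k) k - f' z k - s * B k k"
      using MVT2[OF zero_less_one deriv] by auto
    have "s * norm k < d" using s k mult_left_le_one_le[of "norm k" s] by auto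
    then have "norm (f' (z + s *\<^sub>R k) - f' z - B (s *\<^sub>R k)) \<le> \<epsilon> * (s * norm k)"
      using d(2)[of "z + s *\<^sub>R k"] s by simp
    also have "\<dots> \<le> \<epsilon> * norm k"
      using s \<open>0 < \<epsilon>\<close> mult_left_le_one_le[of "norm k" s] by (intro mult_left_mono) auto
    finally have *: "norm (f' (z + s *\<^sub>R k) - f' z - B (s *\<^sub>R k)) \<le> \<epsilon> * norm k" .
    have "\<psi> 1 - \<psi> 0 = (f' (z + s *\<^sub>R k) - f' z - B (s *\<^sub>R k)) k"
      using s(3) by (simp add: blinfun.diff_left blinfun.scaleR_left blinfun.scaleR_right)
    then have "\<bar>\<psi> 1 - \<psi> 0\<bar> \<le> norm (f' (z + s *\<^sub>R k) - f' z - B (s *\<^sub>R k)) * norm k"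
      using norm_blinfun by (metis real_norm_def)
    also have "\<dots> \<le> \<epsilon> * norm k * norm k" using * by (intro mult_right_mono) auto
    finally show ?thesis by (simp add: \<psi>_def power2_eq_square algebra_simps)
  qed
  then show ?thesis using d(1) by (auto simp: eventually_nhds_metric)
qed

text \<open>The second difference over the parallelogram spanned by \<open>s *\<^sub>R u\<close> and
  \<open>s *\<^sub>R v\<close> is symmetric in \<open>u\<close> and \<open>v\<close>. The mean value
  theorem in direction \<open>u\<close> identifies it with \<open>s\<^sup>2 * B v u\<close> up to a
  small multiple of \<open>s\<^sup>2\<close>, and in direction \<open>v\<close> with
  \<open>s\<^sup>2 * B u v\<close>.\<close>

lemma second_derivative_symmetric:
  fixes f :: "'a::real_normed_vector \<Rightarrow> real" and f' :: "'a \<Rightarrow> 'a \<Rightarrow>\<^sub>L real"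
    and B :: "'a \<Rightarrow>\<^sub>L 'a \<Rightarrow>\<^sub>L real"
  assumes f: "\<And>z. (f has_derivative blinfun_apply (f' z)) (at z)"
    and B: "(f' has_derivative blinfun_apply B) (at z)"
  shows "B u v = B v u"
proof -
  have mixed: "\<exists>d>0. \<forall>s. 0 < s \<and> s < d \<longrightarrow>
      \<bar>f (z + s *\<^sub>R u + s *\<^sub>R v) - f (z + s *\<^sub>R u) - f (z + s *\<^sub>R v) + f z - s\<^sup>2 * B v u\<bar>
        \<le> \<epsilon> * s\<^sup>2 * (2 * norm u + norm v) * norm u" if "0 < \<epsilon>" for \<epsilon> and u v :: 'a
  proof -
    from B \<open>0 < \<epsilon>\<close> obtain d where d: "d > 0"
      "\<And>y. norm (y - z) < d \<Longrightarrow> norm (f' y - f' z - B (y - z)) \<le> \<epsilon> * norm (y - z)"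
      unfolding has_derivative_at_alt by meson
    define e where "e = d / (norm u + norm v + 1)"
    have pos: "0 < norm u + norm v + 1" by (simp add: add_nonneg_pos)
    then have e: "e > 0" "e * (norm u + norm v + 1) = d" using d(1) by (auto simp: e_def)
    have "\<bar>f (z + s *\<^sub>R u + s *\<^sub>R v) - f (z + s *\<^sub>R u) - f (z + s *\<^sub>R v) + f z - s\<^sup>2 * B v u\<bar>
        \<le> \<epsilon> * s\<^sup>2 * (2 * norm u + norm v) * norm u" if s: "0 < s" "s < e" for s
    proof -
      define \<psi> where "\<psi> r = f (z + s *\<^sub>R v + r *\<^sub>R u) - f (z + r *\<^sub>R u)" for r
      have deriv: "(\<psi> has_real_derivative (f' (z + s *\<^sub>R v + r *\<^sub>R u) u - f' (z + r *\<^sub>R u) u)) (at r)" for r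
        unfolding \<psi>_def has_field_derivative_def
        by (rule derivative_eq_intros has_derivative_compose[where g = f, OF _ f] refl)+
          (auto simp: fun_eq_iff blinfun.scaleR_right algebra_simps)
      obtain r where r: "0 < r" "r < s"
        "\<psi> s - \<psi> 0 = (s - 0) * (f' (z + s *\<^sub>R v + r *\<^sub>R u) u - f' (z + r *\<^sub>R u) u)"
        using MVT2[OF s(1) deriv] by blast
      have n1: "norm (s *\<^sub>R v + r *\<^sub>R u) \<le> s * (norm u + norm v)"
        using norm_triangle_ineq[of "s *\<^sub>R v" "r *\<^sub>R u"] r s mult_right_mono[of r s "norm u"]
        by (auto simp: algebra_simps)
      have n2: "norm (r *\<^sub>R u) \<le> s * norm u" using r s by (auto intro: mult_right_mono)
      have "s * (norm u + norm v + 1) < d"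
        using s(2) e(2) mult_strict_right_mono[OF s(2) pos] by simp
      moreover have "0 \<le> s * norm v" using s(1) by simp
      ultimately have "s * (norm u + norm v) < d" "s * norm u < d"
        using s(1) unfolding distrib_left by linarith+
      with n1 n2 have "norm (f' (z + s *\<^sub>R v + r *\<^sub>R u) - f' z - B (s *\<^sub>R v + r *\<^sub>R u)) \<le> \<epsilon> * norm (s *\<^sub>R v + r *\<^sub>R u)"
        "norm (f' (z + r *\<^sub>R u) - f' z - B (r *\<^sub>R u)) \<le> \<epsilon> * norm (r *\<^sub>R u)"
        using d(2)[of "z + s *\<^sub>R v + r *\<^sub>R u"] d(2)[of "z + r *\<^sub>R u"] by (auto simp: add.assoc)
      moreover have "\<epsilon> * norm (s *\<^sub>R v + r *\<^sub>R u) \<le> \<epsilon> * (s * (norm u + norm v))"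
        "\<epsilon> * norm (r *\<^sub>R u) \<le> \<epsilon> * (s * norm u)"
        using n1 n2 \<open>0 < \<epsilon>\<close> by (auto intro!: mult_left_mono)
      ultimately have N: "norm ((f' (z + s *\<^sub>R v + r *\<^sub>R u) - f' z - B (s *\<^sub>R v + r *\<^sub>R u))
          - (f' (z + r *\<^sub>R u) - f' z - B (r *\<^sub>R u))) \<le> \<epsilon> * s * (2 * norm u + norm v)" (is "norm ?D \<le> _")
        using norm_triangle_ineq4[of "f' (z + s *\<^sub>R v + r *\<^sub>R u) - f' z - B (s *\<^sub>R v + r *\<^sub>R u)"
            "f' (z + r *\<^sub>R u) - f' z - B (r *\<^sub>R u)"]
        by (auto simp: algebra_simps)
      have "\<psi> s - \<psi> 0 - s\<^sup>2 * B v u = s * ?D u"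
        using r(3) by (simp add: blinfun.diff_left blinfun.add_left blinfun.add_right blinfun.scaleR_left
            blinfun.scaleR_right algebra_simps power2_eq_square)
      also have "\<bar>s * ?D u\<bar> = s * \<bar>?D u\<bar>" using s(1) by (simp add: abs_mult)
      also have "\<bar>?D u\<bar> \<le> norm ?D * norm u" using norm_blinfun by (metis real_norm_def)
      also have "\<dots> \<le> \<epsilon> * s * (2 * norm u + norm v) * norm u" using N by (intro mult_right_mono) auto
      finally have "\<bar>\<psi> s - \<psi> 0 - s\<^sup>2 * B v u\<bar> \<le> s * (\<epsilon> * s * (2 * norm u + norm v) * norm u)"
        using s(1) by (simp add: mult_left_mono)
      then show ?thesis by (simp add: \<psi>_def power2_eq_square algebra_simps)
    qed
    then show ?thesis using e(1) by blast
  qed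
  define C where "C = (2 * norm u + norm v) * norm u + (2 * norm v + norm u) * norm v"
  have "\<bar>B v u - B u v\<bar> \<le> \<epsilon> * C" if \<epsilon>: "0 < \<epsilon>" for \<epsilon>
  proof -
    obtain d1 d2 where d: "d1 > 0" "d2 > 0"
      "\<And>s. 0 < s \<Longrightarrow> s < d1 \<Longrightarrow> \<bar>f (z + s *\<^sub>R u + s *\<^sub>R v) - f (z + s *\<^sub>R u) - f (z + s *\<^sub>R v) + f z - s\<^sup>2 * B v u\<bar>
        \<le> \<epsilon> * s\<^sup>2 * (2 * norm u + norm v) * norm u"
      "\<And>s. 0 < s \<Longrightarrow> s < d2 \<Longrightarrow> \<bar>f (z + s *\<^sub>R v + s *\<^sub>R u) - f (z + s *\<^sub>R v) - f (z + s *\<^sub>R u) + f z - s\<^sup>2 * B u v\<bar>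
        \<le> \<epsilon> * s\<^sup>2 * (2 * norm v + norm u) * norm v"
      using mixed[OF \<epsilon>, of u v] mixed[OF \<epsilon>, of v u] by blast
    define s where "s = min d1 d2 / 2"
    have s: "0 < s" "s < d1" "s < d2" using d by (auto simp: s_def)
    have eq: "f (z + s *\<^sub>R v + s *\<^sub>R u) - f (z + s *\<^sub>R v) - f (z + s *\<^sub>R u)
      = f (z + s *\<^sub>R u + s *\<^sub>R v) - f (z + s *\<^sub>R u) - f (z + s *\<^sub>R v)"
      by (simp add: add.assoc add.commute[of "s *\<^sub>R v" "s *\<^sub>R u"])
    have "\<bar>s\<^sup>2 * B v u - s\<^sup>2 * B u v\<bar> \<le> \<epsilon> * s\<^sup>2 * (2 * norm u + norm v) * norm u + \<epsilon> * s\<^sup>2 * (2 * norm v + norm u) * norm v"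
      using d(3)[OF s(1,2)] d(4)[OF s(1,3)] unfolding eq by arith
    then have "s\<^sup>2 * \<bar>B v u - B u v\<bar> \<le> s\<^sup>2 * (\<epsilon> * C)"
      unfolding right_diff_distrib[symmetric] abs_mult by (simp add: C_def algebra_simps)
    then show ?thesis using s(1) by simp
  qed
  moreover have "0 \<le> C" by (simp add: C_def)
  ultimately have "\<bar>B v u - B u v\<bar> \<le> 0" by (rule le_zero_if_le_all_mult)
  then show ?thesis by simp
qed

lemma linear_axis_sum:
  fixes l :: "real^'n \<Rightarrow> real"
  assumes "linear l"
  shows "l h = (\<Sum>i\<in>UNIV. h $ i * l (axis i 1))"
proof -
  have "l h = l (\<Sum>i\<in>UNIV. h $ i *\<^sub>R axis i 1)" using basis_expansion[of h] by (simp add: scalar_mult_eq_scaleR)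
  also have "\<dots> = (\<Sum>i\<in>UNIV. h $ i * l (axis i 1))"
    using assms by (simp add: linear_sum linear_scale)
  finally show ?thesis .
qed

lemma blinfun_scaleR_Pair:
  "blinfun_apply l (s *\<^sub>R v, 0) = s *\<^sub>R blinfun_apply l (v, 0 :: 'b::real_normed_vector)"
  using blinfun.scaleR_right[of l s "(v, 0)"] by simp

lemma blinfun_add_Pair:
  "blinfun_apply l (v + w, 0) = blinfun_apply l (v, 0) + blinfun_apply l (w, 0 :: 'b::real_normed_vector)"
  using blinfun.add_right[of l "(v, 0)" "(w, 0)"] by simp

text \<open>The error has to be small in space only: any finite multiple of
  \<open>\<tau>\<^sup>2\<close> is admissible, because the equation is of first order in time. The
  mixed derivative can therefore be absorbed, and \<open>poly2\<close> needs no mixed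
  coefficient.\<close>

lemma C2_expansion:
  fixes \<phi> :: "real^'n \<Rightarrow> real \<Rightarrow> real"
    and x :: "real^'n" and t \<epsilon> :: real
  assumes "C2 (\<lambda>(y, s). \<phi> y s)"
  defines "a \<equiv> deriv (\<lambda>s. \<phi> x s) t" and "p \<equiv> grad (\<lambda>y. \<phi> y t) x" and "X \<equiv> hessian (\<lambda>y. \<phi> y t) x"
  shows "X \<in> sym_matrices"
    and "0 < \<epsilon> \<Longrightarrow> \<exists>K\<ge>0. \<forall>\<^sub>F (h, \<tau>) in nhds 0.
      \<bar>\<phi> (x + h) (t + \<tau>) - \<phi> x t - poly2 a p X 0 h \<tau>\<bar> \<le> \<epsilon> * (norm h)\<^sup>2 + K * \<tau>\<^sup>2"
proof -
  define f where "f = (\<lambda>(y, s). \<phi> y s)"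
  from assms(1) obtain f' f'' where f: "\<And>z. (f has_derivative blinfun_apply (f' z)) (at z)"
    and f': "\<And>z. (f' has_derivative blinfun_apply (f'' z)) (at z)"
    unfolding C2_def f_def[symmetric] by blast
  define B where "B = f'' (x, t)"
  have B: "(f' has_derivative blinfun_apply B) (at (x, t))" unfolding B_def by (rule f')
  have a: "a = f' (x, t) (0, 1)"
  proof -
    have "((\<lambda>s. f (x, s)) has_real_derivative f' (x, t) (0, 1)) (at t)"
    proof -
      have "((\<lambda>s. (x, s)) has_derivative (\<lambda>s. (0, s))) (at t)"
        by (intro has_derivative_Pair has_derivative_const has_derivative_ident)
      from has_derivative_compose[OF this f] have "((\<lambda>s. f (x, s)) has_derivative (\<lambda>s. f' (x, t) (0, s))) (at t)" .
      moreover have "(\<lambda>s. f' (x, t) (0, s)) = (*) (f' (x, t) (0, 1))"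
      proof
        show "f' (x, t) (0, s) = f' (x, t) (0, 1) * s" for s
          using blinfun.scaleR_right[of "f' (x, t)" s "(0, 1)"] by simp
      qed
      ultimately show ?thesis by (simp add: has_field_derivative_def)
    qed
    then show ?thesis unfolding a_def f_def by (auto intro: DERIV_imp_deriv)
  qed
  have line: "((\<lambda>s. (y + s *\<^sub>R axis i 1, t)) has_derivative (\<lambda>s. s *\<^sub>R (axis i 1, 0))) (at 0)"
    for y :: "real^'n" and i
    by (rule derivative_eq_intros refl)+ (simp add: fun_eq_iff)
  have part: "partial_deriv i (\<lambda>y. \<phi> y t) y = f' (y, t) (axis i 1, 0)" for i y
  proof -
    have "((\<lambda>s. f (y + s *\<^sub>R axis i 1, t)) has_real_derivative f' (y, t) (axis i 1, 0)) (at 0)"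
      using has_derivative_compose[OF line[of y i] f]
      by (simp add: has_field_derivative_def blinfun_scaleR_Pair mult_commute_abs)
    then show ?thesis unfolding partial_deriv_def f_def by (auto intro: DERIV_imp_deriv)
  qed
  have part2: "partial_deriv i (partial_deriv j (\<lambda>y. \<phi> y t)) x = B (axis i 1, 0) (axis j 1, 0)" for i j
  proof -
    have "((\<lambda>s. f' (x + s *\<^sub>R axis i 1, t) (axis j 1, 0)) has_real_derivative
        f'' (x, t) (axis i 1, 0) (axis j 1, 0)) (at 0)"
      using bounded_linear.has_derivative[OF blinfun.bounded_linear_left[of "(axis j 1, 0)"]
          has_derivative_compose[OF line[of x i] f']]
      by (simp add: has_field_derivative_def blinfun_scaleR_Pair blinfun.scaleR_left mult_commute_abs)
    then show ?thesis unfolding partial_deriv_def[of i] part B_def by (auto intro: DERIV_imp_deriv)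
  qed
  have sym: "B u v = B v u" for u v by (rule second_derivative_symmetric[OF f B])
  show "X \<in> sym_matrices"
    unfolding X_def hessian_def sym_matrices_def transpose_def by (auto simp: part2 vec_eq_iff sym)
  have ph: "p \<bullet> h = f' (x, t) (h, 0)" for h
  proof -
    have "linear (\<lambda>h. f' (x, t) (h, 0))"
      by (rule linearI) (auto simp: blinfun_add_Pair blinfun_scaleR_Pair)
    from linear_axis_sum[OF this, of h] show ?thesis
      by (simp add: p_def grad_def part inner_vec_def mult.commute)
  qed
  have Xh: "h \<bullet> (X *v h) = B (h, 0) (h, 0)" for h
  proof -
    have "linear (\<lambda>h. B (k, 0) (h, 0))" for k
      by (rule linearI) (auto simp: blinfun_add_Pair blinfun_scaleR_Pair)
    note l1 = linear_axis_sum[OF this]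
    have "linear (\<lambda>k. B (k, 0) (h, 0))" for h
      by (rule linearI) (auto simp: blinfun_add_Pair blinfun_scaleR_Pair blinfun.add_left blinfun.scaleR_left)
    note l2 = linear_axis_sum[OF this]
    have "B (h, 0) (h, 0) = (\<Sum>i\<in>UNIV. h $ i * (\<Sum>j\<in>UNIV. h $ j * B (axis i 1, 0) (axis j 1, 0)))"
      by (subst l2, subst l1) simp
    then show ?thesis
      by (simp add: X_def hessian_def part2 inner_vec_def matrix_vector_mult_def mult.commute)
  qed
  assume "0 < \<epsilon>"
  define C where "C = norm B"
  have BC: "\<bar>B u v\<bar> \<le> C * norm u * norm v" for u v
  proof -
    have "\<bar>B u v\<bar> \<le> norm (B u) * norm v" using norm_blinfun[of "B u" v] by simp
    also have "\<dots> \<le> norm B * norm u * norm v" by (intro mult_right_mono norm_blinfun) auto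
    finally show ?thesis by (simp add: C_def)
  qed
  \<comment> \<open>The three contributions come from the Taylor remainder, the pure time
    derivative, and the mixed term after Young's inequality.\<close>
  define K where "K = \<epsilon> / 2 + C + C\<^sup>2 / \<epsilon>"
  have "\<forall>\<^sub>F k in nhds 0. \<bar>f ((x, t) + k) - f (x, t) - f' (x, t) k - B k k / 2\<bar> \<le> \<epsilon> / 2 * (norm k)\<^sup>2"
    using \<open>0 < \<epsilon>\<close> by (intro second_derivative_taylor[OF f B]) auto
  then have "\<forall>\<^sub>F (h, \<tau>) in nhds 0.
      \<bar>\<phi> (x + h) (t + \<tau>) - \<phi> x t - poly2 a p X 0 h \<tau>\<bar> \<le> \<epsilon> * (norm h)\<^sup>2 + K * \<tau>\<^sup>2"
  proof (rule eventually_mono, clarify)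
    fix h :: "real^'n" and \<tau> :: real
    assume *: "\<bar>f ((x, t) + (h, \<tau>)) - f (x, t) - f' (x, t) (h, \<tau>) - B (h, \<tau>) (h, \<tau>) / 2\<bar>
      \<le> \<epsilon> / 2 * (norm (h, \<tau>))\<^sup>2"
    have split: "(h, \<tau>) = (h, 0) + \<tau> *\<^sub>R (0, 1)" by simp
    have "f' (x, t) (h, \<tau>) = p \<bullet> h + a * \<tau>"
      unfolding split by (simp only: blinfun.add_right blinfun.scaleR_right ph a) simp
    moreover have "B (h, \<tau>) (h, \<tau>) = h \<bullet> (X *v h) + 2 * (\<tau> * B (h, 0) (0, 1)) + \<tau>\<^sup>2 * B (0, 1) (0, 1)"
      unfolding split
      by (simp only: blinfun.add_right blinfun.scaleR_right blinfun.add_left blinfun.scaleR_left Xh sym[of "(0,1)" "(h,0)"])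
        (simp add: power2_eq_square algebra_simps)
    moreover have "\<bar>\<tau> * B (h, 0) (0, 1)\<bar> \<le> \<epsilon> / 2 * (norm h)\<^sup>2 + C\<^sup>2 / \<epsilon> * \<tau>\<^sup>2"
    proof -
      have "\<bar>\<tau> * B (h, 0) (0, 1)\<bar> \<le> \<bar>\<tau>\<bar> * (C * norm h)"
        using BC[of "(h, 0)" "(0, 1)"] by (auto simp: abs_mult norm_Pair intro!: mult_left_mono)
      also have "\<dots> \<le> \<epsilon> / 2 * (norm h)\<^sup>2 + C\<^sup>2 / \<epsilon> * \<tau>\<^sup>2"
      proof -
        have "0 \<le> (\<epsilon> * norm h - C * \<bar>\<tau>\<bar>)\<^sup>2 + (C * \<bar>\<tau>\<bar>)\<^sup>2" by simp
        then have "2 * \<epsilon> * (\<bar>\<tau>\<bar> * (C * norm h)) \<le> 2 * \<epsilon> * (\<epsilon> / 2 * (norm h)\<^sup>2 + C\<^sup>2 / \<epsilon> * \<tau>\<^sup>2)"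
          using \<open>0 < \<epsilon>\<close> by (simp add: power2_eq_square algebra_simps)
        then show ?thesis using \<open>0 < \<epsilon>\<close> by simp
      qed
      finally show ?thesis .
    qed
    moreover have "\<bar>\<tau>\<^sup>2 * B (0, 1) (0, 1)\<bar> \<le> C * \<tau>\<^sup>2"
      using mult_left_mono[OF BC[of "(0, 1)" "(0, 1)"], of "\<tau>\<^sup>2"] by (simp add: abs_mult norm_Pair mult.commute)
    moreover have "\<epsilon> / 2 * (norm (h, \<tau>))\<^sup>2 = \<epsilon> / 2 * (norm h)\<^sup>2 + \<epsilon> / 2 * \<tau>\<^sup>2"
      by (simp add: norm_Pair distrib_left add_divide_distrib)
    moreover have "K * \<tau>\<^sup>2 = \<epsilon> / 2 * \<tau>\<^sup>2 + C * \<tau>\<^sup>2 + C\<^sup>2 / \<epsilon> * \<tau>\<^sup>2" by (simp add: K_def distrib_right)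
    moreover have "\<epsilon> * (norm h)\<^sup>2 = \<epsilon> / 2 * (norm h)\<^sup>2 + \<epsilon> / 2 * (norm h)\<^sup>2" by simp
    moreover have "0 \<le> C * \<tau>\<^sup>2" by (simp add: C_def)
    moreover have "poly2 a p X 0 h \<tau> = a * \<tau> + p \<bullet> h + (h \<bullet> (X *v h)) / 2" by (simp add: poly2_def)
    moreover have "f ((x, t) + (h, \<tau>)) = \<phi> (x + h) (t + \<tau>)" "f (x, t) = \<phi> x t" by (simp_all add: f_def)
    ultimately show "\<bar>\<phi> (x + h) (t + \<tau>) - \<phi> x t - poly2 a p X 0 h \<tau>\<bar> \<le> \<epsilon> * (norm h)\<^sup>2 + K * \<tau>\<^sup>2"
      using * unfolding abs_le_iff by linarith
  qed
  moreover have "0 \<le> K" using \<open>0 < \<epsilon>\<close> by (simp add: K_def C_def)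
  ultimately show "\<exists>K\<ge>0. \<forall>\<^sub>F (h, \<tau>) in nhds 0.
      \<bar>\<phi> (x + h) (t + \<tau>) - \<phi> x t - poly2 a p X 0 h \<tau>\<bar> \<le> \<epsilon> * (norm h)\<^sup>2 + K * \<tau>\<^sup>2" by blast
qed

section \<open>Strong subsolutions\<close>

lemma dist_Pair_le: "dist (a, b) (c, d) \<le> dist a c + dist b d"
  by (simp add: dist_Pair_Pair sqrt_sum_squares_le_sum)

lemma eventually_nhds_0_iff_shift:
  fixes z :: "'a::real_normed_vector"
  shows "(\<forall>\<^sub>F k in nhds 0. P (z + k)) \<longleftrightarrow> (\<forall>\<^sub>F y in nhds z. P y)"
proof
  assume "\<forall>\<^sub>F k in nhds 0. P (z + k)"
  then obtain d where d: "d > 0" "\<And>k. norm k < d \<Longrightarrow> P (z + k)"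
    by (auto simp: eventually_nhds_metric)
  have "P y" if "dist y z < d" for y
    using d(2)[of "y - z"] that by (simp add: dist_norm)
  with d(1) show "\<forall>\<^sub>F y in nhds z. P y" by (auto simp: eventually_nhds_metric)
next
  assume "\<forall>\<^sub>F y in nhds z. P y"
  then obtain d where d: "d > 0" "\<And>y. dist y z < d \<Longrightarrow> P y"
    by (auto simp: eventually_nhds_metric)
  have "P (z + k)" if "norm k < d" for k
    using d(2)[of "z + k"] that by (simp add: dist_norm)
  with d(1) show "\<forall>\<^sub>F k in nhds 0. P (z + k)" by (auto simp: eventually_nhds_metric)
qed

lemma eventually_nhds_0_Pair_iff_shift:
  fixes x :: "'a::real_normed_vector" and t :: real
  shows "(\<forall>\<^sub>F (h, \<tau>) in nhds 0. P (x + h) (t + \<tau>)) \<longleftrightarrow> (\<forall>\<^sub>F (y, s) in nhds (x, t). P y s)"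
  using eventually_nhds_0_iff_shift[of "\<lambda>(y, s). P y s" "(x, t)"]
  by (simp add: case_prod_unfold plus_prod_def)

lemma eventually_nhds_0_norm_less:
  "0 < d \<Longrightarrow> \<forall>\<^sub>F (h :: 'a::real_normed_vector, \<tau> :: real) in nhds 0. norm h < d \<and> \<bar>\<tau>\<bar> < d"
  unfolding eventually_nhds_metric
proof (intro exI[of _ d] conjI allI impI, assumption)
  fix z :: "'a \<times> real" assume "0 < d" "dist z 0 < d"
  then show "case z of (h, \<tau>) \<Rightarrow> norm h < d \<and> \<bar>\<tau>\<bar> < d"
    using norm_fst_le[of "fst z" "snd z"] norm_snd_le[of "snd z" "fst z"] by (auto simp: case_prod_unfold)
qed

text \<open>
  \<open>\<theta>\<close> is the profile of the flat test functions. Only the upper estimate \<open>\<theta>_upper\<close> is ever needed,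
  with \<open>g\<close> in the role of its derivative; the factor \<open>c\<close> in \<open>g_flat\<close> makes the class of profiles
  \<open>s \<mapsto> \<theta> (c * s)\<close> stable under the moving translations of the sup-convolution.
\<close>

locale obstacle_problem =
  fixes T L :: real
    and F :: "real^'n \<Rightarrow> real^'n^'n \<Rightarrow> real"
    and k um up :: "real^'n \<Rightarrow> real \<Rightarrow> real"
    and u0 :: "real^'n \<Rightarrow> real"
    and \<omega> \<theta> g :: "real \<Rightarrow> real"
  assumes T_pos: "0 < T"
    and F_cont: "continuous_on ((UNIV - {0}) \<times> sym_matrices) (\<lambda>(p, X). F p X)"
    and F_geometric: "\<And>p X c \<sigma>. X \<in> sym_matrices \<Longrightarrow> 0 < c \<Longrightarrow>
          F (c *\<^sub>R p) (c *\<^sub>R X + \<sigma> *\<^sub>R outer_prod p p) = c * F p X"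
    and F_elliptic: "\<And>p X Y. X \<in> sym_matrices \<Longrightarrow> Y \<in> sym_matrices \<Longrightarrow> loewner_le X Y \<Longrightarrow>
          F p Y \<le> F p X"
    and k_lipschitz: "L-lipschitz_on (UNIV \<times> {0..}) (\<lambda>(x, t). k x t)"
    and obstacles_le: "\<And>x t. 0 \<le> t \<Longrightarrow> um x t \<le> up x t"
    and um_bounded: "bounded ((\<lambda>(x, t). um x t) ` (UNIV \<times> {0..}))"
    and up_bounded: "bounded ((\<lambda>(x, t). up x t) ` (UNIV \<times> {0..}))"
    and um_ucont: "uniformly_continuous_on (UNIV \<times> {0..}) (\<lambda>(x, t). um x t)"
    and up_ucont: "uniformly_continuous_on (UNIV \<times> {0..}) (\<lambda>(x, t). up x t)"
    and u0_between: "\<And>x. um x 0 \<le> u0 x \<and> u0 x \<le> up x 0"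
    and u0_modulus: "modulus_of_continuity_on UNIV u0 \<omega>"
    and um_modulus: "modulus_of_continuity_on (UNIV \<times> {0..}) (\<lambda>(x, t). um x t) \<omega>"
    and up_modulus: "modulus_of_continuity_on (UNIV \<times> {0..}) (\<lambda>(x, t). up x t) \<omega>"
    and \<theta>_zero: "\<theta> 0 = 0"
    and \<theta>_mono: "\<And>s t. 0 \<le> s \<Longrightarrow> s \<le> t \<Longrightarrow> \<theta> s \<le> \<theta> t"
    and \<theta>_pos: "\<And>s. 0 < s \<Longrightarrow> 0 < \<theta> s"
    and g_pos: "\<And>s. 0 < s \<Longrightarrow> 0 < g s"
    and g_le: "\<And>s. 0 \<le> s \<Longrightarrow> g s \<le> s"
    and \<theta>_upper: "\<And>s s1. 0 \<le> s \<Longrightarrow> 0 \<le> s1 \<Longrightarrow> \<theta> s \<le> \<theta> s1 + g s1 * (s - s1) + (s - s1)\<^sup>2"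
    and g_flat: "\<And>c d. 0 < c \<Longrightarrow> d \<noteq> 0 \<Longrightarrow> norm d \<le> 1 \<Longrightarrow> c * norm d \<le> 1 \<Longrightarrow>
      g (c * (norm d)\<^sup>2) * \<bar>\<bar>F d (mat 2)\<bar> + \<bar>F (- d) (mat (- 2))\<bar>\<bar> \<le> c * (norm d)\<^sup>2"
begin

section \<open>Elementary consequences of the structural hypotheses\<close>

lemma L_nonneg: "0 \<le> L"
  using k_lipschitz by (simp add: lipschitz_on_def)

lemma k_space: "0 \<le> t \<Longrightarrow> k x t \<le> k y t + L * norm (y - x)"
  using lipschitz_onD[OF k_lipschitz, of "(x, t)" "(y, t)"]
  by (auto simp: dist_Pair_Pair dist_norm norm_minus_commute)

lemma k_bound: "\<exists>K\<ge>0. \<forall>x t. norm (x - x0) \<le> 1 \<longrightarrow> 0 \<le> t \<longrightarrow> t \<le> T \<longrightarrow> \<bar>k x t\<bar> \<le> K"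
proof (intro exI[of _ "\<bar>k x0 0\<bar> + L * (1 + T)"] conjI allI impI)
  show "0 \<le> \<bar>k x0 0\<bar> + L * (1 + T)" using L_nonneg T_pos by simp
  fix x t assume *: "norm (x - x0) \<le> 1" "0 \<le> t" "t \<le> T"
  have "dist (x, t) (x0, 0) \<le> norm (x - x0) + \<bar>t\<bar>"
    using dist_Pair_le[of x t x0 0] by (simp add: dist_norm)
  also have "\<dots> \<le> 1 + T" using * by simp
  finally have "L * dist (x, t) (x0, 0) \<le> L * (1 + T)" using L_nonneg by (intro mult_left_mono)
  moreover have "\<bar>k x t - k x0 0\<bar> \<le> L * dist (x, t) (x0, 0)"
    using lipschitz_onD[OF k_lipschitz, of "(x, t)" "(x0, 0)"] * by (auto simp: dist_real_def)
  ultimately show "\<bar>k x t\<bar> \<le> \<bar>k x0 0\<bar> + L * (1 + T)" by linarith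
qed

lemma F_tendsto:
  assumes "(f \<longlongrightarrow> p) \<F>" "(Y \<longlongrightarrow> X) \<F>" "p \<noteq> 0" "X \<in> sym_matrices"
    "\<forall>\<^sub>F z in \<F>. Y z \<in> sym_matrices"
  shows "((\<lambda>z. F (f z) (Y z)) \<longlongrightarrow> F p X) \<F>"
proof -
  have "((\<lambda>z. (\<lambda>(p, X). F p X) (f z, Y z)) \<longlongrightarrow> (\<lambda>(p, X). F p X) (p, X)) \<F>"
  proof (rule continuous_on_tendsto_compose[OF F_cont])
    show "((\<lambda>z. (f z, Y z)) \<longlongrightarrow> (p, X)) \<F>" using assms by (intro tendsto_Pair)
    show "(p, X) \<in> (UNIV - {0}) \<times> sym_matrices" using assms by auto
    have "\<forall>\<^sub>F z in \<F>. f z \<noteq> 0" using tendsto_imp_eventually_ne[OF assms(1,3)] .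
    with assms(5) show "\<forall>\<^sub>F z in \<F>. (f z, Y z) \<in> (UNIV - {0}) \<times> sym_matrices"
      by eventually_elim auto
  qed
  then show ?thesis by simp
qed

text \<open>Scaling at zero gradient gives \<open>F 0 0 = 2 * F 0 0\<close>, so
  \<open>F 0 0 = 0\<close>, and ellipticity gives the sign. This settles critical points with a
  semidefinite Hessian, where \<open>F\<close> is not assumed continuous.\<close>

lemma F_zero_nonneg: "X \<in> sym_matrices \<Longrightarrow> loewner_le X 0 \<Longrightarrow> 0 \<le> F 0 X"
  using F_elliptic[of X 0 0] F_geometric[of 0 2 0 0] by (simp add: sym_matrices_zero)

lemma F_zero_nonpos: "X \<in> sym_matrices \<Longrightarrow> loewner_le 0 X \<Longrightarrow> F 0 X \<le> 0"
  using F_elliptic[of 0 X 0] F_geometric[of 0 2 0 0] by (simp add: sym_matrices_zero)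

section \<open>The flat profile and its expansions\<close>

lemma \<theta>_nonneg: "0 \<le> s \<Longrightarrow> 0 \<le> \<theta> s"
  using \<theta>_mono[of 0 s] by (simp add: \<theta>_zero)

text \<open>As a consequence \<open>\<theta> (c * (norm h)\<^sup>2)\<close> is of fourth order at
  its centre and has vanishing gradient and Hessian there.\<close>

lemma \<theta>_le_square: "0 \<le> s \<Longrightarrow> \<theta> s \<le> s\<^sup>2"
  using \<theta>_upper[of s 0] g_le[of 0] mult_nonneg_nonpos2[of s "g 0"] by (auto simp: \<theta>_zero)

lemma continuous_on_\<theta>: "continuous_on {0..} \<theta>"
proof -
  have "continuous_on {0..M} \<theta>" for M
  proof -
    have "(2 * \<bar>M\<bar>)-lipschitz_on {0..M} \<theta>"
    proof (rule lipschitz_onI)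
      have *: "\<theta> s - \<theta> t \<le> 2 * \<bar>M\<bar> * \<bar>s - t\<bar>" if "s \<in> {0..M}" "t \<in> {0..M}" for s t
      \<comment> \<open>At 0 the function \<open>g\<close> is bounded only from above, so its
        product with the increment cannot be estimated in absolute value; the quadratic bound for
        \<open>\<theta>\<close> takes over.\<close>
      proof (cases "t = 0")
        case True
        have "\<theta> s - \<theta> t \<le> s * s" using \<theta>_le_square[of s] that True by (simp add: \<theta>_zero power2_eq_square)
        also have "\<dots> \<le> 2 * \<bar>M\<bar> * s" using that by (intro mult_right_mono) auto
        finally show ?thesis using True that by simp
      next
        case False
        have "\<theta> s - \<theta> t \<le> g t * (s - t) + (s - t)\<^sup>2" using \<theta>_upper[of s t] that by simp
        also have "\<dots> \<le> \<bar>g t * (s - t)\<bar> + \<bar>s - t\<bar> * \<bar>s - t\<bar>" by (simp add: power2_eq_square)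
        also have "\<dots> \<le> \<bar>M\<bar> * \<bar>s - t\<bar> + \<bar>M\<bar> * \<bar>s - t\<bar>"
          unfolding abs_mult using g_pos[of t] g_le[of t] that False
          by (intro add_mono mult_right_mono) auto
        finally show ?thesis by simp
      qed
      show "dist (\<theta> s) (\<theta> t) \<le> 2 * \<bar>M\<bar> * dist s t" if "s \<in> {0..M}" "t \<in> {0..M}" for s t
        using *[OF that] *[OF that(2,1)] by (auto simp: dist_real_def abs_le_iff abs_minus_commute)
    qed simp
    then show ?thesis by (rule lipschitz_on_continuous_on)
  qed
  note cont = this
  show ?thesis
    unfolding continuous_on_eq_continuous_within
  proof
    fix s :: real assume s: "s \<in> {0..}"
    have "continuous (at s within {0..s + 1}) \<theta>"
      using cont[of "s + 1"] s by (auto simp: continuous_on_eq_continuous_within)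
    moreover have "at s within {0..} = at s within {0..s + 1}"
      by (rule at_within_nhd[of s "{..<s + 1}"]) (use s in auto)
    ultimately show "continuous (at s within {0..}) \<theta>" by simp
  qed
qed

lemma continuous_on_\<theta>_compose:
  assumes "continuous_on S f" "\<And>z. z \<in> S \<Longrightarrow> 0 \<le> f z"
  shows "continuous_on S (\<lambda>z. \<theta> (f z))"
  using continuous_on_compose2[OF continuous_on_\<theta> assms(1)] assms(2) by auto

text \<open>The increment of c|d + h|^2 is c(2u + v) with u the inner product of \<open>d\<close>
  and \<open>h\<close>, and v = |h|^2. In the square of this increment the part in \<open>v\<close>
  is absorbed by the positive value of \<open>g\<close>; the part in \<open>u\<close> is kept apart
  because it acts in the gradient direction only.\<close>

lemma \<theta>_expansion:
  assumes "d \<noteq> 0" "0 < c"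
  shows "\<forall>\<^sub>F (h :: real^'n, \<tau> :: real) in nhds 0. \<theta> (c * (norm (d + h))\<^sup>2) - \<theta> (c * (norm d)\<^sup>2) \<le>
    2 * c * g (c * (norm d)\<^sup>2) * (d \<bullet> h) + 2 * c * g (c * (norm d)\<^sup>2) * (norm h)\<^sup>2 + 8 * c\<^sup>2 * (d \<bullet> h)\<^sup>2"
proof -
  define G where "G = g (c * (norm d)\<^sup>2)"
  have G: "0 < G" unfolding G_def using assms by (intro g_pos) auto
  \<comment> \<open>Within this radius \<open>2 * c * (norm h)\<^sup>2 \<le> G\<close>, which turns
    the quadratic contribution of \<open>v\<close> into a multiple of \<open>G\<close>.\<close>
  define r where "r = sqrt (G / (2 * c))"
  have r: "0 < r" using G assms by (simp add: r_def)
  show ?thesis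
  proof (rule eventually_mono[OF eventually_nhds_0_norm_less[OF r]], clarify)
    fix h :: "real^'n" and \<tau> :: real assume "norm h < r"
    then have "(norm h)\<^sup>2 \<le> r\<^sup>2" by (intro power_mono) auto
    then have hG: "2 * c * (norm h)\<^sup>2 \<le> G" using G assms(2) by (simp add: r_def field_simps)
    define u v where "u = d \<bullet> h" and "v = (norm h)\<^sup>2"
    have v: "0 \<le> v" "2 * c * v \<le> G" using hG by (auto simp: v_def)
    have e: "c * (norm (d + h))\<^sup>2 - c * (norm d)\<^sup>2 = c * (2 * u + v)"
      by (simp add: u_def v_def power2_norm_eq_inner inner_add_left inner_add_right inner_commute algebra_simps)
    have "\<theta> (c * (norm (d + h))\<^sup>2) - \<theta> (c * (norm d)\<^sup>2) \<le> G * (c * (2 * u + v)) + (c * (2 * u + v))\<^sup>2"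
      using \<theta>_upper[of "c * (norm (d + h))\<^sup>2" "c * (norm d)\<^sup>2"] assms(2) unfolding e G_def by simp
    also have "(c * (2 * u + v))\<^sup>2 \<le> 8 * c\<^sup>2 * u\<^sup>2 + c * v * (2 * c * v)"
    proof -
      have "8 * c\<^sup>2 * u\<^sup>2 + c * v * (2 * c * v) - (c * (2 * u + v))\<^sup>2 = c\<^sup>2 * (2 * u - v)\<^sup>2"
        by (simp add: power2_eq_square algebra_simps)
      moreover have "0 \<le> c\<^sup>2 * (2 * u - v)\<^sup>2" by simp
      ultimately show ?thesis by linarith
    qed
    also have "c * v * (2 * c * v) \<le> c * v * G" using v assms(2) by (intro mult_left_mono) auto
    finally show "\<theta> (c * (norm (d + h))\<^sup>2) - \<theta> (c * (norm d)\<^sup>2) \<le>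
      2 * c * g (c * (norm d)\<^sup>2) * (d \<bullet> h) + 2 * c * g (c * (norm d)\<^sup>2) * (norm h)\<^sup>2 + 8 * c\<^sup>2 * (d \<bullet> h)\<^sup>2"
      by (simp add: G_def[symmetric] u_def[symmetric] v_def[symmetric] algebra_simps)
  qed
qed

text \<open>The last summand of the Hessian is a multiple of the gradient tensored with itself,
  hence invisible to a geometric \<open>F\<close>. What remains is a multiple of the jet
  \<open>(d, mat 2)\<close>, with the factor \<open>G\<close> for which \<open>g_flat\<close> is
  arranged.\<close>

lemma \<theta>_expansion_poly2:
  assumes "d \<noteq> 0" "0 < c" "0 \<le> A"
  defines "G \<equiv> g (c * (norm d)\<^sup>2)"
  shows "\<forall>\<^sub>F (h :: real^'n, \<tau>) in nhds 0. A * (\<theta> (c * (norm (d + h))\<^sup>2) - \<theta> (c * (norm d)\<^sup>2)) \<le>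
    poly2 0 ((2 * A * c * G) *\<^sub>R d) ((2 * A * c * G) *\<^sub>R mat 2 + (16 * A * c\<^sup>2) *\<^sub>R outer_prod d d) 0 h \<tau>"
proof (rule eventually_mono[OF \<theta>_expansion[OF assms(1,2)]], clarify)
  fix h :: "real^'n" and \<tau> :: real
  assume "\<theta> (c * (norm (d + h))\<^sup>2) - \<theta> (c * (norm d)\<^sup>2) \<le>
      2 * c * g (c * (norm d)\<^sup>2) * (d \<bullet> h) + 2 * c * g (c * (norm d)\<^sup>2) * (norm h)\<^sup>2 + 8 * c\<^sup>2 * (d \<bullet> h)\<^sup>2"
  from mult_left_mono[OF this assms(3)]
  have "A * (\<theta> (c * (norm (d + h))\<^sup>2) - \<theta> (c * (norm d)\<^sup>2)) \<le>
     2 * A * c * G * (d \<bullet> h) + 2 * A * c * G * (norm h)\<^sup>2 + 8 * A * c\<^sup>2 * (d \<bullet> h)\<^sup>2"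
    by (simp add: G_def algebra_simps)
  moreover have "poly2 0 ((2 * A * c * G) *\<^sub>R d) ((2 * A * c * G) *\<^sub>R mat 2 + (16 * A * c\<^sup>2) *\<^sub>R outer_prod d d) 0 h \<tau> =
     2 * A * c * G * (d \<bullet> h) + (2 * A * c * G * (norm h)\<^sup>2 + 8 * A * c\<^sup>2 * (d \<bullet> h)\<^sup>2)"
    unfolding poly2_def matrix_vector_mult_add_rdistrib scaleR_matrix_vector mat_vector outer_prod_vector
    by (simp add: inner_add_right power2_norm_eq_inner inner_commute[of h d] power2_eq_square[of "d \<bullet> h"] add_divide_distrib)
  ultimately show "A * (\<theta> (c * (norm (d + h))\<^sup>2) - \<theta> (c * (norm d)\<^sup>2)) \<le>
    poly2 0 ((2 * A * c * G) *\<^sub>R d) ((2 * A * c * G) *\<^sub>R mat 2 + (16 * A * c\<^sup>2) *\<^sub>R outer_prod d d) 0 h \<tau>"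
    by linarith
qed

text \<open>Being of fourth order, the flat function lies below
  \<open>\<epsilon> * (norm h)\<^sup>2\<close> near the origin for every positive
  \<open>\<epsilon>\<close>. Quadratic polynomials can then be compared, and
  \<open>\<epsilon>\<close> tends to zero.\<close>

lemma poly2_le_flat_imp:
  fixes X0 :: "real^'n^'n"
  assumes "\<forall>\<^sub>F (h, \<tau>) in nhds 0. poly2 a0 p0 X0 K0 h \<tau> \<le> a * \<tau> + K * \<tau>\<^sup>2 + A * \<theta> (c * (norm h)\<^sup>2)"
    and "0 < A" "0 < c"
  shows "a = a0" "p0 = 0" "loewner_le X0 0"
proof -
  have cmp: "a = a0 \<and> p0 = 0 \<and> loewner_le X0 (mat (2 * \<epsilon>))" if "0 < \<epsilon>" for \<epsilon>
  proof -
    define r where "r = sqrt (\<epsilon> / (A * c\<^sup>2))"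
    have r: "0 < r" using that assms by (simp add: r_def)
    have "\<forall>\<^sub>F (h, \<tau>) in nhds 0. poly2 a0 p0 X0 K0 h \<tau> \<le> poly2 a 0 (mat (2 * \<epsilon>)) K h \<tau>"
      using assms(1) eventually_nhds_0_norm_less[OF r]
    proof (eventually_elim, clarify)
      fix h :: "real^'n" and \<tau> :: real
      assume 1: "poly2 a0 p0 X0 K0 h \<tau> \<le> a * \<tau> + K * \<tau>\<^sup>2 + A * \<theta> (c * (norm h)\<^sup>2)" and h: "norm h < r"
      from h have "(norm h)\<^sup>2 \<le> r\<^sup>2" by (intro power_mono) auto
      then have "A * c\<^sup>2 * (norm h)\<^sup>2 \<le> \<epsilon>" using assms that by (simp add: r_def field_simps)
      from mult_right_mono[OF this, of "(norm h)\<^sup>2"]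
      have "A * (c * (norm h)\<^sup>2)\<^sup>2 \<le> \<epsilon> * (norm h)\<^sup>2" by (simp add: power2_eq_square mult_ac)
      moreover have "A * \<theta> (c * (norm h)\<^sup>2) \<le> A * (c * (norm h)\<^sup>2)\<^sup>2"
        using assms by (intro mult_left_mono \<theta>_le_square) auto
      moreover have "poly2 a 0 (mat (2 * \<epsilon>)) K h \<tau> = a * \<tau> + \<epsilon> * (norm h)\<^sup>2 + K * \<tau>\<^sup>2"
        by (simp add: poly2_def mat_vector power2_norm_eq_inner)
      ultimately show "poly2 a0 p0 X0 K0 h \<tau> \<le> poly2 a 0 (mat (2 * \<epsilon>)) K h \<tau>" using 1 by linarith
    qed
    from poly2_le_imp[OF this] show ?thesis by auto
  qed
  have "v \<bullet> (X0 *v v) \<le> 0" for v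
  proof (rule field_le_epsilon)
    fix e :: real assume "0 < e"
    define \<epsilon> where "\<epsilon> = e / (2 * (v \<bullet> v + 1))"
    have "0 < \<epsilon>" using \<open>0 < e\<close> by (simp add: \<epsilon>_def add_nonneg_pos)
    then have "v \<bullet> (X0 *v v) \<le> 2 * \<epsilon> * (v \<bullet> v)" using cmp[of \<epsilon>] by (auto simp: loewner_le_def mat_vector)
    also have "\<dots> \<le> 2 * \<epsilon> * (v \<bullet> v + 1)" using \<open>0 < \<epsilon>\<close> by simp
    also have "\<dots> = e"
    proof -
      have "2 * (e / (2 * B)) * B = e" if "B \<noteq> 0" for B using that by simp
      moreover have "v \<bullet> v + 1 \<noteq> 0" using inner_ge_zero[of v] by linarith
      ultimately show ?thesis unfolding \<epsilon>_def by blast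
    qed
    finally show "v \<bullet> (X0 *v v) \<le> 0 + e" by simp
  qed
  then have "loewner_le X0 0" by (simp add: loewner_le_def)
  then show "loewner_le X0 0" .
  show "a = a0" "p0 = 0" using cmp[of 1] by auto
qed

text \<open>The first clause is the superjet form of the differential inequality, restricted to
  nonzero gradient. In the second the gradient and Hessian of the test function vanish at the
  contact point, so the equation reduces to the sign of \<open>a\<close>. Contact is local and
  \<open>K\<close> is arbitrary, which leaves room for second order errors in time.\<close>

definition sub_at :: "((real^'n) \<times> real \<Rightarrow> real) \<Rightarrow> real^'n \<Rightarrow> real \<Rightarrow> bool" where
  "sub_at w x t \<longleftrightarrow>
    (\<forall>a p X K. X \<in> sym_matrices \<and> p \<noteq> 0 \<and>
      (\<forall>\<^sub>F (h, \<tau>) in nhds 0. w (x + h, t + \<tau>) \<le> w (x, t) + poly2 a p X K h \<tau>) \<longrightarrow>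
      a + F p X + k x t * norm p \<le> 0) \<and>
    (\<forall>a K A c. 0 < A \<and> 0 < c \<and>
      (\<forall>\<^sub>F (h, \<tau>) in nhds 0. w (x + h, t + \<tau>) \<le> w (x, t) + a * \<tau> + K * \<tau>\<^sup>2 + A * \<theta> (c * (norm h)\<^sup>2)) \<longrightarrow>
      a \<le> 0)"

lemma sub_at_poly2D:
  assumes "sub_at w x t" "X \<in> sym_matrices" "p \<noteq> 0"
    "\<forall>\<^sub>F (h, \<tau>) in nhds 0. w (x + h, t + \<tau>) \<le> w (x, t) + poly2 a p X K h \<tau>"
  shows "a + F p X + k x t * norm p \<le> 0"
  using assms unfolding sub_at_def by blast

lemma sub_at_flatD:
  assumes "sub_at w x t" "0 < A" "0 < c"
    "\<forall>\<^sub>F (h, \<tau>) in nhds 0. w (x + h, t + \<tau>) \<le> w (x, t) + a * \<tau> + K * \<tau>\<^sup>2 + A * \<theta> (c * (norm h)\<^sup>2)"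
  shows "a \<le> 0"
  using assms unfolding sub_at_def by blast

lemma sub_at_mono:
  assumes "sub_at \<psi> x t" "\<psi> (x, t) = w (x, t)" "\<forall>\<^sub>F (h, \<tau>) in nhds 0. \<psi> (x + h, t + \<tau>) \<le> w (x + h, t + \<tau>)"
  shows "sub_at w x t"
  unfolding sub_at_def
proof (intro conjI allI impI; elim conjE)
  fix a p X K assume *: "X \<in> sym_matrices" "p \<noteq> 0"
    "\<forall>\<^sub>F (h, \<tau>) in nhds 0. w (x + h, t + \<tau>) \<le> w (x, t) + poly2 a p X K h \<tau>"
  have "\<forall>\<^sub>F (h, \<tau>) in nhds 0. \<psi> (x + h, t + \<tau>) \<le> \<psi> (x, t) + poly2 a p X K h \<tau>"
    using *(3) assms(3) by eventually_elim (auto simp: assms(2))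
  from sub_at_poly2D[OF assms(1) *(1,2) this] show "a + F p X + k x t * norm p \<le> 0" .
next
  fix a K A c :: real assume *: "0 < A" "0 < c"
    "\<forall>\<^sub>F (h, \<tau>) in nhds 0. w (x + h, t + \<tau>) \<le> w (x, t) + a * \<tau> + K * \<tau>\<^sup>2 + A * \<theta> (c * (norm h)\<^sup>2)"
  have "\<forall>\<^sub>F (h, \<tau>) in nhds 0. \<psi> (x + h, t + \<tau>) \<le> \<psi> (x, t) + a * \<tau> + K * \<tau>\<^sup>2 + A * \<theta> (c * (norm h)\<^sup>2)"
    using *(3) assms(3) by eventually_elim (auto simp: assms(2))
  from sub_at_flatD[OF assms(1) *(1,2) this] show "a \<le> 0" .
qed

text \<open>Whatever touches \<open>\<psi>\<close> from above also lies above the polynomial, so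
  ellipticity reduces everything to the jet of the polynomial. A flat function can touch only where
  that polynomial has zero gradient and nonpositive Hessian.\<close>

lemma sub_at_if_poly2_below:
  assumes low: "\<forall>\<^sub>F (h, \<tau>) in nhds 0. \<psi> (x, t) + poly2 a0 p0 X0 K0 h \<tau> \<le> \<psi> (x + h, t + \<tau>)"
    and X0: "X0 \<in> sym_matrices"
    and nonzero: "p0 \<noteq> 0 \<Longrightarrow> a0 + F p0 X0 + k x t * norm p0 \<le> 0"
    and zero: "p0 = 0 \<Longrightarrow> loewner_le X0 0 \<Longrightarrow> a0 \<le> 0"
  shows "sub_at \<psi> x t"
  unfolding sub_at_def
proof (intro conjI allI impI; elim conjE)
  fix a p X K assume *: "X \<in> sym_matrices" "p \<noteq> 0"
    "\<forall>\<^sub>F (h, \<tau>) in nhds 0. \<psi> (x + h, t + \<tau>) \<le> \<psi> (x, t) + poly2 a p X K h \<tau>"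
  have "\<forall>\<^sub>F (h, \<tau>) in nhds 0. poly2 a0 p0 X0 K0 h \<tau> \<le> poly2 a p X K h \<tau>"
    using *(3) low by eventually_elim auto
  from poly2_le_imp[OF this] have "a = a0" "p = p0" "loewner_le X0 X" by auto
  then show "a + F p X + k x t * norm p \<le> 0"
    using nonzero F_elliptic[OF X0 *(1), of p] *(2) by auto
next
  fix a K A c :: real assume *: "0 < A" "0 < c"
    "\<forall>\<^sub>F (h, \<tau>) in nhds 0. \<psi> (x + h, t + \<tau>) \<le> \<psi> (x, t) + a * \<tau> + K * \<tau>\<^sup>2 + A * \<theta> (c * (norm h)\<^sup>2)"
  have "\<forall>\<^sub>F (h, \<tau>) in nhds 0. poly2 a0 p0 X0 K0 h \<tau> \<le> a * \<tau> + K * \<tau>\<^sup>2 + A * \<theta> (c * (norm h)\<^sup>2)"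
    using *(3) low by eventually_elim auto
  from poly2_le_flat_imp[OF this *(1,2)] show "a \<le> 0" using zero by simp
qed

lemma F_flat_bound:
  assumes "d \<noteq> 0" "0 < c" "norm d \<le> 1" "c * norm d \<le> 1"
  shows "g (c * (norm d)\<^sup>2) * \<bar>F d (mat 2)\<bar> \<le> c * (norm d)\<^sup>2"
    and "g (c * (norm d)\<^sup>2) * \<bar>F (- d) (mat (- 2))\<bar> \<le> c * (norm d)\<^sup>2"
proof -
  have "0 < g (c * (norm d)\<^sup>2)" using assms by (intro g_pos) auto
  with g_flat[OF assms(2,1,3,4)]
  have "g (c * (norm d)\<^sup>2) * \<bar>F d (mat 2)\<bar> + g (c * (norm d)\<^sup>2) * \<bar>F (- d) (mat (- 2))\<bar> \<le> c * (norm d)\<^sup>2"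
    by (simp add: distrib_left)
  moreover have "0 \<le> g (c * (norm d)\<^sup>2) * \<bar>F d (mat 2)\<bar>" "0 \<le> g (c * (norm d)\<^sup>2) * \<bar>F (- d) (mat (- 2))\<bar>"
    using \<open>0 < g (c * (norm d)\<^sup>2)\<close> by auto
  ultimately show "g (c * (norm d)\<^sup>2) * \<bar>F d (mat 2)\<bar> \<le> c * (norm d)\<^sup>2"
    "g (c * (norm d)\<^sup>2) * \<bar>F (- d) (mat (- 2))\<bar> \<le> c * (norm d)\<^sup>2" by linarith+
qed

text \<open>The decisive estimate. For a flat test function whose centre is off the contact point by
  \<open>d\<close>, scaling turns \<open>F\<close> at its jet into \<open>2 * A * c\<close> times
  \<open>G * F d (mat 2)\<close>, and \<open>g_flat\<close> bounds the latter by c|d|^2. The bound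
  vanishes with \<open>d\<close> however singular \<open>F\<close> is, so it passes continuously
  into the critical case \<open>d = 0\<close>.\<close>

lemma sub_at_flat_bound:
  assumes sub: "sub_at w x t" and "0 < A" "0 < c" "norm d \<le> 1" "c * norm d \<le> 1" "\<bar>k x t\<bar> \<le> K0"
    and touch: "\<forall>\<^sub>F (h, \<tau>) in nhds 0. w (x + h, t + \<tau>) \<le> w (x, t) + a * \<tau> + K * \<tau>\<^sup>2 +
      A * (\<theta> (c * (norm (d + h))\<^sup>2) - \<theta> (c * (norm d)\<^sup>2))"
  shows "a \<le> 2 * A * c * (c * (norm d)\<^sup>2) * (1 + K0)"
proof (cases "d = 0")
  case True
  have "a \<le> 0" using sub_at_flatD[OF sub assms(2,3), of a K] touch by (simp add: True \<theta>_zero add.assoc)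
  with True show ?thesis by simp
next
  case False
  define G where "G = g (c * (norm d)\<^sup>2)"
  define X where "X = (2 * A * c * G) *\<^sub>R mat 2 + (16 * A * c\<^sup>2) *\<^sub>R outer_prod d d"
  have G: "0 < G" unfolding G_def using False assms by (intro g_pos) auto
  have X: "X \<in> sym_matrices" unfolding X_def by (intro sym_matrices_intros)
  have "\<forall>\<^sub>F (h, \<tau>) in nhds 0. w (x + h, t + \<tau>) \<le> w (x, t) + poly2 a ((2 * A * c * G) *\<^sub>R d) X K h \<tau>"
    using touch \<theta>_expansion_poly2[OF False assms(3) less_imp_le[OF assms(2)]]
    by eventually_elim (auto simp: X_def G_def poly2_def)
  from sub_at_poly2D[OF sub X _ this] G False assms
  have le: "a + F ((2 * A * c * G) *\<^sub>R d) X + k x t * norm ((2 * A * c * G) *\<^sub>R d) \<le> 0" by simp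
  have e1: "F ((2 * A * c * G) *\<^sub>R d) X = 2 * A * c * (G * F d (mat 2))"
    unfolding X_def using F_geometric[of "mat 2" "2 * A * c * G" d] G assms by (simp add: sym_matrices_mat)
  have e2: "norm ((2 * A * c * G) *\<^sub>R d) = 2 * A * c * (G * norm d)" using G assms by simp
  from le have "a \<le> 2 * A * c * (G * (- F d (mat 2)) + G * norm d * (- k x t))"
    unfolding e1 e2 by (simp add: algebra_simps)
  also have "G * (- F d (mat 2)) \<le> G * \<bar>F d (mat 2)\<bar>" using G by (intro mult_left_mono) auto
  also have "\<dots> \<le> c * (norm d)\<^sup>2" unfolding G_def using F_flat_bound(1)[OF False assms(3-5)] .
  also have "G * norm d * (- k x t) \<le> G * norm d * \<bar>k x t\<bar>" using G by (intro mult_left_mono) auto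
  also have "\<dots> \<le> (c * (norm d)\<^sup>2 * 1) * K0"
  proof (rule mult_mono)
    show "G * norm d \<le> c * (norm d)\<^sup>2 * 1"
      unfolding G_def using assms g_le[of "c * (norm d)\<^sup>2"] G by (intro mult_mono) auto
  qed (use assms G in auto)
  finally show ?thesis using assms by (simp add: algebra_simps)
qed

text \<open>With the sign reversed the other value controlled by \<open>g_flat\<close>,
  \<open>F (- d) (mat (- 2))\<close>, enters, and \<open>C\<close> outweighs it together with
  \<open>k\<close>. At the centre a concave polynomial of zero gradient lies below the
  barrier.\<close>

lemma sub_at_lower_barrier:
  assumes "0 < A" "norm d \<le> 1" "d = x - x0" "\<bar>k x t\<bar> \<le> K0" "2 * A * (1 + K0) \<le> C" "0 \<le> C"
  shows "sub_at (\<lambda>(y, s). c0 - A * \<theta> ((norm (y - x0))\<^sup>2) - C * (s - t0)) x t"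
proof (cases "d = 0")
  case True
  have "\<forall>\<^sub>F (h, \<tau>) in nhds 0. c0 - A * \<theta> ((norm (x - x0))\<^sup>2) - C * (t - t0) + poly2 (- C) 0 (mat (- 2 * A)) 0 h \<tau>
     \<le> c0 - A * \<theta> ((norm (x + h - x0))\<^sup>2) - C * (t + \<tau> - t0)"
  proof (rule eventually_mono[OF eventually_nhds_0_norm_less[OF zero_less_one]], clarify)
    fix h :: "real^'n" and \<tau> :: real assume h: "norm h < 1"
    have "\<theta> ((norm h)\<^sup>2) \<le> (norm h)\<^sup>2 * (norm h)\<^sup>2" using \<theta>_le_square[of "(norm h)\<^sup>2"] by (simp add: power2_eq_square)
    also have "\<dots> \<le> 1 * (norm h)\<^sup>2" using h by (intro mult_right_mono) (auto simp: power_le_one_iff abs_square_le_1)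
    finally have "A * \<theta> ((norm h)\<^sup>2) \<le> A * (norm h)\<^sup>2" using assms(1) by (intro mult_left_mono) auto
    moreover have "norm (x + h - x0) = norm h" "norm (x - x0) = 0" using True assms(3) by auto
    ultimately show "c0 - A * \<theta> ((norm (x - x0))\<^sup>2) - C * (t - t0) + poly2 (- C) 0 (mat (- 2 * A)) 0 h \<tau>
     \<le> c0 - A * \<theta> ((norm (x + h - x0))\<^sup>2) - C * (t + \<tau> - t0)"
      by (simp add: poly2_def mat_vector \<theta>_zero power2_norm_eq_inner algebra_simps)
  qed
  then show ?thesis
    by (intro sub_at_if_poly2_below[where ?a0.0 = "- C" and ?p0.0 = 0 and ?X0.0 = "mat (- 2 * A)" and ?K0.0 = 0])
      (use assms in \<open>auto simp: sym_matrices_mat\<close>)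
next
  case False
  define G where "G = g ((norm d)\<^sup>2)"
  define X where "X = (2 * A * G) *\<^sub>R mat 2 + (16 * A) *\<^sub>R outer_prod d d"
  have G: "0 < G" unfolding G_def using False assms by (intro g_pos) auto
  have X: "- X \<in> sym_matrices" unfolding X_def minus_add_distrib scaleR_minus_left[symmetric] by (intro sym_matrices_intros)
  show ?thesis
  proof (rule sub_at_if_poly2_below[where ?a0.0 = "- C" and ?p0.0 = "(2 * A * G) *\<^sub>R (- d)" and ?X0.0 = "- X" and ?K0.0 = 0])
    show "- X \<in> sym_matrices" by (rule X)
    show "- C \<le> 0" using assms by simp
    have eX: "- X = (2 * A * G) *\<^sub>R mat (- 2) + (- (16 * A)) *\<^sub>R outer_prod (- d) (- d)"
      by (simp add: X_def vec_eq_iff mat_def outer_prod_def)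
    have "F ((2 * A * G) *\<^sub>R (- d)) (- X) = 2 * A * (G * F (- d) (mat (- 2)))"
      unfolding eX by (subst F_geometric) (use G assms in \<open>auto simp: sym_matrices_mat\<close>)
    also have "G * F (- d) (mat (- 2)) \<le> G * \<bar>F (- d) (mat (- 2))\<bar>" using G by (intro mult_left_mono) auto
    also have "\<dots> \<le> (norm d)\<^sup>2" using F_flat_bound(2)[OF False, of 1] assms by (simp add: G_def)
    also have "\<dots> \<le> 1" using assms by (simp add: power_le_one_iff abs_square_le_1)
    finally have 1: "F ((2 * A * G) *\<^sub>R (- d)) (- X) \<le> 2 * A" using assms by simp
    have "G \<le> 1" unfolding G_def using assms g_le[of "(norm d)\<^sup>2"] by (auto simp: power_le_one_iff abs_square_le_1 intro: order_trans)
    then have "G * norm d \<le> 1" using assms G mult_mono[of G 1 "norm d" 1] by simp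
    then have "k x t * (G * norm d) \<le> K0 * 1"
      using assms G by (intro mult_mono) auto
    then have kG: "2 * A * (k x t * (G * norm d)) \<le> 2 * A * K0" using assms by simp
    have nd: "norm ((2 * A * G) *\<^sub>R (- d)) = 2 * A * (G * norm d)" using assms(1) G by simp
    have 2: "k x t * norm ((2 * A * G) *\<^sub>R (- d)) \<le> 2 * A * K0" using kG unfolding nd by (simp add: mult_ac)
    show "- C + F ((2 * A * G) *\<^sub>R (- d)) (- X) + k x t * norm ((2 * A * G) *\<^sub>R (- d)) \<le> 0"
      using 1 2 assms(5) by (simp add: algebra_simps)
    show "\<forall>\<^sub>F (h, \<tau>) in nhds 0. (case (x, t) of (y, s) \<Rightarrow> c0 - A * \<theta> ((norm (y - x0))\<^sup>2) - C * (s - t0))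
        + poly2 (- C) ((2 * A * G) *\<^sub>R (- d)) (- X) 0 h \<tau>
      \<le> (case (x + h, t + \<tau>) of (y, s) \<Rightarrow> c0 - A * \<theta> ((norm (y - x0))\<^sup>2) - C * (s - t0))"
    proof (rule eventually_mono[OF \<theta>_expansion_poly2[OF False zero_less_one less_imp_le[OF assms(1)]]], clarify)
      fix h :: "real^'n" and \<tau> :: real
      assume "A * (\<theta> (1 * (norm (d + h))\<^sup>2) - \<theta> (1 * (norm d)\<^sup>2)) \<le>
        poly2 0 ((2 * A * 1 * g (1 * (norm d)\<^sup>2)) *\<^sub>R d) ((2 * A * 1 * g (1 * (norm d)\<^sup>2)) *\<^sub>R mat 2
          + (16 * A * 1\<^sup>2) *\<^sub>R outer_prod d d) 0 h \<tau>"
      then have "A * \<theta> ((norm (d + h))\<^sup>2) - A * \<theta> ((norm d)\<^sup>2) \<le> poly2 0 ((2 * A * G) *\<^sub>R d) X 0 h \<tau>"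
        by (simp add: G_def X_def right_diff_distrib)
      moreover have "poly2 (- C) ((2 * A * G) *\<^sub>R (- d)) (- X) 0 h \<tau> = - C * \<tau> - poly2 0 ((2 * A * G) *\<^sub>R d) X 0 h \<tau>"
        by (simp add: poly2_def minus_matrix_vector)
      moreover have e: "x + h - x0 = d + h" "x - x0 = d" using assms(3) by auto
      moreover have "C * (t + \<tau> - t0) = C * (t - t0) + C * \<tau>" by (simp add: algebra_simps)
      ultimately show "c0 - A * \<theta> ((norm (x - x0))\<^sup>2) - C * (t - t0) + poly2 (- C) ((2 * A * G) *\<^sub>R (- d)) (- X) 0 h \<tau>
        \<le> c0 - A * \<theta> ((norm (x + h - x0))\<^sup>2) - C * (t + \<tau> - t0)"
        unfolding e by linarith
    qed
  qed
qed

end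

section \<open>The class of strong subsolutions and barriers from above\<close>

lemma max_zero_square_le: "(max 0 (a + \<tau>))\<^sup>2 \<le> (max 0 a)\<^sup>2 + 2 * max 0 a * \<tau> + \<tau>\<^sup>2" for a \<tau> :: real
proof -
  have "(max 0 (a + \<tau>))\<^sup>2 \<le> \<bar>max 0 a + \<tau>\<bar>\<^sup>2" by (intro power_mono) auto
  then show ?thesis by (simp add: power2_sum)
qed

context obstacle_problem
begin

definition subsol :: "((real^'n) \<times> real \<Rightarrow> real) \<Rightarrow> bool" where
  "subsol w \<longleftrightarrow> usc_on (UNIV \<times> {0..<T}) w \<and>
    (\<forall>x t. 0 \<le> t \<and> t < T \<longrightarrow> um x t \<le> w (x, t) \<and> w (x, t) \<le> up x t) \<and>
    (\<forall>x. w (x, 0) \<le> u0 x) \<and>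
    (\<forall>x t. 0 < t \<and> t < T \<and> um x t < w (x, t) \<longrightarrow> sub_at w x t)"

lemma subsolD:
  assumes "subsol w"
  shows "usc_on (UNIV \<times> {0..<T}) w"
    and "0 \<le> t \<Longrightarrow> t < T \<Longrightarrow> um x t \<le> w (x, t)"
    and "0 \<le> t \<Longrightarrow> t < T \<Longrightarrow> w (x, t) \<le> up x t"
    and "w (x, 0) \<le> u0 x"
    and "0 < t \<Longrightarrow> t < T \<Longrightarrow> um x t < w (x, t) \<Longrightarrow> sub_at w x t"
  using assms by (auto simp: subsol_def)

definition bnd :: real where
  "bnd = (SOME B. 0 < B \<and> (\<forall>x t. 0 \<le> t \<longrightarrow> \<bar>um x t\<bar> \<le> B \<and> \<bar>up x t\<bar> \<le> B))"

lemma bnd: "0 < bnd" "0 \<le> t \<Longrightarrow> \<bar>um x t\<bar> \<le> bnd" "0 \<le> t \<Longrightarrow> \<bar>up x t\<bar> \<le> bnd"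
proof -
  from um_bounded obtain B1 where B1: "\<And>x t. 0 \<le> t \<Longrightarrow> \<bar>um x t\<bar> \<le> B1"
    unfolding bounded_iff by auto
  from up_bounded obtain B2 where B2: "\<And>x t. 0 \<le> t \<Longrightarrow> \<bar>up x t\<bar> \<le> B2"
    unfolding bounded_iff by auto
  have "0 < max (max B1 B2) 1 \<and> (\<forall>x t. 0 \<le> t \<longrightarrow> \<bar>um x t\<bar> \<le> max (max B1 B2) 1 \<and> \<bar>up x t\<bar> \<le> max (max B1 B2) 1)"
    using B1 B2 by (auto simp: le_max_iff_disj)
  then have "0 < bnd \<and> (\<forall>x t. 0 \<le> t \<longrightarrow> \<bar>um x t\<bar> \<le> bnd \<and> \<bar>up x t\<bar> \<le> bnd)"
    unfolding bnd_def by (rule someI)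
  then show "0 < bnd" "0 \<le> t \<Longrightarrow> \<bar>um x t\<bar> \<le> bnd" "0 \<le> t \<Longrightarrow> \<bar>up x t\<bar> \<le> bnd" by auto
qed

lemma subsol_bnd: "subsol w \<Longrightarrow> 0 \<le> t \<Longrightarrow> t < T \<Longrightarrow> \<bar>w (x, t)\<bar> \<le> bnd"
  using subsolD(2,3)[of w t x] bnd(2,3)[of t x] by (simp add: abs_le_iff)

lemma continuous_on_um: "continuous_on (UNIV \<times> {0..}) (\<lambda>z. um (fst z) (snd z))"
  using uniformly_continuous_imp_continuous[OF um_ucont] by (simp add: case_prod_unfold)

lemma continuous_on_up: "continuous_on (UNIV \<times> {0..}) (\<lambda>z. up (fst z) (snd z))"
  using uniformly_continuous_imp_continuous[OF up_ucont] by (simp add: case_prod_unfold)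

lemma subsol_um: "subsol (\<lambda>z. um (fst z) (snd z))"
proof -
  have "continuous_on (UNIV \<times> {0..<T}) (\<lambda>z. um (fst z) (snd z))"
    by (rule continuous_on_subset[OF continuous_on_um]) auto
  then show ?thesis
    unfolding subsol_def by (auto intro: continuous_on_imp_usc_on obstacles_le simp: u0_between)
qed

text \<open>At a positive maximum of the difference the barrier is a flat test function of time
  slope at least \<open>C\<close>, whereas \<open>sub_at_flat_bound\<close> allows at most
  \<open>2 * A * (1 + K0)\<close>. The hypotheses keep the maximum away from the initial time, the
  lateral boundary and the lower obstacle.\<close>

lemma upper_barrier:
  assumes w: "subsol w" and s0: "0 \<le> s0" and A: "0 < A" and K0: "0 \<le> K0"
    and k: "\<And>x t. norm (x - x0) \<le> 1 \<Longrightarrow> 0 \<le> t \<Longrightarrow> t \<le> T \<Longrightarrow> \<bar>k x t\<bar> \<le> K0"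
    and C: "2 * A * (1 + K0) < C"
    and init: "\<And>x. w (x, s0) \<le> c0 + A * \<theta> ((norm (x - x0))\<^sup>2)"
    and obst: "\<And>x t. s0 \<le> t \<Longrightarrow> t < T \<Longrightarrow> um x t \<le> c0 + A * \<theta> ((norm (x - x0))\<^sup>2) + C * (t - s0)"
    and far: "\<And>x t. s0 \<le> t \<Longrightarrow> t < T \<Longrightarrow> 1 \<le> norm (x - x0) \<Longrightarrow> w (x, t) \<le> c0 + A * \<theta> ((norm (x - x0))\<^sup>2)"
    and t: "s0 \<le> t" "t < T"
  shows "w (x, t) \<le> c0 + A * \<theta> ((norm (x - x0))\<^sup>2) + C * (t - s0)"
proof (rule ccontr)
  assume neg: "\<not> ?thesis"
  have "0 < 2 * A * (1 + K0)" using A K0 by simp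
  with C have C0: "0 < C" by linarith
  define t3 where "t3 = (t + T) / 2"
  have t3: "t < t3" "t3 < T" using t by (auto simp: t3_def)
  \<comment> \<open>The penalty \<open>M * (max 0 (s - t))\<^sup>2\<close> vanishes up to time
    \<open>t\<close>, and at \<open>t3\<close> it exceeds \<open>2 * bnd\<close>, the largest
    possible value of \<open>w - c0\<close>. This keeps the maximum off the final time, where only
    one side would be available; the slope of the penalty has the favourable sign.\<close>
  define M where "M = (2 * bnd + 1) / (t3 - t)\<^sup>2"
  have M: "0 < M" "M * (t3 - t)\<^sup>2 = 2 * bnd + 1" using t3 bnd(1) by (auto simp: M_def)
  define G where "G z = c0 + A * \<theta> ((norm (fst z - x0))\<^sup>2) + C * (snd z - s0) + M * (max 0 (snd z - t))\<^sup>2"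
    for z :: "(real^'n) \<times> real"
  have contG: "continuous_on UNIV G"
    unfolding G_def by (intro continuous_intros continuous_on_\<theta>_compose) auto
  define D where "D = cball x0 1 \<times> {s0..t3}"
  have D: "compact D" "D \<subseteq> UNIV \<times> {0..<T}"
    unfolding D_def using s0 t3 by (auto intro: compact_Times)
  have xD: "(x, t) \<in> D"
  proof -
    have "norm (x - x0) < 1"
    proof (rule ccontr)
      assume "\<not> norm (x - x0) < 1"
      then have "w (x, t) \<le> c0 + A * \<theta> ((norm (x - x0))\<^sup>2)" using far[of t x] t by simp
      moreover have "0 \<le> C * (t - s0)" using C0 t by simp
      ultimately show False using neg by linarith
    qed
    then show ?thesis using t t3 by (auto simp: D_def dist_norm norm_minus_commute)
  qed
  have "usc_on (UNIV \<times> {0..<T}) (\<lambda>z. w z - G z)"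
    by (intro usc_on_diff_continuous subsolD(1)[OF w] continuous_on_subset[OF contG]) auto
  from usc_on_attains_sup[OF this D] xD obtain z where z: "z \<in> D" "\<And>y. y \<in> D \<Longrightarrow> w y - G y \<le> w z - G z"
    by blast
  obtain y s where ys: "z = (y, s)" by (cases z)
  have pos: "0 < w z - G z" using z(2)[OF xD] neg by (simp add: G_def)
  have s: "s0 \<le> s" "s \<le> t3" "norm (y - x0) \<le> 1"
    using z(1) by (auto simp: D_def ys dist_norm norm_minus_commute)
  have C1: "0 \<le> C * (s - s0)" using C0 s by simp
  have M1: "0 \<le> M * (max 0 (s - t))\<^sup>2" using M(1) by simp
  have \<theta>1: "0 \<le> A * \<theta> ((norm (y - x0))\<^sup>2)" using A \<theta>_nonneg by simp
  have "s \<noteq> s0" using pos init[of y] M1 by (auto simp: ys G_def)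
  moreover have "norm (y - x0) \<noteq> 1" using pos far[of s y] s t3 M1 C1 by (auto simp: ys G_def)
  moreover have "s \<noteq> t3"
  proof
    assume "s = t3"
    then have "M * (max 0 (s - t))\<^sup>2 = 2 * bnd + 1" using M t3 by simp
    moreover have "- bnd \<le> c0" using obst[of s0 x0] bnd(2)[of s0 x0] s0 t by (auto simp: \<theta>_zero)
    moreover have "w z \<le> bnd" using subsol_bnd[OF w, of s y] s s0 t3 by (auto simp: ys)
    ultimately show False using pos C1 \<theta>1 by (simp add: G_def ys)
  qed
  ultimately have s': "s0 < s" "s < t3" "norm (y - x0) < 1" using s by auto
  have "um y s < w (y, s)" using pos obst[of s y] s' t3 M1 by (auto simp: ys G_def)
  then have sub: "sub_at w y s" using subsolD(5)[OF w, of s y] s' s0 t3 by auto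
  define r where "r = min (1 - norm (y - x0)) (min (s - s0) (t3 - s))"
  have r: "0 < r" using s' by (simp add: r_def)
  have "C + 2 * M * max 0 (s - t) \<le> 2 * A * 1 * (1 * (norm (y - x0))\<^sup>2) * (1 + K0)"
  proof (rule sub_at_flat_bound[OF sub A])
    show "\<forall>\<^sub>F (h, \<tau>) in nhds 0. w (y + h, s + \<tau>) \<le> w (y, s) + (C + 2 * M * max 0 (s - t)) * \<tau> + M * \<tau>\<^sup>2 +
        A * (\<theta> (1 * (norm (y - x0 + h))\<^sup>2) - \<theta> (1 * (norm (y - x0))\<^sup>2))"
    proof (rule eventually_mono[OF eventually_nhds_0_norm_less[OF r]], clarify)
      fix h :: "real^'n" and \<tau> :: real assume h: "norm h < r" "\<bar>\<tau>\<bar> < r"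
      have "norm (y + h - x0) \<le> norm (y - x0) + norm h" using norm_triangle_ineq[of "y - x0" h] by (simp add: algebra_simps)
      then have "(y + h, s + \<tau>) \<in> D" using h by (auto simp: D_def r_def dist_norm norm_minus_commute)
      from z(2)[OF this] have "w (y + h, s + \<tau>) \<le> w (y, s) + (G (y + h, s + \<tau>) - G (y, s))" by (simp add: ys)
      moreover have "G (y + h, s + \<tau>) - G (y, s) = A * (\<theta> ((norm (y - x0 + h))\<^sup>2) - \<theta> ((norm (y - x0))\<^sup>2)) + C * \<tau>
         + M * ((max 0 (s - t + \<tau>))\<^sup>2 - (max 0 (s - t))\<^sup>2)"
        by (simp add: G_def algebra_simps)
      moreover have "M * ((max 0 (s - t + \<tau>))\<^sup>2 - (max 0 (s - t))\<^sup>2) \<le> M * (2 * max 0 (s - t) * \<tau> + \<tau>\<^sup>2)"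
        using max_zero_square_le[of "s - t" \<tau>] M(1) by (intro mult_left_mono) auto
      ultimately show "w (y + h, s + \<tau>) \<le> w (y, s) + (C + 2 * M * max 0 (s - t)) * \<tau> + M * \<tau>\<^sup>2 +
        A * (\<theta> (1 * (norm (y - x0 + h))\<^sup>2) - \<theta> (1 * (norm (y - x0))\<^sup>2))"
        by (simp add: algebra_simps)
    qed
  qed (use s k[of y s] s0 t3 in auto)
  moreover have "0 \<le> M * max 0 (s - t)" using M by simp
  moreover have "2 * A * 1 * (1 * (norm (y - x0))\<^sup>2) * (1 + K0) \<le> 2 * A * (1 + K0) * 1"
  proof -
    have "(2 * A * (1 + K0)) * (norm (y - x0))\<^sup>2 \<le> (2 * A * (1 + K0)) * 1"
      using A K0 s by (intro mult_left_mono) (auto simp: abs_square_le_1 power_le_one_iff)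
    moreover have "2 * A * 1 * (1 * (norm (y - x0))\<^sup>2) * (1 + K0) = (2 * A * (1 + K0)) * (norm (y - x0))\<^sup>2"
      by (simp add: algebra_simps)
    ultimately show ?thesis by (simp only:)
  qed
  ultimately show False using C by linarith
qed

text \<open>Below the scale \<open>d\<close> uniform continuity gives \<open>\<epsilon>\<close>;
  above it the oscillation \<open>2 * B\<close> is at most \<open>2 * B / d\<close> times the
  elapsed time. With such a slope a barrier outruns the motion of an obstacle.\<close>

lemma uniform_time_bound:
  fixes f :: "real^'n \<Rightarrow> real \<Rightarrow> real"
  assumes "uniformly_continuous_on (UNIV \<times> {0..}) (\<lambda>(x, t). f x t)"
    and "\<And>x t. 0 \<le> t \<Longrightarrow> \<bar>f x t\<bar> \<le> B" and "0 < \<epsilon>"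
  shows "\<exists>C\<ge>0. \<forall>x s t. 0 \<le> s \<longrightarrow> s \<le> t \<longrightarrow> \<bar>f x t - f x s\<bar> \<le> \<epsilon> + C * (t - s)"
proof -
  from assms(1,3) obtain d where d: "d > 0"
    "\<And>z z'. z \<in> UNIV \<times> {0..} \<Longrightarrow> z' \<in> UNIV \<times> {0..} \<Longrightarrow> dist z' z < d \<Longrightarrow>
      dist (case z' of (x, t) \<Rightarrow> f x t) (case z of (x, t) \<Rightarrow> f x t) < \<epsilon>"
    unfolding uniformly_continuous_on_def by meson
  have B: "0 \<le> B" using assms(2)[of 0 undefined] by simp
  have "\<bar>f x t - f x s\<bar> \<le> \<epsilon> + 2 * B / d * (t - s)" if "0 \<le> s" "s \<le> t" for x s t
  proof (cases "t - s < d")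
    case True
    then have "\<bar>f x t - f x s\<bar> < \<epsilon>"
      using d(2)[of "(x, s)" "(x, t)"] that by (auto simp: dist_Pair_Pair dist_real_def)
    moreover have "0 \<le> 2 * B / d * (t - s)" using B d that by simp
    ultimately show ?thesis by linarith
  next
    case False
    then have "2 * B / d * d \<le> 2 * B / d * (t - s)" using B d by (intro mult_left_mono) auto
    moreover have "2 * B / d * d = 2 * B" using d by simp
    moreover have "\<bar>f x t - f x s\<bar> \<le> 2 * B" using assms(2)[of t x] assms(2)[of s x] that by linarith
    ultimately show ?thesis using assms(3) by linarith
  qed
  moreover have "0 \<le> 2 * B / d" using B d by simp
  ultimately show ?thesis by blast
qed

section \<open>The common modulus and the constants of the barriers\<close>

lemma \<omega>_mono: "0 \<le> r \<Longrightarrow> r \<le> s \<Longrightarrow> \<omega> r \<le> \<omega> s"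
  using u0_modulus by (auto simp: modulus_of_continuity_on_def is_modulus_def mono_on_def)

lemma \<omega>_nonneg: "0 \<le> r \<Longrightarrow> 0 \<le> \<omega> r"
  using u0_modulus by (auto simp: modulus_of_continuity_on_def is_modulus_def)

lemma \<omega>_small: "0 < \<epsilon> \<Longrightarrow> \<exists>d>0. \<forall>r. 0 < r \<and> r < d \<longrightarrow> \<omega> r < \<epsilon>"
proof -
  assume "0 < \<epsilon>"
  have "(\<omega> \<longlongrightarrow> 0) (at_right 0)"
    using u0_modulus by (auto simp: modulus_of_continuity_on_def is_modulus_def)
  from order_tendstoD(2)[OF this \<open>0 < \<epsilon>\<close>] show ?thesis
    by (auto simp: eventually_at_right_field)
qed

lemma u0_\<omega>: "\<bar>u0 x - u0 y\<bar> \<le> \<omega> (norm (x - y))"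
  using u0_modulus by (auto simp: modulus_of_continuity_on_def dist_norm)

lemma um_\<omega>: "0 \<le> t \<Longrightarrow> \<bar>um x t - um y t\<bar> \<le> \<omega> (norm (x - y))"
  using um_modulus by (force simp: modulus_of_continuity_on_def dist_norm dist_Pair_Pair)

lemma up_\<omega>: "0 \<le> t \<Longrightarrow> \<bar>up x t - up y t\<bar> \<le> \<omega> (norm (x - y))"
  using up_modulus by (force simp: modulus_of_continuity_on_def dist_norm dist_Pair_Pair)

text \<open>The factor \<open>exp (L * T)\<close> dominates the growth of the modulus up to time
  \<open>T\<close>, so the same constants serve for \<open>u0\<close> and for all later times. The
  minimum with \<open>2 * bnd\<close> reflects that the functions concerned are bounded by
  \<open>bnd\<close>.\<close>

definition barrier_consts :: "real \<Rightarrow> real^'n \<Rightarrow> real \<Rightarrow> real \<Rightarrow> real \<Rightarrow> bool" where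
  "barrier_consts \<epsilon> x0 A C K0 \<longleftrightarrow> 0 < A \<and> 0 \<le> K0 \<and> 2 * A * (1 + K0) < C \<and>
    (\<forall>x t. norm (x - x0) \<le> 1 \<longrightarrow> 0 \<le> t \<longrightarrow> t \<le> T \<longrightarrow> \<bar>k x t\<bar> \<le> K0) \<and>
    (\<forall>x. x \<noteq> x0 \<longrightarrow> min (\<omega> (exp (L * T) * norm (x - x0))) (2 * bnd) \<le> \<epsilon> + A * \<theta> ((norm (x - x0))\<^sup>2)) \<and>
    (\<forall>x. 1 \<le> norm (x - x0) \<longrightarrow> 2 * bnd \<le> A * \<theta> ((norm (x - x0))\<^sup>2)) \<and>
    (\<forall>x s t. 0 \<le> s \<longrightarrow> s \<le> t \<longrightarrow> \<bar>um x t - um x s\<bar> \<le> \<epsilon> + C * (t - s)) \<and>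
    (\<forall>x s t. 0 \<le> s \<longrightarrow> s \<le> t \<longrightarrow> \<bar>up x t - up x s\<bar> \<le> \<epsilon> + C * (t - s))"

lemma barrier_constsD:
  assumes "barrier_consts \<epsilon> x0 A C K0"
  shows "0 < A" "0 \<le> K0" "2 * A * (1 + K0) < C"
    "\<And>x t. norm (x - x0) \<le> 1 \<Longrightarrow> 0 \<le> t \<Longrightarrow> t \<le> T \<Longrightarrow> \<bar>k x t\<bar> \<le> K0"
    "\<And>x. x \<noteq> x0 \<Longrightarrow> min (\<omega> (exp (L * T) * norm (x - x0))) (2 * bnd) \<le> \<epsilon> + A * \<theta> ((norm (x - x0))\<^sup>2)"
    "\<And>x. 1 \<le> norm (x - x0) \<Longrightarrow> 2 * bnd \<le> A * \<theta> ((norm (x - x0))\<^sup>2)"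
    "\<And>x s t. 0 \<le> s \<Longrightarrow> s \<le> t \<Longrightarrow> \<bar>um x t - um x s\<bar> \<le> \<epsilon> + C * (t - s)"
    "\<And>x s t. 0 \<le> s \<Longrightarrow> s \<le> t \<Longrightarrow> \<bar>up x t - up x s\<bar> \<le> \<epsilon> + C * (t - s)"
  using assms unfolding barrier_consts_def by simp_all

lemma barrier_constants:
  assumes "0 < \<epsilon>"
  shows "\<exists>A C K0. barrier_consts \<epsilon> x0 A C K0"
proof -
  obtain K0 where K0: "0 \<le> K0" "\<And>x t. norm (x - x0) \<le> 1 \<Longrightarrow> 0 \<le> t \<Longrightarrow> t \<le> T \<Longrightarrow> \<bar>k x t\<bar> \<le> K0"
    using k_bound[of x0] by blast
  obtain C1 where C1: "0 \<le> C1" "\<And>x s t. 0 \<le> s \<Longrightarrow> s \<le> t \<Longrightarrow> \<bar>um x t - um x s\<bar> \<le> \<epsilon> + C1 * (t - s)"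
    using uniform_time_bound[OF um_ucont bnd(2) assms] by blast
  obtain C2 where C2: "0 \<le> C2" "\<And>x s t. 0 \<le> s \<Longrightarrow> s \<le> t \<Longrightarrow> \<bar>up x t - up x s\<bar> \<le> \<epsilon> + C2 * (t - s)"
    using uniform_time_bound[OF up_ucont bnd(3) assms] by blast
  obtain d0 where d0: "0 < d0" "\<And>r. 0 < r \<Longrightarrow> r < d0 \<Longrightarrow> \<omega> r < \<epsilon>" using \<omega>_small[OF assms] by blast
  \<comment> \<open>Inside radius \<open>d\<close> the modulus is at most \<open>\<epsilon>\<close>;
    outside, \<open>A\<close> makes \<open>A * \<theta>\<close> exceed the oscillation
    \<open>2 * bnd\<close>. Since \<open>d \<le> 1\<close>, the second alternative includes all
    points at distance at least 1.\<close>
  define d where "d = min 1 (d0 / exp (L * T))"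
  have d: "0 < d" "d \<le> 1" using d0 by (auto simp: d_def)
  define A where "A = 2 * bnd / \<theta> (d\<^sup>2)"
  have \<theta>d: "0 < \<theta> (d\<^sup>2)" using d by (intro \<theta>_pos) auto
  have A: "0 < A" "A * \<theta> (d\<^sup>2) = 2 * bnd" using \<theta>d bnd(1) by (auto simp: A_def)
  have far: "2 * bnd \<le> A * \<theta> ((norm (x - x0))\<^sup>2)" if "d \<le> norm (x - x0)" for x
  proof -
    have "\<theta> (d\<^sup>2) \<le> \<theta> ((norm (x - x0))\<^sup>2)" using that d by (intro \<theta>_mono power_mono) auto
    then have "A * \<theta> (d\<^sup>2) \<le> A * \<theta> ((norm (x - x0))\<^sup>2)" using A by (intro mult_left_mono) auto
    with A(2) show ?thesis by simp
  qed
  have near: "\<omega> (exp (L * T) * norm (x - x0)) \<le> \<epsilon>" if "x \<noteq> x0" "norm (x - x0) < d" for x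
  proof -
    have "norm (x - x0) < d0 / exp (L * T)" using that by (simp add: d_def)
    then have "exp (L * T) * norm (x - x0) < d0" by (simp add: pos_less_divide_eq mult.commute)
    then show ?thesis using d0(2)[of "exp (L * T) * norm (x - x0)"] that by simp
  qed
  define C where "C = max (2 * A * (1 + K0) + 1) (max C1 C2)"
  have C: "C1 \<le> C" "C2 \<le> C" by (simp_all add: C_def)
  have "barrier_consts \<epsilon> x0 A C K0"
    unfolding barrier_consts_def
  proof (intro conjI allI impI A(1) K0)
    show "2 * A * (1 + K0) < C" by (simp add: C_def)
    show "min (\<omega> (exp (L * T) * norm (x - x0))) (2 * bnd) \<le> \<epsilon> + A * \<theta> ((norm (x - x0))\<^sup>2)" if "x \<noteq> x0" for x
    proof (cases "norm (x - x0) < d")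
      case True
      have "0 \<le> A * \<theta> ((norm (x - x0))\<^sup>2)" using A \<theta>_nonneg by simp
      with near[OF that True] show ?thesis by linarith
    next
      case False
      then show ?thesis using far[of x] assms by linarith
    qed
    show "2 * bnd \<le> A * \<theta> ((norm (x - x0))\<^sup>2)" if "1 \<le> norm (x - x0)" for x using far[of x] d that by simp
    show "\<bar>um x t - um x s\<bar> \<le> \<epsilon> + C * (t - s)" if "0 \<le> s" "s \<le> t" for x s t
      using C1(2)[OF that, of x] mult_right_mono[of C1 C "t - s"] that C by linarith
    show "\<bar>up x t - up x s\<bar> \<le> \<epsilon> + C * (t - s)" if "0 \<le> s" "s \<le> t" for x s t
      using C2(2)[OF that, of x] mult_right_mono[of C2 C "t - s"] that C by linarith
  qed
  then show ?thesis by blast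
qed


subsection \<open>The greatest strong subsolution\<close>

text \<open>
  The points \<open>y\<close> range over neighbourhoods of \<open>z\<close>: \<open>perron\<close> is the upper semicontinuous envelope of
  the supremum of all strong subsolutions.
\<close>

definition perron_below :: "(real^'n) \<times> real \<Rightarrow> real set" where
  "perron_below z = {c. \<forall>r>0. \<exists>w y. subsol w \<and> y \<in> UNIV \<times> {0..<T} \<and> dist z y < r \<and> c < w y}"

definition perron :: "(real^'n) \<times> real \<Rightarrow> real" where
  "perron z = Sup (perron_below z)"

lemma bdd_above_perron_below: "bdd_above (perron_below z)"
proof (rule bdd_aboveI[of _ bnd])
  fix c assume "c \<in> perron_below z"
  then obtain w y where "subsol w" "y \<in> UNIV \<times> {0..<T}" "c < w y"
    unfolding perron_below_def using zero_less_one by blast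
  then show "c \<le> bnd" using subsol_bnd[of w "snd y" "fst y"] by (auto simp: abs_le_iff)
qed

lemma perron_below_subsol:
  assumes "subsol w" "z \<in> UNIV \<times> {0..<T}" "c < w z"
  shows "c \<in> perron_below z"
  unfolding perron_below_def
proof (intro CollectI allI impI exI conjI)
  fix r :: real assume "0 < r"
  then show "dist z z < r" by simp
qed (use assms in auto)

lemma perron_leI:
  assumes "r > 0" "z \<in> UNIV \<times> {0..<T}"
    and "\<And>w y. subsol w \<Longrightarrow> y \<in> UNIV \<times> {0..<T} \<Longrightarrow> dist z y < r \<Longrightarrow> w y \<le> c"
  shows "perron z \<le> c"
  unfolding perron_def
proof (rule cSup_least)
  show "perron_below z \<noteq> {}"
    using perron_below_subsol[OF subsol_um assms(2), of "um (fst z) (snd z) - 1"] by auto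
  fix c' assume "c' \<in> perron_below z"
  then obtain w y where "subsol w" "y \<in> UNIV \<times> {0..<T}" "dist z y < r" "c' < w y"
    unfolding perron_below_def using assms(1) by blast
  with assms(3)[of w y] show "c' \<le> c" by simp
qed

lemma perron_approx:
  assumes "c < perron z" "z \<in> UNIV \<times> {0..<T}" "r > 0"
  shows "\<exists>w y. subsol w \<and> y \<in> UNIV \<times> {0..<T} \<and> dist z y < r \<and> c < w y"
proof (rule ccontr)
  assume neg: "\<not> ?thesis"
  have "perron z \<le> c"
  proof (rule perron_leI[OF assms(3,2)])
    fix w y assume "subsol w" "y \<in> UNIV \<times> {0..<T}" "dist z y < r"
    with neg show "w y \<le> c" using not_less by blast
  qed
  with assms(1) show False by simp
qed

lemma subsol_le_perron:
  assumes "subsol w" "z \<in> UNIV \<times> {0..<T}"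
  shows "w z \<le> perron z"
proof (rule dense_ge)
  fix c assume "perron z < c"
  show "w z \<le> c"
  proof (rule ccontr)
    assume "\<not> w z \<le> c"
    then have "c \<in> perron_below z" by (intro perron_below_subsol[OF assms]) auto
    then have "c \<le> perron z" unfolding perron_def by (intro cSup_upper bdd_above_perron_below)
    with \<open>perron z < c\<close> show False by simp
  qed
qed

lemma perron_le_continuous:
  assumes "continuous_on (UNIV \<times> {0..<T}) G" "z \<in> UNIV \<times> {0..<T}"
    and "\<And>w y. subsol w \<Longrightarrow> y \<in> UNIV \<times> {0..<T} \<Longrightarrow> w y \<le> G y"
  shows "perron z \<le> G z"
proof (rule field_le_epsilon)
  fix e :: real assume "0 < e"
  then obtain r where r: "r > 0" "\<And>y. y \<in> UNIV \<times> {0..<T} \<Longrightarrow> dist y z < r \<Longrightarrow> dist (G y) (G z) < e"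
    using assms(1,2) unfolding continuous_on_iff by blast
  show "perron z \<le> G z + e"
  proof (rule perron_leI[OF r(1) assms(2)])
    fix w y assume *: "subsol w" "y \<in> UNIV \<times> {0..<T}" "dist z y < r"
    then have "dist (G y) (G z) < e" by (intro r(2)) (simp_all only: dist_commute)
    then have "G y < G z + e" by (simp add: dist_real_def abs_less_iff)
    with assms(3)[OF *(1,2)] show "w y \<le> G z + e" by linarith
  qed
qed

lemma usc_on_perron: "usc_on (UNIV \<times> {0..<T}) perron"
proof (rule usc_onI)
  fix z c assume z: "z \<in> UNIV \<times> {0..<T}" "perron z < c"
  define c' where "c' = (perron z + c) / 2"
  have c': "perron z < c'" "c' < c" using z by (auto simp: c'_def)
  have "c' \<notin> perron_below z"
  proof
    assume "c' \<in> perron_below z"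
    then have "c' \<le> perron z" unfolding perron_def by (intro cSup_upper bdd_above_perron_below)
    with c' show False by simp
  qed
  then have "\<exists>r. 0 < r \<and> \<not> (\<exists>w y. subsol w \<and> y \<in> UNIV \<times> {0..<T} \<and> dist z y < r \<and> c' < w y)"
    unfolding perron_below_def mem_Collect_eq not_all not_imp .
  then obtain r where r0: "0 < r \<and> \<not> (\<exists>w y. subsol w \<and> y \<in> UNIV \<times> {0..<T} \<and> dist z y < r \<and> c' < w y)" ..
  have r: "r > 0" using r0 ..
  have r': "w y \<le> c'" if "subsol w" "y \<in> UNIV \<times> {0..<T}" "dist z y < r" for w y
  proof (rule ccontr)
    assume "\<not> w y \<le> c'"
    with that have "\<exists>w y. subsol w \<and> y \<in> UNIV \<times> {0..<T} \<and> dist z y < r \<and> c' < w y"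
      by (intro exI[of _ w] exI[of _ y] conjI) auto
    from conjunct2[OF r0] this show False by (rule notE)
  qed
  have "perron y < c" if "y \<in> UNIV \<times> {0..<T}" "dist y z < r / 2" for y
  proof -
    have "perron y \<le> c'"
    proof (rule perron_leI[of "r / 2"])
      fix w y' assume "subsol w" "y' \<in> UNIV \<times> {0..<T}" "dist y y' < r / 2"
      moreover have "dist z y' < r"
        using dist_triangle_half_r[of y z r y'] that \<open>dist y y' < r / 2\<close> by (simp add: dist_commute)
      ultimately show "w y' \<le> c'" by (intro r')
    qed (use that r in auto)
    with c' show ?thesis by simp
  qed
  with r show "\<exists>d>0. \<forall>y\<in>UNIV \<times> {0..<T}. dist y z < d \<longrightarrow> perron y < c"
    by (intro exI[of _ "r / 2"]) simp
qed


text \<open>Stability of strict maxima under the relaxed supremum: a member \<open>w\<close> that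
  nearly reaches \<open>perron\<close> close to the strict maximum attains its own maximum over a
  closed ball in the interior, because on the sphere even \<open>perron\<close> is too low.\<close>

lemma perron_contact:
  assumes t0: "0 < t0" "t0 < T" and gt: "um x0 t0 < perron (x0, t0)" and G: "continuous_on UNIV G"
    and strict: "\<rho> > 0" "\<And>y. 0 < dist y (x0, t0) \<Longrightarrow> dist y (x0, t0) < \<rho> \<Longrightarrow> perron y - G y < perron (x0, t0) - G (x0, t0)"
    and "r > 0"
  shows "\<exists>w x t. subsol w \<and> dist (x, t) (x0, t0) < r \<and> 0 < t \<and> t < T \<and> um x t < w (x, t) \<and>
    (\<forall>\<^sub>F y in nhds (x, t). w y - G y \<le> w (x, t) - G (x, t))"
proof -
  let ?z = "(x0, t0)" and ?Q = "UNIV \<times> {0..<T} :: ((real^'n) \<times> real) set"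
  \<comment> \<open>A quarter of the gap: one part for the variation of \<open>G\<close>, one for
    the variation of \<open>um\<close>, and at most two for the loss \<open>2 * m\<close>, so that
    \<open>w\<close> stays strictly above \<open>um\<close> at the new contact point.\<close>
  define \<eta> where "\<eta> = (perron ?z - um x0 t0) / 4"
  have \<eta>: "0 < \<eta>" using gt by (simp add: \<eta>_def)
  have zQ: "?z \<in> ?Q" using t0 by simp
  obtain r1 where r1: "r1 > 0" "\<And>y. dist y ?z < r1 \<Longrightarrow> dist (G y) (G ?z) < \<eta>"
    using G \<eta> unfolding continuous_on_iff by (meson UNIV_I)
  obtain r2 where r2: "r2 > 0" "\<And>y. y \<in> UNIV \<times> {0..} \<Longrightarrow> dist y ?z < r2 \<Longrightarrow>
      dist (um (fst y) (snd y)) (um (fst ?z) (snd ?z)) < \<eta>"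
    using continuous_on_um \<eta> t0 unfolding continuous_on_iff
    by (metis SigmaI UNIV_I atLeast_iff less_imp_le)
  define R where "R = min (min r \<rho>) (min (min r1 r2) (min t0 (T - t0))) / 2"
  have R: "0 < R" "R < r" "R < \<rho>" "R < r1" "R < r2" "R < t0" "R < T - t0"
    using assms r1 r2 by (auto simp: R_def min_def)
  define B where "B = cball ?z R"
  have time: "0 < snd y" "snd y < T" if "dist y ?z \<le> R" for y
    using order_trans[OF dist_snd_le that] R by (auto simp: dist_real_def abs_le_iff)
  have BQ: "B \<subseteq> ?Q"
  proof
    fix y assume "y \<in> B"
    then have "dist y ?z \<le> R" by (simp add: B_def dist_commute)
    from time[OF this] show "y \<in> ?Q" by (cases y) auto
  qed
  have "compact (sphere ?z R)" "sphere ?z R \<subseteq> ?Q"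
    using BQ by (auto simp: B_def)
  have uscP: "usc_on ?Q (\<lambda>y. perron y - G y)"
    by (intro usc_on_diff_continuous usc_on_perron continuous_on_subset[OF G]) auto
  \<comment> \<open>The margin on the sphere is twice \<open>m\<close>: one \<open>m\<close> is
    spent on approximating \<open>perron ?z\<close> by a value of \<open>w\<close>, the other on the
    change of \<open>G\<close> between the two points.\<close>
  have "\<exists>m>0. m \<le> \<eta> \<and> (\<forall>y\<in>sphere ?z R. perron y - G y \<le> perron ?z - G ?z - 2 * m)"
  proof (cases "sphere ?z R = {}")
    case True
    then show ?thesis using \<eta> by auto
  next
    case False
    from usc_on_attains_sup[OF uscP \<open>compact (sphere ?z R)\<close> \<open>sphere ?z R \<subseteq> ?Q\<close> False]
    obtain y where y: "y \<in> sphere ?z R" "\<And>y'. y' \<in> sphere ?z R \<Longrightarrow> perron y' - G y' \<le> perron y - G y" by blast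
    have "perron y - G y < perron ?z - G ?z" using y(1) R by (intro strict) (auto simp: dist_commute)
    define m where "m = min \<eta> ((perron ?z - G ?z - (perron y - G y)) / 2)"
    have "m > 0" using \<eta> \<open>perron y - G y < perron ?z - G ?z\<close> by (simp add: m_def)
    moreover have "perron y - G y \<le> perron ?z - G ?z - 2 * m" "m \<le> \<eta>" by (auto simp: m_def min_def field_simps)
    ultimately show ?thesis using y(2) by (intro exI[of _ m]) force
  qed
  then obtain m where m: "m > 0" "m \<le> \<eta>" "\<And>y. y \<in> sphere ?z R \<Longrightarrow> perron y - G y \<le> perron ?z - G ?z - 2 * m" by blast
  obtain r3 where r3: "r3 > 0" "\<And>y. dist y ?z < r3 \<Longrightarrow> dist (G y) (G ?z) < m"
    using G m unfolding continuous_on_iff by (meson UNIV_I)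
  have "perron ?z - m < perron ?z" "0 < min r3 R" using m r3 R by auto
  from perron_approx[OF this(1) zQ this(2)] obtain w y0 where
    w: "subsol w" and y0: "dist ?z y0 < min r3 R" "perron ?z - m < w y0" by blast
  have y0B: "y0 \<in> B" using y0 by (auto simp: B_def)
  have "\<bar>G y0 - G ?z\<bar> < m" using r3(2)[of y0] y0 by (auto simp: dist_commute dist_real_def)
  with y0(2) have low: "perron ?z - G ?z - 2 * m < w y0 - G y0" by (simp add: abs_less_iff)
  have "usc_on ?Q (\<lambda>y. w y - G y)"
    by (intro usc_on_diff_continuous subsolD(1)[OF w] continuous_on_subset[OF G]) auto
  from usc_on_attains_sup[OF this _ BQ] y0B
  obtain y where y: "y \<in> B" "\<And>y'. y' \<in> B \<Longrightarrow> w y' - G y' \<le> w y - G y"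
    unfolding B_def using compact_cball by blast
  have low': "perron ?z - G ?z - 2 * m < w y - G y" using low y(2)[OF y0B] by simp
  have "y \<notin> sphere ?z R"
    using m(3)[of y] subsol_le_perron[OF w, of y] low' y(1) BQ by force
  then have yR: "dist y ?z < R" using y(1) by (auto simp: B_def dist_commute)
  obtain x t where xt: "y = (x, t)" by (cases y)
  have tt: "0 < t" "t < T" using time[of y] yR by (auto simp: xt)
  have "um x t < w (x, t)"
  proof -
    have "\<bar>G y - G ?z\<bar> < \<eta>" using r1(2)[of y] yR R by (simp add: dist_real_def)
    moreover have "\<bar>um x t - um x0 t0\<bar> < \<eta>" using r2(2)[of y] yR R tt by (simp add: dist_real_def xt)
    moreover have "perron ?z = um x0 t0 + 4 * \<eta>" by (simp add: \<eta>_def field_simps)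
    ultimately show ?thesis using low' m(2) unfolding xt by linarith
  qed
  moreover have "\<forall>\<^sub>F y' in nhds y. w y' - G y' \<le> w y - G y"
    unfolding eventually_nhds
    by (rule exI[of _ "ball ?z R"]) (use y(2) yR in \<open>auto simp: B_def dist_commute\<close>)
  ultimately show ?thesis using w yR R(2) tt unfolding xt by (intro exI[of _ w] exI[of _ x] exI[of _ t]) auto
qed

section \<open>The envelope is itself a strong subsolution\<close>

lemma k_tendsto:
  assumes "0 < t"
  shows "((\<lambda>z. k (fst z) (snd z)) \<longlongrightarrow> k x t) (nhds (x, t))"
proof -
  have "continuous_on (UNIV \<times> {0..}) (\<lambda>z. k (fst z) (snd z))"
    using lipschitz_on_continuous_on[OF k_lipschitz] by (simp add: case_prod_unfold)
  then have "continuous_on (UNIV \<times> {0<..}) (\<lambda>z. k (fst z) (snd z))"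
    by (rule continuous_on_subset) auto
  from continuous_on_tendsto_compose[OF this filterlim_ident, of "(x, t)"]
  show ?thesis
    using assms eventually_nhds_in_open[of "UNIV \<times> {0<..}" "(x, t)"] by (simp add: open_Times)
qed

lemma F_add_mat_tendsto:
  assumes "p \<noteq> 0" "X \<in> sym_matrices"
  shows "((\<lambda>\<epsilon>. F p (X + mat (2 * \<epsilon>))) \<longlongrightarrow> F p X) (at_right 0)"
proof -
  have "((\<lambda>\<epsilon>. X + mat (2 * \<epsilon>)) \<longlongrightarrow> X + mat (2 * 0)) (at_right 0)"
  proof -
    have "mat (2 * \<epsilon>) = (2 * \<epsilon>) *\<^sub>R (mat 1 :: real^'n^'n)" for \<epsilon> by (simp add: mat_def vec_eq_iff)
    then show ?thesis by (simp only:) (intro tendsto_intros)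
  qed
  moreover have "mat (2 * 0) = (0 :: real^'n^'n)" by (simp add: mat_def vec_eq_iff)
  ultimately have "((\<lambda>\<epsilon>. X + mat (2 * \<epsilon>)) \<longlongrightarrow> X) (at_right 0)" by simp
  then show ?thesis
    by (intro F_tendsto tendsto_const assms) (auto intro!: always_eventually sym_matrices_intros assms)
qed

text \<open>Adding \<open>\<epsilon> * (norm h)\<^sup>2 + \<tau>\<^sup>2\<close> makes the contact
  strict. If the inequality failed for the perturbed jet it would fail for all nearby jets,
  \<open>F\<close> being continuous at nonzero gradient; but some member of the class is touched by
  the same polynomial at a nearby point.\<close>

lemma sub_at_perron_nonzero:
  assumes t: "0 < t" "t < T" and gt: "um x t < perron (x, t)" and X: "X \<in> sym_matrices" and p: "p \<noteq> 0"
    and touch: "\<forall>\<^sub>F (h, \<tau>) in nhds 0. perron (x + h, t + \<tau>) \<le> perron (x, t) + poly2 a p X K h \<tau>"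
  shows "a + F p X + k x t * norm p \<le> 0"
proof -
  have eps: "a + F p (X + mat (2 * \<epsilon>)) + k x t * norm p \<le> 0" if "0 < \<epsilon>" for \<epsilon>
  proof (rule ccontr)
    define X' where "X' = X + mat (2 * \<epsilon>)"
    have X': "X' \<in> sym_matrices" unfolding X'_def by (intro sym_matrices_intros X)
    define G where "G z = poly2 a p X' (K + 1) (fst z - x) (snd z - t)" for z
    have G: "continuous_on UNIV G" unfolding G_def by (rule continuous_on_poly2)
    define q where "q z = p + X' *v (fst z - x)" for z :: "(real^'n) \<times> real"
    \<comment> \<open>The left-hand side of the inequality for the polynomial re-expanded at
      \<open>z\<close>, where its gradient is \<open>q z\<close>.\<close>
    define H where "H z = a + 2 * (K + 1) * (snd z - t) + F (q z) X' + k (fst z) (snd z) * norm (q z)" for z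
    assume "\<not> ?thesis"
    then have H0: "0 < a + 2 * (K + 1) * (snd (x, t) - t) + F p X' + k x t * norm p" by (simp add: X'_def)
    have q: "(q \<longlongrightarrow> p + X' *v (fst (x, t) - x)) (nhds (x, t))"
      unfolding q_def
      by (intro tendsto_intros bounded_linear.tendsto[OF matrix_vector_mul_bounded_linear] tendsto_fst filterlim_ident)
    then have q: "(q \<longlongrightarrow> p) (nhds (x, t))" by simp
    have "(H \<longlongrightarrow> a + 2 * (K + 1) * (snd (x, t) - t) + F p X' + k x t * norm p) (nhds (x, t))"
      unfolding H_def
      by (intro tendsto_intros F_tendsto q k_tendsto t tendsto_snd filterlim_ident p X') (simp add: X')
    from order_tendstoD(1)[OF this H0] have "\<forall>\<^sub>F z in nhds (x, t). 0 < H z" .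
    moreover have "\<forall>\<^sub>F z in nhds (x, t). q z \<noteq> 0" using tendsto_imp_eventually_ne[OF q p] .
    ultimately have "\<forall>\<^sub>F z in nhds (x, t). 0 < H z \<and> q z \<noteq> 0" by eventually_elim auto
    then obtain r where r: "r > 0" "\<And>z. dist z (x, t) < r \<Longrightarrow> 0 < H z \<and> q z \<noteq> 0"
      by (auto simp: eventually_nhds_metric)
    have "\<forall>\<^sub>F (y, s) in nhds (x, t). perron (y, s) \<le> perron (x, t) + poly2 a p X K (y - x) (s - t)"
      using touch by (subst eventually_nhds_0_Pair_iff_shift[symmetric]) simp
    then obtain \<rho> where \<rho>: "\<rho> > 0" "\<And>y s. dist (y, s) (x, t) < \<rho> \<Longrightarrow> perron (y, s) \<le> perron (x, t) + poly2 a p X K (y - x) (s - t)"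
      by (auto simp: eventually_nhds_metric)
    have "\<exists>w x' t'. subsol w \<and> dist (x', t') (x, t) < r \<and> 0 < t' \<and> t' < T \<and> um x' t' < w (x', t') \<and>
      (\<forall>\<^sub>F y in nhds (x', t'). w y - G y \<le> w (x', t') - G (x', t'))"
    proof (rule perron_contact[OF t gt G \<rho>(1) _ r(1)])
      fix y assume y: "0 < dist y (x, t)" "dist y (x, t) < \<rho>"
      obtain x' t' where xt: "y = (x', t')" by (cases y)
      have "perron y \<le> perron (x, t) + poly2 a p X K (x' - x) (t' - t)" using \<rho>(2)[of x' t'] y by (simp add: xt)
      moreover have "poly2 a p X K (x' - x) (t' - t) = G y - (\<epsilon> * (norm (x' - x))\<^sup>2 + (t' - t)\<^sup>2)"
        unfolding G_def X'_def poly2_add_mat xt by (simp add: poly2_def algebra_simps)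
      moreover have "0 < \<epsilon> * (norm (x' - x))\<^sup>2 + (t' - t)\<^sup>2"
      proof (cases "x' = x")
        case True
        then show ?thesis using y by (simp add: xt)
      next
        case False
        then have "0 < \<epsilon> * (norm (x' - x))\<^sup>2" using that by simp
        then show ?thesis by (rule add_pos_nonneg) simp
      qed
      moreover have "G (x, t) = 0" by (simp add: G_def)
      ultimately show "perron y - G y < perron (x, t) - G (x, t)" by linarith
    qed
    then obtain w x' t' where w: "subsol w" "dist (x', t') (x, t) < r" "0 < t'" "t' < T" "um x' t' < w (x', t')"
      and loc: "\<forall>\<^sub>F y in nhds (x', t'). w y - G y \<le> w (x', t') - G (x', t')" by blast
    have sub: "sub_at w x' t'" by (rule subsolD(5)[OF w(1,3-5)])
    have "\<forall>\<^sub>F (h, \<tau>) in nhds 0. w (x' + h, t' + \<tau>) \<le> w (x', t') + poly2 (a + 2 * (K + 1) * (t' - t)) (p + X' *v (x' - x)) X' (K + 1) h \<tau>"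
    proof -
      have "\<forall>\<^sub>F (y, s) in nhds (x', t'). w (y, s) - G (y, s) \<le> w (x', t') - G (x', t')"
        using loc by (simp add: case_prod_unfold)
      then have "\<forall>\<^sub>F (h, \<tau>) in nhds 0. w (x' + h, t' + \<tau>) - G (x' + h, t' + \<tau>) \<le> w (x', t') - G (x', t')"
        by (subst eventually_nhds_0_Pair_iff_shift)
      then show ?thesis
      proof (rule eventually_mono, clarify)
        fix h \<tau> assume 1: "w (x' + h, t' + \<tau>) - G (x' + h, t' + \<tau>) \<le> w (x', t') - G (x', t')"
        have "G (x' + h, t' + \<tau>) = G (x', t') + poly2 (a + 2 * (K + 1) * (t' - t)) (p + X' *v (x' - x)) X' (K + 1) h \<tau>"
          using poly2_shift[OF X', of a p "K + 1" h "x' - x" \<tau> "t' - t"]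
          by (simp add: G_def add_diff_eq add.commute)
        with 1 show "w (x' + h, t' + \<tau>) \<le> w (x', t') + poly2 (a + 2 * (K + 1) * (t' - t)) (p + X' *v (x' - x)) X' (K + 1) h \<tau>"
          by linarith
      qed
    qed
    from sub_at_poly2D[OF sub X' _ this] r(2)[OF w(2)] show False by (simp add: H_def q_def)
  qed
  have "((\<lambda>\<epsilon>. a + F p (X + mat (2 * \<epsilon>)) + k x t * norm p) \<longlongrightarrow> a + F p X + k x t * norm p) (at_right 0)"
    by (intro tendsto_intros F_add_mat_tendsto p X)
  then show ?thesis
    by (rule tendsto_upperbound) (auto simp: eventually_at_right_less eps intro: eventually_mono[OF eventually_at_right_less])
qed

text \<open>Nearby members may be touched at arbitrarily small gradients, where continuity of
  \<open>F\<close> gives no uniform control; \<open>sub_at_flat_bound\<close> does. One more copy of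
  the flat function and of \<open>\<tau>\<^sup>2\<close> makes the contact strict without leaving
  the flat test functions.\<close>

lemma sub_at_perron_flat:
  assumes t: "0 < t" "t < T" and gt: "um x t < perron (x, t)" and A: "0 < A" and c: "0 < c"
    and touch: "\<forall>\<^sub>F (h, \<tau>) in nhds 0. perron (x + h, t + \<tau>) \<le> perron (x, t) + a * \<tau> + K * \<tau>\<^sup>2 + A * \<theta> (c * (norm h)\<^sup>2)"
  shows "a \<le> 0"
proof -
  obtain K0 where K0: "0 \<le> K0" "\<And>y s. norm (y - x) \<le> 1 \<Longrightarrow> 0 \<le> s \<Longrightarrow> s \<le> T \<Longrightarrow> \<bar>k y s\<bar> \<le> K0"
    using k_bound[of x] by blast
  define C where "C = 2 * (\<bar>K\<bar> + 1) + 2 * (A + 1) * c * c * (1 + K0)"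
  have C: "0 \<le> C" using A c K0 by (simp add: C_def)
  define G where "G z = a * (snd z - t) + (K + 1) * (snd z - t)\<^sup>2 + (A + 1) * \<theta> (c * (norm (fst z - x))\<^sup>2)"
    for z :: "(real^'n) \<times> real"
  have G: "continuous_on UNIV G"
    unfolding G_def using c by (intro continuous_intros continuous_on_\<theta>_compose) auto
  have "\<forall>\<^sub>F (y, s) in nhds (x, t). perron (y, s) \<le> perron (x, t) + a * (s - t) + K * (s - t)\<^sup>2 + A * \<theta> (c * (norm (y - x))\<^sup>2)"
    using touch by (subst eventually_nhds_0_Pair_iff_shift[symmetric]) simp
  then obtain \<rho> where \<rho>: "\<rho> > 0" "\<And>y s. dist (y, s) (x, t) < \<rho> \<Longrightarrow>
      perron (y, s) \<le> perron (x, t) + a * (s - t) + K * (s - t)\<^sup>2 + A * \<theta> (c * (norm (y - x))\<^sup>2)"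
    by (auto simp: eventually_nhds_metric)
  show "a \<le> 0"
  proof (rule le_zero_if_le_all_mult[OF _ C])
    fix \<epsilon> :: real assume "0 < \<epsilon>"
    \<comment> \<open>The bound \<open>1 / c\<close> ensures
      \<open>c * norm (x' - x) \<le> 1\<close>. The drift of the time slope and the flat bound are
      then both of order \<open>r\<close>, with total coefficient at most \<open>C\<close>.\<close>
    define r where "r = min \<epsilon> (min 1 (1 / c))"
    have r: "0 < r" "r \<le> \<epsilon>" "r \<le> 1" "r \<le> 1 / c" using \<open>0 < \<epsilon>\<close> c by (auto simp: r_def)
    have "\<exists>w x' t'. subsol w \<and> dist (x', t') (x, t) < r \<and> 0 < t' \<and> t' < T \<and> um x' t' < w (x', t') \<and>
      (\<forall>\<^sub>F y in nhds (x', t'). w y - G y \<le> w (x', t') - G (x', t'))"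
    proof (rule perron_contact[OF t gt G \<rho>(1) _ r(1)])
      fix y assume y: "0 < dist y (x, t)" "dist y (x, t) < \<rho>"
      obtain x' t' where xt: "y = (x', t')" by (cases y)
      have "perron y \<le> perron (x, t) + a * (t' - t) + K * (t' - t)\<^sup>2 + A * \<theta> (c * (norm (x' - x))\<^sup>2)"
        using \<rho>(2)[of x' t'] y by (simp add: xt)
      moreover have "G y = a * (t' - t) + K * (t' - t)\<^sup>2 + A * \<theta> (c * (norm (x' - x))\<^sup>2) + ((t' - t)\<^sup>2 + \<theta> (c * (norm (x' - x))\<^sup>2))"
        by (simp add: G_def xt algebra_simps)
      moreover have "0 < (t' - t)\<^sup>2 + \<theta> (c * (norm (x' - x))\<^sup>2)"
      proof (cases "x' = x")
        case True
        then show ?thesis using y by (simp add: xt \<theta>_zero)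
      next
        case False
        then have "0 < \<theta> (c * (norm (x' - x))\<^sup>2)" using c by (intro \<theta>_pos) simp
        then show ?thesis by (rule add_nonneg_pos[rotated]) simp
      qed
      moreover have "G (x, t) = 0" by (simp add: G_def \<theta>_zero)
      ultimately show "perron y - G y < perron (x, t) - G (x, t)" by linarith
    qed
    then obtain w x' t' where w: "subsol w" "dist (x', t') (x, t) < r" "0 < t'" "t' < T" "um x' t' < w (x', t')"
      and loc: "\<forall>\<^sub>F y in nhds (x', t'). w y - G y \<le> w (x', t') - G (x', t')" by blast
    have sub: "sub_at w x' t'" by (rule subsolD(5)[OF w(1,3-5)])
    have d: "norm (x' - x) < r" "\<bar>t' - t\<bar> < r"
      using le_less_trans[OF dist_fst_le w(2)] le_less_trans[OF dist_snd_le w(2)] by (auto simp: dist_norm)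
    have "c * norm (x' - x) \<le> c * (1 / c)" using d r c by (intro mult_left_mono) auto
    then have cd: "c * norm (x' - x) \<le> 1" using c by simp
    have "a + 2 * (K + 1) * (t' - t) \<le> 2 * (A + 1) * c * (c * (norm (x' - x))\<^sup>2) * (1 + K0)"
    proof (rule sub_at_flat_bound[OF sub _ c _ cd])
      have "\<forall>\<^sub>F (y, s) in nhds (x', t'). w (y, s) - G (y, s) \<le> w (x', t') - G (x', t')"
        using loc by (simp add: case_prod_unfold)
      then have "\<forall>\<^sub>F (h, \<tau>) in nhds 0. w (x' + h, t' + \<tau>) - G (x' + h, t' + \<tau>) \<le> w (x', t') - G (x', t')"
        by (subst eventually_nhds_0_Pair_iff_shift)
      then show "\<forall>\<^sub>F (h, \<tau>) in nhds 0. w (x' + h, t' + \<tau>) \<le> w (x', t') + (a + 2 * (K + 1) * (t' - t)) * \<tau> + (K + 1) * \<tau>\<^sup>2 +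
        (A + 1) * (\<theta> (c * (norm (x' - x + h))\<^sup>2) - \<theta> (c * (norm (x' - x))\<^sup>2))"
      proof (rule eventually_mono, clarify)
        fix h \<tau> assume 1: "w (x' + h, t' + \<tau>) - G (x' + h, t' + \<tau>) \<le> w (x', t') - G (x', t')"
        have "x' + h - x = x' - x + h" by simp
        then have "G (x' + h, t' + \<tau>) = G (x', t') + (a + 2 * (K + 1) * (t' - t)) * \<tau> + (K + 1) * \<tau>\<^sup>2 +
          (A + 1) * (\<theta> (c * (norm (x' - x + h))\<^sup>2) - \<theta> (c * (norm (x' - x))\<^sup>2))"
          by (simp add: G_def power2_eq_square algebra_simps)
        with 1 show "w (x' + h, t' + \<tau>) \<le> w (x', t') + (a + 2 * (K + 1) * (t' - t)) * \<tau> + (K + 1) * \<tau>\<^sup>2 +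
          (A + 1) * (\<theta> (c * (norm (x' - x + h))\<^sup>2) - \<theta> (c * (norm (x' - x))\<^sup>2))"
          by linarith
      qed
    qed (use A d r K0(2)[of x' t'] w in auto)
    also have "\<dots> \<le> 2 * (A + 1) * c * (c * r) * (1 + K0)"
    proof -
      have "(norm (x' - x))\<^sup>2 \<le> r * 1" unfolding power2_eq_square using d r by (intro mult_mono) auto
      then show ?thesis using A c K0 by (intro mult_right_mono mult_left_mono) auto
    qed
    finally have "a \<le> - (2 * (K + 1) * (t' - t)) + r * (2 * (A + 1) * c * c * (1 + K0))" by (simp add: mult_ac)
    moreover have "- (2 * (K + 1) * (t' - t)) \<le> (2 * (\<bar>K\<bar> + 1)) * r"
    proof -
      have "- (2 * (K + 1) * (t' - t)) \<le> \<bar>2 * (K + 1)\<bar> * \<bar>t' - t\<bar>" by (metis abs_ge_minus_self abs_mult)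
      also have "\<dots> \<le> (2 * (\<bar>K\<bar> + 1)) * r" using d by (intro mult_mono) auto
      finally show ?thesis .
    qed
    ultimately have "a \<le> r * C" by (simp add: C_def algebra_simps)
    also have "\<dots> \<le> \<epsilon> * C" using r C by (intro mult_right_mono) auto
    finally show "a \<le> \<epsilon> * C" .
  qed
qed

lemma subsol_perron: "subsol perron"
proof -
  have bounds: "um x t \<le> perron (x, t) \<and> perron (x, t) \<le> up x t" if t: "0 \<le> t" "t < T" for x t
  proof
    show "um x t \<le> perron (x, t)" using subsol_le_perron[OF subsol_um, of "(x, t)"] t by simp
    have "continuous_on (UNIV \<times> {0..<T}) (\<lambda>z. up (fst z) (snd z))"
      by (rule continuous_on_subset[OF continuous_on_up]) auto
    from perron_le_continuous[OF this, of "(x, t)"] show "perron (x, t) \<le> up x t"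
      using t subsolD(3) by (auto simp: case_prod_unfold)
  qed
  \<comment> \<open>Limits from later times might raise the envelope above \<open>u0\<close>. An
    upper barrier common to all members, starting from \<open>u0 x0 + e\<close>, excludes
    this.\<close>
  have init: "perron (x0, 0) \<le> u0 x0" for x0
  proof (rule field_le_epsilon)
    fix e :: real assume "0 < e"
    then have "0 < e / 2" by simp
    from barrier_constants[OF this, of x0] obtain A C K0 where "barrier_consts (e / 2) x0 A C K0" by blast
    note A = barrier_constsD[OF this]
    have u0b: "\<bar>u0 x\<bar> \<le> bnd" for x using u0_between[of x] bnd(2,3)[of 0 x] by (simp add: abs_le_iff)
    have u0e: "u0 x \<le> u0 x0 + e / 2 + A * \<theta> ((norm (x - x0))\<^sup>2)" for x
    proof (cases "x = x0")
      case True
      then show ?thesis using \<open>0 < e\<close> by (simp add: \<theta>_zero)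
    next
      case False
      have "norm (x - x0) \<le> exp (L * T) * norm (x - x0)"
        using L_nonneg T_pos mult_right_mono[of 1 "exp (L * T)" "norm (x - x0)"] by simp
      then have "u0 x - u0 x0 \<le> \<omega> (exp (L * T) * norm (x - x0))"
        using u0_\<omega>[of x x0] \<omega>_mono[of "norm (x - x0)" "exp (L * T) * norm (x - x0)"] by simp
      moreover have "u0 x - u0 x0 \<le> 2 * bnd" using u0b[of x] u0b[of x0] by linarith
      ultimately show ?thesis using A(5)[OF False] by linarith
    qed
    define G where "G z = u0 x0 + e + A * \<theta> ((norm (fst z - x0))\<^sup>2) + C * (snd z - 0)" for z :: "(real^'n) \<times> real"
    have G: "continuous_on (UNIV \<times> {0..<T}) G"
      unfolding G_def by (intro continuous_intros continuous_on_\<theta>_compose) auto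
    have "perron (x0, 0) \<le> G (x0, 0)"
    proof (rule perron_le_continuous[OF G])
      fix w and y :: "(real^'n) \<times> real" assume w: "subsol w" and y: "y \<in> UNIV \<times> {0..<T}"
      have "w (fst y, snd y) \<le> (u0 x0 + e) + A * \<theta> ((norm (fst y - x0))\<^sup>2) + C * (snd y - 0)"
      proof (rule upper_barrier[OF w order_refl A(1,2,4,3)])
        show "w (x, 0) \<le> u0 x0 + e + A * \<theta> ((norm (x - x0))\<^sup>2)" for x
          using subsolD(4)[OF w, of x] u0e[of x] \<open>0 < e\<close> by linarith
        show "um x t \<le> u0 x0 + e + A * \<theta> ((norm (x - x0))\<^sup>2) + C * (t - 0)" if "0 \<le> t" "t < T" for x t
          using A(7)[of 0 t x] that u0_between[of x] u0e[of x] by (simp add: abs_le_iff)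
        show "w (x, t) \<le> u0 x0 + e + A * \<theta> ((norm (x - x0))\<^sup>2)" if "0 \<le> t" "t < T" "1 \<le> norm (x - x0)" for x t
          using subsol_bnd[OF w that(1,2), of x] A(6)[OF that(3)] u0b[of x0] \<open>0 < e\<close> by linarith
      qed (use y in auto)
      then show "w y \<le> G y" by (simp add: G_def)
    qed (use T_pos in auto)
    then show "perron (x0, 0) \<le> u0 x0 + e" by (simp add: G_def \<theta>_zero)
  qed
  have "sub_at perron x t" if "0 < t" "t < T" "um x t < perron (x, t)" for x t
    unfolding sub_at_def using sub_at_perron_nonzero[OF that] sub_at_perron_flat[OF that] by blast
  then show ?thesis
    unfolding subsol_def using usc_on_perron bounds init by blast
qed

end

subsection \<open>Sup-convolution over shrinking balls\<close>

lemma linear_quadratic_nonneg_right: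
  fixes \<alpha> \<beta> :: real
  assumes "\<forall>\<^sub>F s in at_right 0. 0 \<le> \<alpha> * s + \<beta> * s\<^sup>2"
  shows "0 \<le> \<alpha>"
proof -
  have lim: "((\<lambda>s. \<alpha> + \<beta> * s) \<longlongrightarrow> \<alpha> + \<beta> * 0) (at_right 0)" by (intro tendsto_intros)
  have ev: "\<forall>\<^sub>F s in at_right (0::real). 0 \<le> \<alpha> + \<beta> * s"
    using assms eventually_at_right_less[of 0]
  proof eventually_elim
    case (elim s)
    then have "0 \<le> s * (\<alpha> + \<beta> * s)" by (simp add: algebra_simps power2_eq_square)
    with elim show ?case by (simp add: zero_le_mult_iff)
  qed
  from tendsto_lowerbound[OF lim ev] show ?thesis by simp
qed

context obstacle_problem
begin

definition supconv :: "((real^'n) \<times> real \<Rightarrow> real) \<Rightarrow> real \<Rightarrow> (real^'n) \<times> real \<Rightarrow> real" where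
  "supconv w r z = max (um (fst z) (snd z))
    ((SUP v\<in>cball 0 (exp (- L * snd z) * r). w (fst z + v, snd z)) - \<omega> r)"

lemma supconv_attained:
  assumes w: "subsol w" and r: "0 \<le> r" and t: "0 \<le> t" "t < T"
  shows "\<exists>d. norm d \<le> exp (- L * t) * r \<and>
    (\<forall>v. norm v \<le> exp (- L * t) * r \<longrightarrow> w (x + v, t) \<le> w (x + d, t)) \<and>
    supconv w r (x, t) = max (um x t) (w (x + d, t) - \<omega> r)"
proof -
  let ?B = "cball 0 (exp (- L * t) * r) :: (real^'n) set"
  let ?K = "(\<lambda>v. (x + v, t)) ` ?B"
  have K: "compact ?K" by (intro compact_continuous_image continuous_intros) auto
  have "0 \<le> exp (- L * t) * r" using r by simp
  then have "?K \<subseteq> UNIV \<times> {0..<T}" "?K \<noteq> {}" using t by auto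
  from usc_on_attains_sup[OF subsolD(1)[OF w] K this]
  obtain d where d: "d \<in> ?B" "\<And>v. v \<in> ?B \<Longrightarrow> w (x + v, t) \<le> w (x + d, t)" by blast
  have "(SUP v\<in>?B. w (x + v, t)) = w (x + d, t)"
  proof (rule cSup_eq_maximum)
    show "w (x + d, t) \<in> (\<lambda>v. w (x + v, t)) ` ?B" using d(1) by (rule imageI)
    show "u \<le> w (x + d, t)" if "u \<in> (\<lambda>v. w (x + v, t)) ` ?B" for u using that d(2) by (elim imageE) simp
  qed
  then have "supconv w r (x, t) = max (um x t) (w (x + d, t) - \<omega> r)" by (simp add: supconv_def)
  moreover have "norm d \<le> exp (- L * t) * r" using d(1) by simp
  moreover have "\<forall>v. norm v \<le> exp (- L * t) * r \<longrightarrow> w (x + v, t) \<le> w (x + d, t)" using d(2) by simp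
  ultimately show ?thesis by (intro exI[of _ d] conjI)
qed

lemma le_supconv:
  assumes w: "subsol w" and t: "0 \<le> t" "t < T" and v: "norm v \<le> exp (- L * t) * r"
  shows "w (x + v, t) \<le> supconv w r (x, t) + \<omega> r"
proof -
  have "0 \<le> exp (- L * t) * r" using order_trans[OF norm_ge_zero v] .
  then have r: "0 \<le> r" by (simp add: zero_le_mult_iff)
  obtain d where "norm d \<le> exp (- L * t) * r \<and>
    (\<forall>v. norm v \<le> exp (- L * t) * r \<longrightarrow> w (x + v, t) \<le> w (x + d, t)) \<and>
    supconv w r (x, t) = max (um x t) (w (x + d, t) - \<omega> r)"
    using supconv_attained[OF w r t, of x] ..
  with v have "w (x + v, t) \<le> w (x + d, t)" "supconv w r (x, t) = max (um x t) (w (x + d, t) - \<omega> r)" by simp_all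
  then show ?thesis by simp
qed

text \<open>Maximizing displacements at nearby points stay in \<open>cball 0 r\<close>, so a
  subsequence converges. The radius depends continuously on time, hence the limit is an admissible
  displacement, and upper semicontinuity of \<open>w\<close> applies there.\<close>

lemma usc_on_supconv:
  assumes w: "subsol w" and r: "0 \<le> r"
  shows "usc_on (UNIV \<times> {0..<T}) (supconv w r)"
proof (rule usc_onI, rule ccontr)
  fix z c assume z: "z \<in> UNIV \<times> {0..<T}" "supconv w r z < c"
  assume neg: "\<not> (\<exists>d>0. \<forall>y\<in>UNIV \<times> {0..<T}. dist y z < d \<longrightarrow> supconv w r y < c)"
  obtain x t where xt: "z = (x, t)" by (cases z)
  have t: "0 \<le> t" "t < T" using z by (auto simp: xt)
  have "\<exists>y\<in>UNIV \<times> {0..<T}. dist y z < d \<and> c \<le> supconv w r y" if "0 < d" for d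
  proof (rule ccontr)
    assume none: "\<not> ?thesis"
    have "\<forall>y\<in>UNIV \<times> {0..<T}. dist y z < d \<longrightarrow> supconv w r y < c"
    proof (intro ballI impI, rule ccontr)
      fix y assume "y \<in> UNIV \<times> {0..<T}" "dist y z < d" "\<not> supconv w r y < c"
      then have "\<exists>y\<in>UNIV \<times> {0..<T}. dist y z < d \<and> c \<le> supconv w r y" by (intro bexI[of _ y]) simp_all
      with none show False by (rule notE)
    qed
    with that have "\<exists>d>0. \<forall>y\<in>UNIV \<times> {0..<T}. dist y z < d \<longrightarrow> supconv w r y < c" by (intro exI[of _ d] conjI)
    with neg show False by (rule notE)
  qed
  then have "\<forall>n. \<exists>y\<in>UNIV \<times> {0..<T}. dist y z < inverse (real (Suc n)) \<and> c \<le> supconv w r y" by simp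
  then obtain y where y: "\<And>n. y n \<in> UNIV \<times> {0..<T}" "\<And>n. dist (y n) z < inverse (real (Suc n))"
    "\<And>n. c \<le> supconv w r (y n)" by metis
  have "(\<lambda>n. dist (y n) z) \<longlonglongrightarrow> 0"
    by (rule tendsto_sandwich[OF _ _ tendsto_const LIMSEQ_inverse_real_of_nat])
      (intro always_eventually allI zero_le_dist less_imp_le[OF y(2)])+
  then have ylim: "y \<longlonglongrightarrow> z" by (rule tendsto_dist_iff[THEN iffD2])
  have "continuous_on (UNIV \<times> {0..<T}) (\<lambda>z. um (fst z) (snd z))"
    by (rule continuous_on_subset[OF continuous_on_um]) auto
  from continuous_on_tendsto_compose[OF this ylim z(1)] y(1)
  have "(\<lambda>n. um (fst (y n)) (snd (y n))) \<longlonglongrightarrow> um x t" by (simp add: xt)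
  moreover have "um x t < c" using z(2) by (simp add: xt supconv_def)
  ultimately have um: "\<forall>\<^sub>F n in sequentially. um (fst (y n)) (snd (y n)) < c" by (rule order_tendstoD(2))
  have "\<forall>n. \<exists>d. norm d \<le> exp (- L * snd (y n)) * r \<and>
    supconv w r (y n) = max (um (fst (y n)) (snd (y n))) (w (fst (y n) + d, snd (y n)) - \<omega> r)"
  proof
    fix n
    have "0 \<le> snd (y n)" "snd (y n) < T" using y(1)[of n] by (auto simp: mem_Times_iff)
    from supconv_attained[OF w r this, of "fst (y n)"]
    show "\<exists>d. norm d \<le> exp (- L * snd (y n)) * r \<and>
      supconv w r (y n) = max (um (fst (y n)) (snd (y n))) (w (fst (y n) + d, snd (y n)) - \<omega> r)"
      unfolding prod.collapse by blast
  qed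
  then obtain d where d: "\<And>n. norm (d n) \<le> exp (- L * snd (y n)) * r"
    "\<And>n. supconv w r (y n) = max (um (fst (y n)) (snd (y n))) (w (fst (y n) + d n, snd (y n)) - \<omega> r)" by metis
  have "d n \<in> cball 0 r" for n
  proof -
    have "exp (- L * snd (y n)) * r \<le> 1 * r" using y(1)[of n] r L_nonneg by (intro mult_right_mono) (auto simp: mem_Times_iff)
    then show ?thesis using d(1)[of n] by simp
  qed
  then obtain l f where lf: "strict_mono f" "(d \<circ> f) \<longlonglongrightarrow> l"
    using compact_cball[of 0 r] unfolding compact_def by blast
  have yf: "(\<lambda>n. y (f n)) \<longlonglongrightarrow> z" using LIMSEQ_subseq_LIMSEQ[OF ylim lf(1)] by (simp add: o_def)
  have df: "(\<lambda>n. d (f n)) \<longlonglongrightarrow> l" using lf(2) by (simp add: o_def)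
  have yx: "(\<lambda>n. fst (y (f n))) \<longlonglongrightarrow> x" and yt: "(\<lambda>n. snd (y (f n))) \<longlonglongrightarrow> t"
    using tendsto_fst[OF yf] tendsto_snd[OF yf] by (auto simp: xt)
  have "(\<lambda>n. exp (- L * snd (y (f n))) * r) \<longlonglongrightarrow> exp (- L * t) * r" by (intro tendsto_intros yt)
  from LIMSEQ_le[OF tendsto_norm[OF df] this] have "norm l \<le> exp (- L * t) * r" using d(1) by blast
  from le_supconv[OF w t this, of x] have "w (x + l, t) < c + \<omega> r" using z(2) by (simp add: xt)
  then obtain e where e: "e > 0" "\<And>p. p \<in> UNIV \<times> {0..<T} \<Longrightarrow> dist p (x + l, t) < e \<Longrightarrow> w p < c + \<omega> r"
    using usc_onD[OF subsolD(1)[OF w], of "(x + l, t)" "c + \<omega> r"] t by auto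
  have "(\<lambda>n. (fst (y (f n)) + d (f n), snd (y (f n)))) \<longlonglongrightarrow> (x + l, t)"
    by (intro tendsto_intros yx yt df)
  from tendstoD[OF this e(1)]
  have "\<forall>\<^sub>F n in sequentially. dist (fst (y (f n)) + d (f n), snd (y (f n))) (x + l, t) < e" .
  moreover have "\<forall>\<^sub>F n in sequentially. um (fst (y (f n))) (snd (y (f n))) < c"
    using eventually_subseq[OF lf(1) um] .
  ultimately have "\<forall>\<^sub>F n in sequentially. False"
  proof eventually_elim
    case (elim n)
    have "w (fst (y (f n)) + d (f n), snd (y (f n))) < c + \<omega> r"
      using y(1)[of "f n"] by (intro e(2) elim(1)) (auto simp: mem_Times_iff)
    then show False using d(2)[of "f n"] y(3)[of "f n"] elim(2) by (simp add: max_def split: if_splits)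
  qed
  then show False by simp
qed

text \<open>If \<open>y = x + d\<close> realizes the supremum, a test function for the
  sup-convolution at \<open>x\<close> becomes one for \<open>w\<close> at \<open>y\<close>, read
  along a displacement that shrinks in time; this adds \<open>L * (p \<bullet> d)\<close> to the
  time slope. Maximality over the ball makes \<open>p \<bullet> d\<close> at least
  \<open>norm d * norm p\<close>, which covers the possible loss \<open>L * norm d * norm p\<close>
  in replacing \<open>k y t\<close> by \<open>k x t\<close>.\<close>

lemma sub_at_supconv:
  assumes w: "subsol w" and r: "0 \<le> r" and t: "0 < t" "t < T" and gt: "um x t < supconv w r (x, t)"
  shows "sub_at (supconv w r) x t"
proof -
  obtain d where d: "norm d \<le> exp (- L * t) * r" "supconv w r (x, t) = max (um x t) (w (x + d, t) - \<omega> r)"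
    using supconv_attained[OF w r less_imp_le[OF t(1)] t(2), of x] by (elim exE conjE) (rule that)
  define y where "y = x + d"
  have V: "supconv w r (x, t) = w (y, t) - \<omega> r" using d(2) gt by (auto simp: y_def max_def split: if_splits)
  have E1: "exp (- L * t) \<le> 1" using L_nonneg t by simp
  have dr: "norm d \<le> r" using d(1) mult_right_mono[OF E1 r] by simp
  have "um y t < w (y, t)"
  proof -
    have "um y t - um x t \<le> \<omega> (norm d)" using um_\<omega>[of t y x] t by (simp add: y_def)
    moreover have "\<omega> (norm d) \<le> \<omega> r" using dr by (intro \<omega>_mono) auto
    ultimately show ?thesis using gt V by linarith
  qed
  then have sub: "sub_at w y t" using subsolD(5)[OF w t] by simp
  \<comment> \<open>Times stay between 0 and \<open>T\<close>, and the bound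
    \<open>1 / (L + 1)\<close> keeps the factor \<open>1 - L * \<tau>\<close> nonnegative.\<close>
  define \<delta> where "\<delta> = min (t / 2) (min ((T - t) / 2) (1 / (L + 1)))"
  have \<delta>: "0 < \<delta>" "\<delta> < t" "\<delta> < T - t" "\<delta> \<le> 1 / (L + 1)" using t L_nonneg by (auto simp: \<delta>_def min_def)
  have L\<tau>: "0 \<le> 1 - L * \<tau>" if "\<bar>\<tau>\<bar> < \<delta>" for \<tau>
  proof -
    have "L * \<tau> \<le> L * \<bar>\<tau>\<bar>" by (intro mult_left_mono L_nonneg) simp
    also have "\<dots> \<le> (L + 1) * \<bar>\<tau>\<bar>" by (intro mult_right_mono) auto
    also have "\<dots> \<le> (L + 1) * (1 / (L + 1))" using that \<delta>(4) L_nonneg by (intro mult_left_mono) auto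
    also have "\<dots> = 1" using L_nonneg by simp
    finally show ?thesis by simp
  qed
  \<comment> \<open>Since \<open>1 - L\<tau> \<le> exp (- L\<tau>)\<close>, the vector \<open>(1 - L\<tau>) d\<close> stays in the shrinking ball, so the
    contact point may be followed along a motion that is linear in time.\<close>
  have shift: "w (y + \<eta>, t + \<tau>) \<le> supconv w r (x + (\<eta> + (L * \<tau>) *\<^sub>R d), t + \<tau>) + \<omega> r" if "\<bar>\<tau>\<bar> < \<delta>" for \<eta> \<tau>
  proof -
    have "norm ((1 - L * \<tau>) *\<^sub>R d) = (1 - L * \<tau>) * norm d" using L\<tau>[OF that] by simp
    also have "\<dots> \<le> exp (- L * \<tau>) * (exp (- L * t) * r)"
      using L\<tau>[OF that] exp_ge_add_one_self[of "- L * \<tau>"] d(1) by (intro mult_mono) auto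
    also have "\<dots> = exp (- L * (t + \<tau>)) * r"
    proof -
      have "exp (- L * (t + \<tau>)) = exp (- L * \<tau>) * exp (- L * t)" by (simp add: mult_exp_exp algebra_simps)
      then show ?thesis by (simp only: mult.assoc)
    qed
    finally have n: "norm ((1 - L * \<tau>) *\<^sub>R d) \<le> exp (- L * (t + \<tau>)) * r" .
    have "0 \<le> t + \<tau>" "t + \<tau> < T" using that \<delta> by auto
    from le_supconv[OF w this n, of "x + (\<eta> + (L * \<tau>) *\<^sub>R d)"]
    show ?thesis by (simp add: y_def algebra_simps)
  qed
  have lim: "((\<lambda>z. (fst z + (L * snd z) *\<^sub>R d, snd z)) \<longlongrightarrow> 0) (nhds (0 :: (real^'n) \<times> real))"
  proof -
    have "((\<lambda>z. (fst z + (L * snd z) *\<^sub>R d, snd z)) \<longlongrightarrow>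
      (fst (0 :: (real^'n) \<times> real) + (L * snd (0 :: (real^'n) \<times> real)) *\<^sub>R d, snd (0 :: (real^'n) \<times> real))) (nhds 0)"
      by (intro tendsto_intros tendsto_fst tendsto_snd filterlim_ident)
    then show ?thesis by (simp add: zero_prod_def)
  qed
  \<comment> \<open>The substitution \<open>h = \<eta> + (L * \<tau>) *\<^sub>R d\<close>
    compensates the shrinking of the displacement: the base point moves, while the argument of
    \<open>w\<close> is exactly \<open>y + \<eta>\<close>.\<close>
  have touch_w: "\<forall>\<^sub>F (\<eta>, \<tau>) in nhds 0. w (y + \<eta>, t + \<tau>) \<le> w (y, t) + f (\<eta> + (L * \<tau>) *\<^sub>R d) \<tau>"
    if touch: "\<forall>\<^sub>F (h, \<tau>) in nhds 0. supconv w r (x + h, t + \<tau>) \<le> supconv w r (x, t) + f h \<tau>" for f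
  proof -
    have "\<forall>\<^sub>F z in nhds 0. case (fst z + (L * snd z) *\<^sub>R d, snd z) of (h, \<tau>) \<Rightarrow>
        supconv w r (x + h, t + \<tau>) \<le> supconv w r (x, t) + f h \<tau>"
      using filterlim_iff[THEN iffD1, OF lim, rule_format, OF touch] .
    with eventually_nhds_0_norm_less[OF \<delta>(1), where 'a = "real^'n"] show ?thesis
    proof eventually_elim
      case (elim z)
      then show ?case using shift[of "snd z" "fst z"] V by (auto simp: case_prod_unfold)
    qed
  qed
  show ?thesis
    unfolding sub_at_def
  proof (intro conjI allI impI; elim conjE)
    fix a p X K assume X: "X \<in> sym_matrices" and p: "p \<noteq> 0"
      and touch: "\<forall>\<^sub>F (h, \<tau>) in nhds 0. supconv w r (x + h, t + \<tau>) \<le> supconv w r (x, t) + poly2 a p X K h \<tau>"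
    have pd: "norm d * norm p \<le> p \<bullet> d"
    proof -
      \<comment> \<open>\<open>v0\<close> maximizes \<open>p \<bullet> v\<close> over the ball.
        Moving the displacement from \<open>d\<close> towards \<open>v0\<close> and the base point
        by the opposite amount keeps the argument of \<open>w\<close> at \<open>y\<close>, so the
        first order term along \<open>d - v0\<close> cannot be negative.\<close>
      define v0 where "v0 = (exp (- L * t) * r / norm p) *\<^sub>R p"
      have v0: "norm v0 \<le> exp (- L * t) * r" "p \<bullet> v0 = exp (- L * t) * r * norm p"
        using p r by (auto simp: v0_def power2_norm_eq_inner[symmetric] power2_eq_square)
      have ev: "\<forall>\<^sub>F s in nhds 0. supconv w r (x + s *\<^sub>R (d - v0), t) \<le> supconv w r (x, t) + poly2 a p X K (s *\<^sub>R (d - v0)) 0"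
        using eventually_nhds_line[OF touch, of "(d - v0, 0)"] by simp
      have "\<forall>\<^sub>F s in at_right 0. 0 \<le> (p \<bullet> (d - v0)) * s + ((d - v0) \<bullet> (X *v (d - v0)) / 2) * s\<^sup>2"
        using filter_leD[OF at_within_le_nhds ev] eventually_at_right_less[of 0]
          eventually_at_right_real[OF zero_less_one]
      proof eventually_elim
        case (elim s)
        have "norm ((1 - s) *\<^sub>R d + s *\<^sub>R v0) \<le> (1 - s) * norm d + s * norm v0"
          using norm_triangle_ineq[of "(1 - s) *\<^sub>R d" "s *\<^sub>R v0"] elim by simp
        also have "\<dots> \<le> (1 - s) * (exp (- L * t) * r) + s * (exp (- L * t) * r)"
          using elim d(1) v0(1) by (intro add_mono mult_left_mono) auto
        finally have "norm ((1 - s) *\<^sub>R d + s *\<^sub>R v0) \<le> exp (- L * t) * r" by (simp add: algebra_simps)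
        from le_supconv[OF w less_imp_le[OF t(1)] t(2) this, of "x + s *\<^sub>R (d - v0)"]
        have "w (y, t) \<le> supconv w r (x + s *\<^sub>R (d - v0), t) + \<omega> r" by (simp add: y_def algebra_simps)
        with elim(1) V have "0 \<le> poly2 a p X K (s *\<^sub>R (d - v0)) 0" by linarith
        also have "\<dots> = (p \<bullet> (d - v0)) * s + ((d - v0) \<bullet> (X *v (d - v0)) / 2) * s\<^sup>2"
          unfolding poly2_def matrix_vector_mult_scaleR by (simp add: power2_eq_square)
        finally show ?case .
      qed
      from linear_quadratic_nonneg_right[OF this] have "p \<bullet> v0 \<le> p \<bullet> d" by (simp add: inner_diff_right)
      moreover have "norm d * norm p \<le> exp (- L * t) * r * norm p" using d(1) by (intro mult_right_mono) auto
      ultimately show ?thesis using v0(2) by simp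
    qed
    obtain c where c: "0 < c" "\<And>v u. \<bar>v \<bullet> (X *v u)\<bar> \<le> c * norm v * norm u" using quadratic_form_bound[of X] by blast
    have "a + L * (p \<bullet> d) + F p (X + mat (2 * \<epsilon>)) + k y t * norm p \<le> 0" if "0 < \<epsilon>" for \<epsilon>
    proof -
      \<comment> \<open>The substitution creates a term mixed in \<open>\<tau>\<close> and
        \<open>\<eta>\<close>. Young's inequality moves it into
        \<open>\<epsilon> * (norm \<eta>)\<^sup>2\<close>, hence the matrix
        \<open>mat (2 * \<epsilon>)\<close>, and into the coefficient of
        \<open>\<tau>\<^sup>2\<close>.\<close>
      define M where "M = (c * L * norm d)\<^sup>2 / \<epsilon> + c * (L * norm d)\<^sup>2 + K"
      have "\<forall>\<^sub>F (\<eta>, \<tau>) in nhds 0. w (y + \<eta>, t + \<tau>) \<le> w (y, t) + poly2 (a + L * (p \<bullet> d)) p (X + mat (2 * \<epsilon>)) M \<eta> \<tau>"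
        using touch_w[OF touch]
      proof (rule eventually_mono, clarify)
        fix \<eta> :: "real^'n" and \<tau> :: real
        assume 1: "w (y + \<eta>, t + \<tau>) \<le> w (y, t) + poly2 a p X K (\<eta> + (L * \<tau>) *\<^sub>R d) \<tau>"
        have e: "poly2 a p X K (\<eta> + (L * \<tau>) *\<^sub>R d) \<tau> = (a + L * (p \<bullet> d)) * \<tau> + p \<bullet> \<eta> + (\<eta> \<bullet> (X *v \<eta>)) / 2
           + L * \<tau> * (\<eta> \<bullet> (X *v d)) + (L * \<tau>)\<^sup>2 * (d \<bullet> (X *v d)) / 2 + K * \<tau>\<^sup>2"
          unfolding poly2_def matrix_vector_right_distrib matrix_vector_mult_scaleR
          using sym_matrices_inner[OF X, of d \<eta>]
          by (simp add: inner_add_left inner_add_right power2_eq_square algebra_simps)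
        have "L * \<tau> * (\<eta> \<bullet> (X *v d)) \<le> \<bar>L * \<tau>\<bar> * \<bar>\<eta> \<bullet> (X *v d)\<bar>" by (metis abs_ge_self abs_mult)
        also have "\<dots> \<le> \<bar>L * \<tau>\<bar> * (c * norm \<eta> * norm d)" using c(2) by (intro mult_left_mono) auto
        also have "\<dots> = (c * L * norm d * \<bar>\<tau>\<bar>) * norm \<eta>" using L_nonneg by (simp add: abs_mult)
        also have "\<dots> \<le> \<epsilon> * (norm \<eta>)\<^sup>2 + (c * L * norm d)\<^sup>2 / \<epsilon> * \<tau>\<^sup>2"
        proof -
          define q where "q = c * L * norm d * \<bar>\<tau>\<bar>"
          have "0 \<le> (q - 2 * (\<epsilon> * norm \<eta>))\<^sup>2 + 3 * q\<^sup>2" by simp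
          then have "\<epsilon> * (q * norm \<eta>) \<le> \<epsilon> * (\<epsilon> * (norm \<eta>)\<^sup>2) + q\<^sup>2" by (simp add: power2_eq_square algebra_simps)
          then have "q * norm \<eta> \<le> \<epsilon> * (norm \<eta>)\<^sup>2 + q\<^sup>2 / \<epsilon>" using that by (simp add: field_simps)
          then show ?thesis by (simp add: q_def power_mult_distrib)
        qed
        finally have b1: "L * \<tau> * (\<eta> \<bullet> (X *v d)) \<le> \<epsilon> * (norm \<eta>)\<^sup>2 + (c * L * norm d)\<^sup>2 / \<epsilon> * \<tau>\<^sup>2" .
        have "d \<bullet> (X *v d) \<le> c * norm d * norm d" using c(2)[of d d] by (simp add: abs_le_iff)
        then have "(L * \<tau>)\<^sup>2 * (d \<bullet> (X *v d)) \<le> (L * \<tau>)\<^sup>2 * (c * norm d * norm d)" by (intro mult_left_mono) auto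
        moreover have "0 \<le> (L * \<tau>)\<^sup>2 * (c * norm d * norm d)" using c(1) by simp
        moreover have "(L * \<tau>)\<^sup>2 * (c * norm d * norm d) = c * (L * norm d)\<^sup>2 * \<tau>\<^sup>2" by (simp add: power2_eq_square)
        ultimately have b2: "(L * \<tau>)\<^sup>2 * (d \<bullet> (X *v d)) / 2 \<le> c * (L * norm d)\<^sup>2 * \<tau>\<^sup>2" by linarith
        have e2: "poly2 (a + L * (p \<bullet> d)) p (X + mat (2 * \<epsilon>)) M \<eta> \<tau> =
          (a + L * (p \<bullet> d)) * \<tau> + p \<bullet> \<eta> + (\<eta> \<bullet> (X *v \<eta>)) / 2 + \<epsilon> * (norm \<eta>)\<^sup>2
            + (c * L * norm d)\<^sup>2 / \<epsilon> * \<tau>\<^sup>2 + c * (L * norm d)\<^sup>2 * \<tau>\<^sup>2 + K * \<tau>\<^sup>2"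
          unfolding poly2_add_mat by (simp add: poly2_def M_def distrib_right)
        show "w (y + \<eta>, t + \<tau>) \<le> w (y, t) + poly2 (a + L * (p \<bullet> d)) p (X + mat (2 * \<epsilon>)) M \<eta> \<tau>"
          using 1 b1 b2 unfolding e e2 by linarith
      qed
      from sub_at_poly2D[OF sub _ p this] show ?thesis by (auto intro: sym_matrices_intros X)
    qed
    note eps = this
    have "((\<lambda>\<epsilon>. a + L * (p \<bullet> d) + F p (X + mat (2 * \<epsilon>)) + k y t * norm p) \<longlongrightarrow> a + L * (p \<bullet> d) + F p X + k y t * norm p) (at_right 0)"
      by (intro tendsto_intros F_add_mat_tendsto p X)
    then have "a + L * (p \<bullet> d) + F p X + k y t * norm p \<le> 0"
      by (rule tendsto_upperbound) (auto simp: eps intro: eventually_mono[OF eventually_at_right_less])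
    moreover have "k x t * norm p \<le> (k y t + L * norm d) * norm p"
      using k_space[of t x y] t by (intro mult_right_mono) (auto simp: y_def)
    moreover have "L * (norm d * norm p) \<le> L * (p \<bullet> d)" using pd L_nonneg by (intro mult_left_mono)
    ultimately show "a + F p X + k x t * norm p \<le> 0" by (simp add: algebra_simps)
  next
    fix a K A c :: real assume A: "0 < A" and c: "0 < c"
      and touch: "\<forall>\<^sub>F (h, \<tau>) in nhds 0. supconv w r (x + h, t + \<tau>) \<le> supconv w r (x, t) + a * \<tau> + K * \<tau>\<^sup>2 + A * \<theta> (c * (norm h)\<^sup>2)"
    \<comment> \<open>The moved profile is dominated by a centred one with \<open>4 * c\<close> for
      \<open>c\<close> plus a term in time: its argument is at most the average, hence the maximum,
      of \<open>?u\<close> and \<open>?v\<close>, and \<open>\<theta>\<close> is monotone. The time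
      term is of higher order and leaves \<open>a\<close> unchanged.\<close>
    define M where "M = 4 * c * (L * norm d)\<^sup>2"
    have M: "0 \<le> M" using c by (simp add: M_def)
    have "\<forall>\<^sub>F (\<eta>, \<tau>) in nhds 0. w (y + \<eta>, t + \<tau>) \<le> w (y, t) + (a * \<tau> + K * \<tau>\<^sup>2 + A * \<theta> (c * (norm (\<eta> + (L * \<tau>) *\<^sub>R d))\<^sup>2))"
      by (rule touch_w) (use touch in \<open>simp add: add.assoc\<close>)
    then have "\<forall>\<^sub>F (\<eta>, \<tau>) in nhds 0. w (y + \<eta>, t + \<tau>) \<le> w (y, t) + a * \<tau> + (K + A * M\<^sup>2) * \<tau>\<^sup>2 + A * \<theta> (4 * c * (norm \<eta>)\<^sup>2)"
      using eventually_nhds_0_norm_less[OF zero_less_one, where 'a = "real^'n"]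
    proof (eventually_elim, clarify)
      fix \<eta> :: "real^'n" and \<tau> :: real
      assume 1: "w (y + \<eta>, t + \<tau>) \<le> w (y, t) + (a * \<tau> + K * \<tau>\<^sup>2 + A * \<theta> (c * (norm (\<eta> + (L * \<tau>) *\<^sub>R d))\<^sup>2))"
        and \<tau>: "\<bar>\<tau>\<bar> < 1"
      let ?u = "4 * c * (norm \<eta>)\<^sup>2" and ?v = "M * \<tau>\<^sup>2"
      have uv: "0 \<le> ?u" "0 \<le> ?v" using c M by auto
      have "norm (\<eta> + (L * \<tau>) *\<^sub>R d) \<le> norm \<eta> + L * \<bar>\<tau>\<bar> * norm d"
        using norm_triangle_ineq[of \<eta> "(L * \<tau>) *\<^sub>R d"] L_nonneg by (simp add: abs_mult)
      then have "(norm (\<eta> + (L * \<tau>) *\<^sub>R d))\<^sup>2 \<le> (norm \<eta> + L * \<bar>\<tau>\<bar> * norm d)\<^sup>2" by (intro power_mono) auto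
      also have "\<dots> \<le> 2 * (norm \<eta>)\<^sup>2 + 2 * (L * \<bar>\<tau>\<bar> * norm d)\<^sup>2"
        using zero_le_power2[of "norm \<eta> - L * \<bar>\<tau>\<bar> * norm d"] by (simp add: power2_sum power2_diff)
      finally have "c * (norm (\<eta> + (L * \<tau>) *\<^sub>R d))\<^sup>2 \<le> c * (2 * (norm \<eta>)\<^sup>2 + 2 * (L * \<bar>\<tau>\<bar> * norm d)\<^sup>2)"
        using c by (intro mult_left_mono) auto
      also have "\<dots> = (?u + ?v) / 2" by (simp add: M_def power_mult_distrib algebra_simps)
      also have "\<dots> \<le> max ?u ?v" by simp
      finally have "\<theta> (c * (norm (\<eta> + (L * \<tau>) *\<^sub>R d))\<^sup>2) \<le> \<theta> (max ?u ?v)" using c by (intro \<theta>_mono) auto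
      also have "\<dots> \<le> \<theta> ?u + \<theta> ?v" using \<theta>_nonneg[OF uv(1)] \<theta>_nonneg[OF uv(2)] by (simp add: max_def)
      also have "\<theta> ?v \<le> ?v\<^sup>2" using uv by (intro \<theta>_le_square)
      also have "?v\<^sup>2 \<le> M\<^sup>2 * \<tau>\<^sup>2"
      proof -
        have "\<tau>\<^sup>2 * \<tau>\<^sup>2 \<le> 1 * \<tau>\<^sup>2" using \<tau> by (intro mult_right_mono) (auto simp: abs_square_le_1)
        then have "M\<^sup>2 * (\<tau>\<^sup>2 * \<tau>\<^sup>2) \<le> M\<^sup>2 * \<tau>\<^sup>2" by (intro mult_left_mono) auto
        then show ?thesis by (simp add: power2_eq_square mult_ac)
      qed
      finally have "A * \<theta> (c * (norm (\<eta> + (L * \<tau>) *\<^sub>R d))\<^sup>2) \<le> A * (\<theta> ?u + M\<^sup>2 * \<tau>\<^sup>2)" using A by (intro mult_left_mono) auto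
      with 1 show "w (y + \<eta>, t + \<tau>) \<le> w (y, t) + a * \<tau> + (K + A * M\<^sup>2) * \<tau>\<^sup>2 + A * \<theta> (4 * c * (norm \<eta>)\<^sup>2)"
        by (simp add: algebra_simps)
    qed
    from sub_at_flatD[OF sub A _ this] c show "a \<le> 0" by simp
  qed
qed

text \<open>Displacements have norm at most \<open>r\<close>, so \<open>\<omega> r\<close> bounds
  the oscillation of \<open>up\<close> and of \<open>u0\<close> over the ball, and subtracting it
  keeps the upper constraints. The maximum with \<open>um\<close> restores the lower one; where
  \<open>um\<close> realizes it, no differential inequality is asked.\<close>

lemma subsol_supconv:
  assumes w: "subsol w" and r: "0 \<le> r"
  shows "subsol (supconv w r)"
proof -
  have "um x t \<le> supconv w r (x, t) \<and> supconv w r (x, t) \<le> up x t" if t: "0 \<le> t" "t < T" for x t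
  proof
    show "um x t \<le> supconv w r (x, t)" by (simp add: supconv_def)
    obtain d where d: "norm d \<le> exp (- L * t) * r" "supconv w r (x, t) = max (um x t) (w (x + d, t) - \<omega> r)"
      using supconv_attained[OF w r t, of x] by (elim exE conjE) (rule that)
    have "exp (- L * t) * r \<le> 1 * r" using r t L_nonneg by (intro mult_right_mono) auto
    then have "\<omega> (norm d) \<le> \<omega> r" using d(1) by (intro \<omega>_mono) auto
    moreover have "up (x + d) t - up x t \<le> \<omega> (norm d)" using up_\<omega>[OF t(1), of "x + d" x] by simp
    ultimately show "supconv w r (x, t) \<le> up x t"
      using subsolD(3)[OF w t, of "x + d"] d(2) obstacles_le[OF t(1), of x] by simp
  qed
  moreover have "supconv w r (x, 0) \<le> u0 x" for x
  proof -
    obtain d where d: "norm d \<le> exp (- L * 0) * r" "supconv w r (x, 0) = max (um x 0) (w (x + d, 0) - \<omega> r)"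
      using supconv_attained[OF w r order_refl T_pos, of x] by (elim exE conjE) (rule that)
    have "\<omega> (norm d) \<le> \<omega> r" using d(1) by (intro \<omega>_mono) auto
    moreover have "u0 (x + d) - u0 x \<le> \<omega> (norm d)" using u0_\<omega>[of "x + d" x] by simp
    ultimately show ?thesis using subsolD(4)[OF w, of "x + d"] d(2) u0_between[of x] by simp
  qed
  ultimately show ?thesis
    unfolding subsol_def using usc_on_supconv[OF w r] sub_at_supconv[OF w r] by blast
qed

text \<open>The radius is chosen so that at time \<open>t\<close> the shrunken ball around
  \<open>x\<close> just reaches \<open>y\<close>; then \<open>perron\<close> is compared with its
  own sup-convolution, which cannot exceed it.\<close>

lemma perron_modulus:
  assumes t: "0 \<le> t" "t < T"
  shows "\<bar>perron (x, t) - perron (y, t)\<bar> \<le> \<omega> (exp (L * t) * norm (x - y))"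
proof -
  have *: "perron (y, t) \<le> perron (x, t) + \<omega> (exp (L * t) * norm (y - x))" for x y
  proof -
    define r where "r = exp (L * t) * norm (y - x)"
    have r: "0 \<le> r" by (simp add: r_def)
    have "exp (- L * t) * exp (L * t) = 1" by (simp add: mult_exp_exp)
    then have "exp (- L * t) * r = norm (y - x)" unfolding r_def by (simp only: mult.assoc[symmetric] mult_1_left)
    then have r': "norm (y - x) \<le> exp (- L * t) * r" by simp
    from le_supconv[OF subsol_perron t r', of x] subsol_le_perron[OF subsol_supconv[OF subsol_perron r], of "(x, t)"] t
    show ?thesis by (simp add: r_def)
  qed
  from *[of x y] *[of y x] show ?thesis by (simp add: abs_le_iff norm_minus_commute)
qed


subsection \<open>Continuity of the greatest strong subsolution\<close>

text \<open>Gluing: the maximum of \<open>perron\<close> and \<open>\<psi>\<close> over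
  \<open>U\<close> stays in the class, so maximality forbids a gain. Barriers start on a closed half
  space, hence \<open>U\<close> is required to be a neighbourhood only of points where
  \<open>\<psi>\<close> wins; the condition outside \<open>U\<close> secures upper semicontinuity
  across its boundary.\<close>

lemma le_perron_if_sub_at:
  assumes \<psi>: "continuous_on UNIV \<psi>"
    and outside: "\<And>z. z \<in> UNIV \<times> {0..<T} \<Longrightarrow> z \<notin> U \<Longrightarrow> \<forall>\<^sub>F y in nhds z. y \<in> U \<longrightarrow> \<psi> y \<le> perron y"
    and up: "\<And>x t. 0 \<le> t \<Longrightarrow> t < T \<Longrightarrow> (x, t) \<in> U \<Longrightarrow> \<psi> (x, t) \<le> up x t"
    and init: "\<And>x. (x, 0) \<in> U \<Longrightarrow> \<psi> (x, 0) \<le> u0 x"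
    and sub: "\<And>x t. 0 < t \<Longrightarrow> t < T \<Longrightarrow> (x, t) \<in> U \<Longrightarrow> perron (x, t) < \<psi> (x, t) \<Longrightarrow>
      sub_at \<psi> x t \<and> (\<forall>\<^sub>F y in nhds (x, t). y \<in> U)"
    and z: "z \<in> U" "z \<in> UNIV \<times> {0..<T}"
  shows "\<psi> z \<le> perron z"
proof -
  define w where "w y = (if y \<in> U then max (perron y) (\<psi> y) else perron y)" for y
  have w_ge: "perron y \<le> w y" for y by (simp add: w_def)
  have "usc_on (UNIV \<times> {0..<T}) w"
  proof (rule usc_onI)
    fix y c assume y: "y \<in> UNIV \<times> {0..<T}" "w y < c"
    then have "perron y < c" using w_ge[of y] by simp
    from usc_onD[OF usc_on_perron y(1) this] obtain d1 where
      d1: "d1 > 0" "\<And>y'. y' \<in> UNIV \<times> {0..<T} \<Longrightarrow> dist y' y < d1 \<Longrightarrow> perron y' < c" by blast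
    have "\<forall>\<^sub>F y' in nhds y. y' \<in> U \<longrightarrow> \<psi> y' < c \<or> \<psi> y' \<le> perron y'"
    proof (cases "y \<in> U")
      case True
      then have "\<psi> y < c" using y(2) by (simp add: w_def)
      from order_tendstoD(2)[OF continuous_on_tendsto_compose[OF \<psi> filterlim_ident, of y] this]
      have "\<forall>\<^sub>F y' in nhds y. \<psi> y' < c" by simp
      then show ?thesis by eventually_elim simp
    next
      case False
      from outside[OF y(1) False] show ?thesis by eventually_elim simp
    qed
    then obtain d2 where d2: "d2 > 0" "\<And>y'. dist y' y < d2 \<Longrightarrow> y' \<in> U \<longrightarrow> \<psi> y' < c \<or> \<psi> y' \<le> perron y'"
      unfolding eventually_nhds_metric by blast
    show "\<exists>d>0. \<forall>y'\<in>UNIV \<times> {0..<T}. dist y' y < d \<longrightarrow> w y' < c"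
    proof (intro exI[of _ "min d1 d2"] conjI ballI impI)
      fix y' assume y': "y' \<in> UNIV \<times> {0..<T}" "dist y' y < min d1 d2"
      then have "perron y' < c" using d1(2)[of y'] by simp
      moreover have "y' \<in> U \<longrightarrow> \<psi> y' < c \<or> \<psi> y' \<le> perron y'" using d2(2)[of y'] y' by simp
      ultimately show "w y' < c" by (auto simp: w_def)
    qed (use d1 d2 in simp)
  qed
  moreover have "um x t \<le> w (x, t) \<and> w (x, t) \<le> up x t" if "0 \<le> t" "t < T" for x t
    using subsolD(2,3)[OF subsol_perron that, of x] up[OF that, of x] w_ge[of "(x, t)"] by (auto simp: w_def)
  moreover have "w (x, 0) \<le> u0 x" for x
    using subsolD(4)[OF subsol_perron, of x] init[of x] by (auto simp: w_def)
  moreover have "sub_at w x t" if t: "0 < t" "t < T" "um x t < w (x, t)" for x t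
  proof (cases "w (x, t) = perron (x, t)")
    case True
    then have "sub_at perron x t" using subsolD(5)[OF subsol_perron t(1,2), of x] t(3) by simp
    then show ?thesis
      by (rule sub_at_mono) (use True w_ge in \<open>auto intro!: always_eventually\<close>)
  next
    case False
    then have U: "(x, t) \<in> U" and gt: "perron (x, t) < \<psi> (x, t)" by (auto simp: w_def max_def split: if_splits)
    from sub[OF t(1,2) this] have s: "sub_at \<psi> x t" and ev: "\<forall>\<^sub>F y in nhds (x, t). y \<in> U" by auto
    from ev have "\<forall>\<^sub>F (h, \<tau>) in nhds 0. (x + h, t + \<tau>) \<in> U"
      by (subst eventually_nhds_0_Pair_iff_shift) (simp add: case_prod_unfold)
    then have "\<forall>\<^sub>F (h, \<tau>) in nhds 0. \<psi> (x + h, t + \<tau>) \<le> w (x + h, t + \<tau>)"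
      by eventually_elim (auto simp: w_def)
    then show ?thesis by (intro sub_at_mono[OF s]) (use U gt in \<open>simp_all add: w_def\<close>)
  qed
  ultimately have "subsol w" unfolding subsol_def by blast
  from subsol_le_perron[OF this z(2)] z(1) show ?thesis by (simp add: w_def)
qed

text \<open>The barrier is glued to \<open>perron\<close> from time \<open>s0\<close> on. Where it
  exceeds \<open>perron\<close> the time is later than \<open>s0\<close> and the point lies in the
  closed unit ball, so \<open>sub_at_lower_barrier\<close> applies. The second alternative in
  \<open>init\<close> allows a start from \<open>u0\<close> before \<open>perron\<close> is known to
  attain it.\<close>

lemma lower_barrier:
  assumes s0: "0 \<le> s0" and A: "0 < A" and K0: "0 \<le> K0"
    and k: "\<And>x t. norm (x - x0) \<le> 1 \<Longrightarrow> 0 \<le> t \<Longrightarrow> t \<le> T \<Longrightarrow> \<bar>k x t\<bar> \<le> K0"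
    and C: "2 * A * (1 + K0) < C"
    and init: "(\<forall>x. c0 - A * \<theta> ((norm (x - x0))\<^sup>2) \<le> perron (x, s0)) \<or>
      s0 = 0 \<and> (\<forall>x. c0 - A * \<theta> ((norm (x - x0))\<^sup>2) \<le> u0 x)"
    and obst: "\<And>x t. s0 \<le> t \<Longrightarrow> t < T \<Longrightarrow> c0 - A * \<theta> ((norm (x - x0))\<^sup>2) - C * (t - s0) \<le> up x t"
    and far: "\<And>x t. s0 \<le> t \<Longrightarrow> t < T \<Longrightarrow> 1 \<le> norm (x - x0) \<Longrightarrow> c0 - A * \<theta> ((norm (x - x0))\<^sup>2) \<le> um x t"
    and t: "s0 \<le> t" "t < T"
  shows "c0 - A * \<theta> ((norm (x - x0))\<^sup>2) - C * (t - s0) \<le> perron (x, t)"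
proof -
  have "0 < 2 * A * (1 + K0)" using A K0 by simp
  with C have C0: "0 < C" by linarith
  define \<psi> where "\<psi> = (\<lambda>(y, s). c0 - A * \<theta> ((norm (y - x0))\<^sup>2) - C * (s - s0))"
  define U where "U = {y :: (real^'n) \<times> real. s0 \<le> snd y}"
  have "\<psi> (x, t) \<le> perron (x, t)"
  proof (rule le_perron_if_sub_at[where U = U])
    show "continuous_on UNIV \<psi>"
      unfolding \<psi>_def case_prod_unfold by (intro continuous_intros continuous_on_\<theta>_compose) auto
    show "\<forall>\<^sub>F y in nhds z. y \<in> U \<longrightarrow> \<psi> y \<le> perron y" if "z \<notin> U" for z
    proof -
      have "open (- U)" unfolding U_def by (intro open_Compl closed_Collect_le continuous_intros)
      then have "\<forall>\<^sub>F y in nhds z. y \<in> - U" using that by (intro eventually_nhds_in_open) auto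
      then show ?thesis by eventually_elim simp
    qed
    show "\<psi> (x, t) \<le> up x t" if "t < T" "(x, t) \<in> U" for x t
      using obst[of t x] that by (simp add: U_def \<psi>_def)
    show "\<psi> (x, 0) \<le> u0 x" if "(x, 0) \<in> U" for x
    proof -
      have "s0 = 0" using that s0 by (simp add: U_def)
      then show ?thesis using init subsolD(4)[OF subsol_perron, of x] by (auto simp: \<psi>_def intro: order_trans)
    qed
    show "sub_at \<psi> x t \<and> (\<forall>\<^sub>F y in nhds (x, t). y \<in> U)"
      if t: "0 < t" "t < T" and U: "(x, t) \<in> U" and gt: "perron (x, t) < \<psi> (x, t)" for x t
    proof
      have "t \<noteq> s0" using gt init t by (auto simp: \<psi>_def) (metis less_le_not_le)
      then have "s0 < t" using U by (simp add: U_def)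
      then have "\<forall>\<^sub>F y in nhds (x, t). y \<in> {y. s0 < snd y}"
        by (intro eventually_nhds_in_open open_Collect_less continuous_intros) auto
      then show "\<forall>\<^sub>F y in nhds (x, t). y \<in> U" by eventually_elim (simp add: U_def)
      have "norm (x - x0) \<le> 1"
      proof (rule ccontr)
        assume "\<not> norm (x - x0) \<le> 1"
        then have "c0 - A * \<theta> ((norm (x - x0))\<^sup>2) \<le> um x t" using far[of t x] \<open>s0 < t\<close> t by simp
        moreover have "um x t \<le> perron (x, t)" using subsolD(2)[OF subsol_perron, of t x] t by simp
        moreover have "0 \<le> C * (t - s0)" using C0 \<open>s0 < t\<close> by simp
        ultimately show False using gt by (simp add: \<psi>_def)
      qed
      then show "sub_at \<psi> x t"
        unfolding \<psi>_def using A C C0 t k[of x t] by (intro sub_at_lower_barrier[OF _ _ refl]) auto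
    qed
    show "(x, t) \<in> U" "(x, t) \<in> UNIV \<times> {0..<T}" using t s0 by (auto simp: U_def)
  qed
  then show ?thesis by (simp add: \<psi>_def)
qed

section \<open>Initial values and continuity in time\<close>

lemma \<omega>_barrier:
  assumes "\<bar>v x - v x0\<bar> \<le> \<omega> (exp (L * s) * norm (x - x0))" "s \<le> T" "\<bar>v x\<bar> \<le> bnd" "\<bar>v x0\<bar> \<le> bnd" "0 < A" "0 < \<epsilon>"
    and "x \<noteq> x0 \<Longrightarrow> min (\<omega> (exp (L * T) * norm (x - x0))) (2 * bnd) \<le> \<epsilon> + A * \<theta> ((norm (x - x0))\<^sup>2)"
  shows "\<bar>v x - v x0\<bar> \<le> \<epsilon> + A * \<theta> ((norm (x - x0))\<^sup>2)"
proof (cases "x = x0")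
  case True
  then show ?thesis using assms by (simp add: \<theta>_zero)
next
  case False
  have "exp (L * s) * norm (x - x0) \<le> exp (L * T) * norm (x - x0)"
    using assms(2) L_nonneg by (intro mult_right_mono) (auto intro: mult_left_mono)
  then have "\<omega> (exp (L * s) * norm (x - x0)) \<le> \<omega> (exp (L * T) * norm (x - x0))" by (intro \<omega>_mono) auto
  moreover have "\<bar>v x - v x0\<bar> \<le> 2 * bnd" using assms(3,4) by linarith
  ultimately show ?thesis using assms(1) assms(7)[OF False] by linarith
qed

lemma u0_bnd: "\<bar>u0 x\<bar> \<le> bnd"
  using u0_between[of x] bnd(2,3)[of 0 x] by (simp add: abs_le_iff)

lemma perron_initial: "perron (x0, 0) = u0 x0"
proof (rule antisym)
  show "perron (x0, 0) \<le> u0 x0" by (rule subsolD(4)[OF subsol_perron])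
  show "u0 x0 \<le> perron (x0, 0)"
  proof (rule field_le_epsilon)
    fix e :: real assume "0 < e"
    then have e2: "0 < e / 2" by simp
    from barrier_constants[OF e2, of x0] obtain A C K0 where "barrier_consts (e / 2) x0 A C K0" by blast
    note A = barrier_constsD[OF this]
    have u0e: "\<bar>u0 x - u0 x0\<bar> \<le> e / 2 + A * \<theta> ((norm (x - x0))\<^sup>2)" for x
      using u0_\<omega>[of x x0] T_pos A(1,5) e2 u0_bnd by (intro \<omega>_barrier[where s = 0]) auto
    have "(u0 x0 - e) - A * \<theta> ((norm (x0 - x0))\<^sup>2) - C * (0 - 0) \<le> perron (x0, 0)"
    proof (rule lower_barrier[OF order_refl A(1,2,4,3)])
      have "\<forall>x. u0 x0 - e - A * \<theta> ((norm (x - x0))\<^sup>2) \<le> u0 x"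
      proof
        show "u0 x0 - e - A * \<theta> ((norm (x - x0))\<^sup>2) \<le> u0 x" for x using u0e[of x] e2 by linarith
      qed
      then show "(\<forall>x. u0 x0 - e - A * \<theta> ((norm (x - x0))\<^sup>2) \<le> perron (x, 0)) \<or>
        (0::real) = 0 \<and> (\<forall>x. u0 x0 - e - A * \<theta> ((norm (x - x0))\<^sup>2) \<le> u0 x)" by simp
      show "u0 x0 - e - A * \<theta> ((norm (x - x0))\<^sup>2) - C * (t - 0) \<le> up x t" if "0 \<le> t" "t < T" for x t
        using u0e[of x] A(8)[OF order_refl that(1), of x] u0_between[of x] by linarith
      show "u0 x0 - e - A * \<theta> ((norm (x - x0))\<^sup>2) \<le> um x t" if "0 \<le> t" "t < T" "1 \<le> norm (x - x0)" for x t
        using A(6)[OF that(3)] u0_bnd[of x0] bnd(2)[OF that(1), of x] \<open>0 < e\<close> by linarith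
    qed (use T_pos in auto)
    then show "u0 x0 \<le> perron (x0, 0) + e" by (simp add: \<theta>_zero)
  qed
qed

text \<open>Barriers from above and below start at time \<open>s\<close>. Their constants do not
  depend on \<open>s\<close>, since the spatial modulus with the factor \<open>exp (L * T)\<close>
  is valid at all times. One \<open>\<epsilon>\<close> pays for this modulus, the other for the
  motion of the obstacles.\<close>

lemma perron_time:
  assumes "0 < \<epsilon>"
  shows "\<exists>C. \<forall>s t. 0 \<le> s \<longrightarrow> s \<le> t \<longrightarrow> t < T \<longrightarrow> \<bar>perron (x0, t) - perron (x0, s)\<bar> \<le> 2 * \<epsilon> + C * (t - s)"
proof -
  from barrier_constants[OF assms, of x0] obtain A C K0 where "barrier_consts \<epsilon> x0 A C K0" by blast
  note A = barrier_constsD[OF this]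
  have "\<bar>perron (x0, t) - perron (x0, s)\<bar> \<le> 2 * \<epsilon> + C * (t - s)" if s: "0 \<le> s" "s \<le> t" and t: "t < T" for s t
  proof -
    have sT: "s < T" using s t by simp
    have P: "\<bar>perron (x, s) - perron (x0, s)\<bar> \<le> \<epsilon> + A * \<theta> ((norm (x - x0))\<^sup>2)" for x
      using perron_modulus[OF s(1) sT] sT A(1,5) assms subsol_bnd[OF subsol_perron s(1) sT]
      by (intro \<omega>_barrier[where s = s and v = "\<lambda>x. perron (x, s)"]) auto
    have "perron (x0, t) \<le> (perron (x0, s) + 2 * \<epsilon>) + A * \<theta> ((norm (x0 - x0))\<^sup>2) + C * (t - s)"
    proof (rule upper_barrier[OF subsol_perron s(1) A(1,2,4,3) _ _ _ s(2) t])
      show "perron (x, s) \<le> perron (x0, s) + 2 * \<epsilon> + A * \<theta> ((norm (x - x0))\<^sup>2)" for x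
        using P[of x] assms by linarith
      show "um x r \<le> perron (x0, s) + 2 * \<epsilon> + A * \<theta> ((norm (x - x0))\<^sup>2) + C * (r - s)" if "s \<le> r" "r < T" for x r
        using P[of x] A(7)[OF s(1) that(1), of x] subsolD(2)[OF subsol_perron s(1) sT, of x] by linarith
      show "perron (x, r) \<le> perron (x0, s) + 2 * \<epsilon> + A * \<theta> ((norm (x - x0))\<^sup>2)"
        if "s \<le> r" "r < T" "1 \<le> norm (x - x0)" for x r
        using A(6)[OF that(3)] subsol_bnd[OF subsol_perron _ that(2), of x] subsol_bnd[OF subsol_perron s(1) sT, of x0]
          that(1) s(1) assms by linarith
    qed
    moreover have "(perron (x0, s) - 2 * \<epsilon>) - A * \<theta> ((norm (x0 - x0))\<^sup>2) - C * (t - s) \<le> perron (x0, t)"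
    proof (rule lower_barrier[OF s(1) A(1,2,4,3) _ _ _ s(2) t])
      have "\<forall>x. perron (x0, s) - 2 * \<epsilon> - A * \<theta> ((norm (x - x0))\<^sup>2) \<le> perron (x, s)"
      proof
        show "perron (x0, s) - 2 * \<epsilon> - A * \<theta> ((norm (x - x0))\<^sup>2) \<le> perron (x, s)" for x
          using P[of x] assms by linarith
      qed
      then show "(\<forall>x. perron (x0, s) - 2 * \<epsilon> - A * \<theta> ((norm (x - x0))\<^sup>2) \<le> perron (x, s)) \<or>
        s = 0 \<and> (\<forall>x. perron (x0, s) - 2 * \<epsilon> - A * \<theta> ((norm (x - x0))\<^sup>2) \<le> u0 x)" by simp
      show "perron (x0, s) - 2 * \<epsilon> - A * \<theta> ((norm (x - x0))\<^sup>2) - C * (r - s) \<le> up x r" if "s \<le> r" "r < T" for x r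
        using P[of x] A(8)[OF s(1) that(1), of x] subsolD(3)[OF subsol_perron s(1) sT, of x] by linarith
      show "perron (x0, s) - 2 * \<epsilon> - A * \<theta> ((norm (x - x0))\<^sup>2) \<le> um x r"
        if "s \<le> r" "r < T" "1 \<le> norm (x - x0)" for x r
        using A(6)[OF that(3)] bnd(2)[of r x] subsol_bnd[OF subsol_perron s(1) sT, of x0]
          that(1) s(1) assms by linarith
    qed
    ultimately show ?thesis by (simp add: \<theta>_zero abs_le_iff)
  qed
  then show ?thesis by blast
qed

lemma \<omega>_zero: "\<omega> 0 = 0"
proof (rule antisym)
  show "\<omega> 0 \<le> 0"
  proof (rule field_le_epsilon)
    fix e :: real assume "0 < e"
    from \<omega>_small[OF this] obtain d where d: "d > 0" "\<And>r. 0 < r \<Longrightarrow> r < d \<Longrightarrow> \<omega> r < e" by blast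
    then have "\<omega> (d / 2) < e" by simp
    moreover have "\<omega> 0 \<le> \<omega> (d / 2)" using d by (intro \<omega>_mono) auto
    ultimately show "\<omega> 0 \<le> 0 + e" by simp
  qed
qed (simp add: \<omega>_nonneg)

lemma \<omega>_exp_small:
  assumes "0 < \<epsilon>"
  shows "\<exists>d>0. \<forall>r t. 0 \<le> r \<longrightarrow> r < d \<longrightarrow> t \<le> T \<longrightarrow> \<omega> (exp (L * t) * r) < \<epsilon>"
proof -
  obtain d where d: "d > 0" "\<And>r. 0 < r \<Longrightarrow> r < d \<Longrightarrow> \<omega> r < \<epsilon>" using \<omega>_small[OF assms] by blast
  have "\<omega> (exp (L * t) * r) < \<epsilon>" if "0 \<le> r" "r < d / exp (L * T)" "t \<le> T" for r t
  proof (cases "r = 0")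
    case True
    then show ?thesis using assms by (simp add: \<omega>_zero)
  next
    case False
    have "exp (L * t) * r \<le> exp (L * T) * r"
      using that L_nonneg by (intro mult_right_mono) (auto intro: mult_left_mono)
    also have "\<dots> < d" using that(2) by (simp add: pos_less_divide_eq mult.commute)
    finally show ?thesis using False that(1) by (intro d(2)) auto
  qed
  then show ?thesis using d(1) by (intro exI[of _ "d / exp (L * T)"]) auto
qed

text \<open>The spatial modulus is uniform in time, so the time estimate is applied along the line
  over \<open>x0\<close> alone.\<close>

lemma continuous_on_perron: "continuous_on (UNIV \<times> {0..<T}) perron"
  unfolding continuous_on_iff
proof (intro ballI allI impI)
  fix z :: "(real^'n) \<times> real" and e :: real assume z: "z \<in> UNIV \<times> {0..<T}" and e: "0 < e"
  obtain x0 t0 where xt: "z = (x0, t0)" by (cases z)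
  have t0: "0 \<le> t0" "t0 < T" using z by (auto simp: xt)
  obtain C where C: "\<And>s t. 0 \<le> s \<Longrightarrow> s \<le> t \<Longrightarrow> t < T \<Longrightarrow> \<bar>perron (x0, t) - perron (x0, s)\<bar> \<le> 2 * (e / 8) + C * (t - s)"
    using perron_time[of "e / 8" x0] e by auto
  obtain d where d: "d > 0" "\<And>r t. 0 \<le> r \<Longrightarrow> r < d \<Longrightarrow> t \<le> T \<Longrightarrow> \<omega> (exp (L * t) * r) < e / 4"
    using \<omega>_exp_small[of "e / 4"] e by auto
  define d' where "d' = min d (e / (4 * (\<bar>C\<bar> + 1)))"
  have d': "0 < d'" "d' \<le> d" "d' \<le> e / (4 * (\<bar>C\<bar> + 1))" using d e by (auto simp: d'_def)
  show "\<exists>d>0. \<forall>z'\<in>UNIV \<times> {0..<T}. dist z' z < d \<longrightarrow> dist (perron z') (perron z) < e"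
  proof (intro exI[of _ d'] conjI ballI impI d'(1))
    fix z' assume z': "z' \<in> UNIV \<times> {0..<T}" "dist z' z < d'"
    obtain x t where xt': "z' = (x, t)" by (cases z')
    have t: "0 \<le> t" "t < T" using z' by (auto simp: xt')
    have "norm (x - x0) < d'" "\<bar>t - t0\<bar> < d'"
      using le_less_trans[OF dist_fst_le z'(2)] le_less_trans[OF dist_snd_le z'(2)]
      by (auto simp: xt xt' dist_norm)
    have "\<bar>perron (x, t) - perron (x0, t)\<bar> < e / 4"
      using perron_modulus[OF t, of x x0] d(2)[of "norm (x - x0)" t] \<open>norm (x - x0) < d'\<close> d'(2) t by simp
    moreover have "\<bar>perron (x0, t) - perron (x0, t0)\<bar> \<le> 2 * (e / 8) + C * \<bar>t - t0\<bar>"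
      using C[of t0 t] C[of t t0] t t0 by (cases "t0 \<le> t") (auto simp: abs_minus_commute)
    moreover have "C * \<bar>t - t0\<bar> \<le> e / 4"
    proof -
      have "C * \<bar>t - t0\<bar> \<le> (\<bar>C\<bar> + 1) * \<bar>t - t0\<bar>" by (intro mult_right_mono) auto
      also have "\<dots> \<le> (\<bar>C\<bar> + 1) * (e / (4 * (\<bar>C\<bar> + 1)))"
        using \<open>\<bar>t - t0\<bar> < d'\<close> d'(3) by (intro mult_left_mono) auto
      also have "\<dots> = e / 4"
      proof -
        have "B * (e / (4 * B)) = e / 4" if "B \<noteq> 0" for B :: real using that by simp
        moreover have "\<bar>C\<bar> + 1 \<noteq> 0" by linarith
        ultimately show ?thesis by blast
      qed
      finally show ?thesis .
    qed
    ultimately show "dist (perron z') (perron z) < e" unfolding xt xt' dist_real_def using e by linarith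
  qed
qed

end

subsection \<open>The greatest strong subsolution is a viscosity solution\<close>

lemma F_lower_leI:
  assumes "\<And>r \<delta>. 0 < r \<Longrightarrow> 0 < \<delta> \<Longrightarrow> \<exists>q Y. Y \<in> sym_matrices \<and> dist (q, Y) (p, X) < r \<and> F q Y \<le> m + \<delta>"
  shows "F_lower F p X \<le> ereal m"
  unfolding F_lower_def lsc_envelope_on_def
proof (rule SUP_least)
  fix r :: real assume r: "r \<in> {0<..}"
  let ?S = "UNIV \<times> sym_matrices \<inter> ball (p, X) r"
  show "(INF y\<in>?S. ereal (case y of (q, Y) \<Rightarrow> F q Y)) \<le> ereal m"
  proof (rule ereal_le_epsilon2)
    fix \<delta> :: real assume "0 < \<delta>"
    with assms[of r \<delta>] r obtain q Y where qY: "Y \<in> sym_matrices" "dist (q, Y) (p, X) < r" "F q Y \<le> m + \<delta>" by auto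
    have "(q, Y) \<in> ?S" using qY by (auto simp: dist_commute)
    then have "(INF y\<in>?S. ereal (case y of (q, Y) \<Rightarrow> F q Y)) \<le> ereal (case (q, Y) of (q, Y) \<Rightarrow> F q Y)"
      by (rule INF_lower)
    also have "\<dots> \<le> ereal m + ereal \<delta>" using qY(3) by simp
    finally show "(INF y\<in>?S. ereal (case y of (q, Y) \<Rightarrow> F q Y)) \<le> ereal m + ereal \<delta>" .
  qed
qed

lemma F_upper_lessD:
  assumes "F_upper F p X < ereal m"
  shows "\<exists>r>0. \<exists>c<m. \<forall>q Y. Y \<in> sym_matrices \<longrightarrow> dist (q, Y) (p, X) < r \<longrightarrow> F q Y \<le> c"
proof -
  obtain c where c: "F_upper F p X < ereal c" "ereal c < ereal m" using ereal_dense2[OF assms] by blast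
  from c(1) obtain r where r: "r > 0"
    "(SUP y\<in>UNIV \<times> sym_matrices \<inter> ball (p, X) r. ereal (case y of (q, Y) \<Rightarrow> F q Y)) < ereal c"
    unfolding F_upper_def usc_envelope_on_def INF_less_iff by auto
  have "F q Y \<le> c" if "Y \<in> sym_matrices" "dist (q, Y) (p, X) < r" for q Y
  proof -
    have "(q, Y) \<in> UNIV \<times> sym_matrices \<inter> ball (p, X) r" using that by (auto simp: dist_commute)
    then have "ereal (case (q, Y) of (q, Y) \<Rightarrow> F q Y) \<le>
        (SUP y\<in>UNIV \<times> sym_matrices \<inter> ball (p, X) r. ereal (case y of (q, Y) \<Rightarrow> F q Y))"
      by (rule SUP_upper)
    with r(2) have "ereal (F q Y) < ereal c" by (simp del: less_ereal.simps)
    then show ?thesis by simp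
  qed
  with r(1) c(2) show ?thesis by auto
qed

lemma dist_add_mat_small:
  fixes X :: "real^'n^'n"
  assumes "0 < r"
  shows "\<exists>e>0. \<forall>\<epsilon>. \<bar>\<epsilon>\<bar> < e \<longrightarrow> dist (X + mat \<epsilon>) X < r"
proof -
  have "dist (X + mat \<epsilon>) X = \<bar>\<epsilon>\<bar> * norm (mat 1 :: real^'n^'n)" for \<epsilon>
  proof -
    have "mat \<epsilon> = \<epsilon> *\<^sub>R (mat 1 :: real^'n^'n)" by (simp add: mat_def vec_eq_iff)
    then have "norm (mat \<epsilon> :: real^'n^'n) = \<bar>\<epsilon>\<bar> * norm (mat 1 :: real^'n^'n)" by simp
    then show ?thesis by (simp add: dist_norm)
  qed
  moreover have "\<bar>\<epsilon>\<bar> * norm (mat 1 :: real^'n^'n) < r" if "\<bar>\<epsilon>\<bar> < r / (norm (mat 1 :: real^'n^'n) + 1)" for \<epsilon>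
  proof -
    let ?N = "norm (mat 1 :: real^'n^'n)"
    have N: "0 < ?N + 1" using norm_ge_zero[of "mat 1 :: real^'n^'n"] by linarith
    have "\<bar>\<epsilon>\<bar> * ?N \<le> \<bar>\<epsilon>\<bar> * (?N + 1)" by (intro mult_left_mono) auto
    also have "\<dots> < r" using that N by (simp add: pos_less_divide_eq)
    finally show ?thesis .
  qed
  moreover have "0 < r / (norm (mat 1 :: real^'n^'n) + 1)"
    using assms norm_ge_zero[of "mat 1 :: real^'n^'n"] by (intro divide_pos_pos) linarith+
  ultimately show ?thesis by (metis)
qed

context obstacle_problem
begin

text \<open>The inequality at zero gradient is recovered for general test polynomials. Separating
  the variable of \<open>perron\<close> from that of the polynomial by a penalty
  \<open>A * \<theta>\<close> moves the contact to a place where either the gradient is small and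
  nonzero, and the first clause of \<open>sub_at\<close> applies, or the flat penalty itself touches
  \<open>perron\<close>. In the latter case the time slope is nonpositive and \<open>X\<close> is
  positive semidefinite, so \<open>F 0 X \<le> 0\<close>. The matrix is exactly \<open>X\<close> in
  both cases.\<close>

lemma perron_touch_small_gradient:
  assumes t: "0 < t" "t < T" and gt: "um x t < perron (x, t)" and X: "X \<in> sym_matrices" and "0 < \<epsilon>"
    and touch: "\<forall>\<^sub>F (h, \<tau>) in nhds 0. perron (x + h, t + \<tau>) \<le> perron (x, t) + poly2 a 0 X K h \<tau> - \<epsilon> * ((norm h)\<^sup>2 + \<tau>\<^sup>2)"
    and "0 < \<delta>"
  shows "\<exists>p. norm p < \<delta> \<and> F p X \<le> - a + \<delta>"
proof -
  obtain K0 where K0: "0 \<le> K0" "\<And>y s. norm (y - x) \<le> 1 \<Longrightarrow> 0 \<le> s \<Longrightarrow> s \<le> T \<Longrightarrow> \<bar>k y s\<bar> \<le> K0"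
    using k_bound[of x] by blast
  obtain cX where cX: "0 < cX" "\<And>v. norm (X *v v) \<le> cX * norm v" using matrix_vector_bound[of X] by blast
  define Q where "Q h \<tau> = poly2 a 0 X K h \<tau>" for h \<tau>
  have "\<forall>\<^sub>F (y, s) in nhds (x, t). perron (y, s) \<le> perron (x, t) + Q (y - x) (s - t) - \<epsilon> * ((norm (y - x))\<^sup>2 + (s - t)\<^sup>2)"
    using touch by (subst eventually_nhds_0_Pair_iff_shift[symmetric]) (simp add: Q_def)
  then obtain \<rho>0 where \<rho>0: "\<rho>0 > 0" "\<And>y s. dist (y, s) (x, t) < \<rho>0 \<Longrightarrow>
      perron (y, s) \<le> perron (x, t) + Q (y - x) (s - t) - \<epsilon> * ((norm (y - x))\<^sup>2 + (s - t)\<^sup>2)"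
    by (auto simp: eventually_nhds_metric)
  define \<rho> where "\<rho> = min (min 1 (\<rho>0 / 4)) (min (t / 2) ((T - t) / 2))"
  have \<rho>: "0 < \<rho>" "\<rho> \<le> 1" "\<rho> < t" "\<rho> < T - t" "2 * \<rho> < \<rho>0" using \<rho>0(1) t by (auto simp: \<rho>_def min_def)
  have time: "0 < s" "s < T" if "\<bar>s - t\<bar> \<le> \<rho>" for s using that \<rho> by linarith+
  have near: "perron (y, s) \<le> perron (x, t) + Q (y - x) (s - t) - \<epsilon> * ((norm (y - x))\<^sup>2 + (s - t)\<^sup>2)"
    if "norm (y - x) \<le> \<rho>" "\<bar>s - t\<bar> \<le> \<rho>" for y s
  proof (rule \<rho>0(2))
    have "dist (y, s) (x, t) \<le> norm (y - x) + \<bar>s - t\<bar>"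
      using dist_Pair_le[of y s x t] by (simp add: dist_norm)
    then show "dist (y, s) (x, t) < \<rho>0" using that \<rho> by linarith
  qed
  have Qdiff: "Q h \<tau> - Q h' \<tau> \<le> cX * norm (h - h')" if "norm h \<le> \<rho>" "norm h' \<le> \<rho>" for h h' \<tau>
  proof -
    have "Q h \<tau> - Q h' \<tau> = ((h + h') \<bullet> (X *v (h - h'))) / 2"
      using sym_matrices_inner[OF X, of h h'] by (simp add: Q_def poly2_def algebra_simps)
    also have "(h + h') \<bullet> (X *v (h - h')) \<le> norm (h + h') * norm (X *v (h - h'))" by (rule norm_cauchy_schwarz)
    also have "\<dots> \<le> 2 * (cX * norm (h - h'))"
      using norm_triangle_ineq[of h h'] that \<rho> cX by (intro mult_mono) auto
    finally show ?thesis by simp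
  qed
  define \<eta>0 where "\<eta>0 = (perron (x, t) - um x t) / 2"
  have \<eta>0: "0 < \<eta>0" using gt by (simp add: \<eta>0_def)
  have "continuous_on (UNIV \<times> {0<..}) (\<lambda>z. um (fst z) (snd z))"
    by (rule continuous_on_subset[OF continuous_on_um]) auto
  from continuous_on_tendsto_compose[OF this filterlim_ident, of "(x, t)"]
  have um_lim: "((\<lambda>z. um (fst z) (snd z)) \<longlongrightarrow> um x t) (nhds (x, t))"
    using t eventually_nhds_in_open[of "UNIV \<times> {0<..}" "(x, t)"] by (simp add: open_Times)
  have "continuous_on UNIV (\<lambda>z. Q (fst z - x) (snd z - t))" unfolding Q_def by (rule continuous_on_poly2)
  from continuous_on_tendsto_compose[OF this filterlim_ident, of "(x, t)"]
  have Q_lim: "((\<lambda>z. Q (fst z - x) (snd z - t)) \<longlongrightarrow> 0) (nhds (x, t))" by (simp add: Q_def)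
  have "\<forall>\<^sub>F z in nhds (x, t). um (fst z) (snd z) < um x t + \<eta>0 \<and> - \<eta>0 < Q (fst z - x) (snd z - t)"
    using order_tendstoD(2)[OF um_lim, of "um x t + \<eta>0"] order_tendstoD(1)[OF Q_lim, of "- \<eta>0"] \<eta>0
    by (auto intro: eventually_conj)
  then obtain \<rho>1 where \<rho>1: "\<rho>1 > 0" "\<And>y s. dist (y, s) (x, t) < \<rho>1 \<Longrightarrow> um y s < um x t + \<eta>0 \<and> - \<eta>0 < Q (y - x) (s - t)"
    unfolding eventually_nhds_metric by (metis fst_conv snd_conv)
  define M where "M = 2 * \<bar>K\<bar> + 2 * cX + 2 * K0 * cX + 1"
  have M: "1 \<le> M" using cX K0 by (simp add: M_def)
  \<comment> \<open>Localization scale: the contact points will lie within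
    \<open>2 * \<sigma>\<close>, where \<open>perron\<close> stays above \<open>um\<close> and the
    errors from \<open>K\<close>, from \<open>k\<close> and from the gradient add up to less than
    \<open>\<delta>\<close>.\<close>
  define \<sigma> where "\<sigma> = min (min (\<rho> / 4) (\<rho>1 / 4)) (\<delta> / (2 * M))"
  have \<sigma>: "0 < \<sigma>" "\<sigma> \<le> \<rho> / 4" "\<sigma> \<le> \<rho>1 / 4" "\<sigma> \<le> \<delta> / (2 * M)" using \<rho> \<rho>1 M \<open>0 < \<delta>\<close> by (auto simp: \<sigma>_def)
  have M\<sigma>: "M * \<sigma> < \<delta>"
  proof -
    have "M * \<sigma> \<le> M * (\<delta> / (2 * M))" using \<sigma> M by (intro mult_left_mono) auto
    also have "\<dots> = \<delta> / 2" using M by simp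
    finally show ?thesis using \<open>0 < \<delta>\<close> by simp
  qed
  \<comment> \<open>Admissible separation of the two variables: below it the polynomial changes by
    less than \<open>\<epsilon> * \<sigma>\<^sup>2\<close>, the gap of the strict contact at
    distance \<open>\<sigma>\<close>.\<close>
  define \<eta> where "\<eta> = min \<sigma> (\<epsilon> * \<sigma>\<^sup>2 / (2 * cX))"
  have \<eta>: "0 < \<eta>" "\<eta> \<le> \<sigma>" "cX * \<eta> < \<epsilon> * \<sigma>\<^sup>2"
  proof -
    show "0 < \<eta>" "\<eta> \<le> \<sigma>" using \<sigma> cX \<open>0 < \<epsilon>\<close> by (auto simp: \<eta>_def)
    have "cX * \<eta> \<le> cX * (\<epsilon> * \<sigma>\<^sup>2 / (2 * cX))" using cX by (intro mult_left_mono) (auto simp: \<eta>_def)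
    also have "\<dots> = \<epsilon> * \<sigma>\<^sup>2 / 2" using cX by simp
    also have "\<dots> < \<epsilon> * \<sigma>\<^sup>2" using \<open>0 < \<epsilon>\<close> \<sigma> by simp
    finally show "cX * \<eta> < \<epsilon> * \<sigma>\<^sup>2" .
  qed
  \<comment> \<open>A separation of at least \<open>\<eta>\<close> then costs more than
    \<open>2 * cX * \<rho>\<close>, the most that separating the variables can gain in the
    ball.\<close>
  define A where "A = (2 * cX * \<rho> + 1) / \<theta> (\<eta>\<^sup>2)"
  have "0 < \<theta> (\<eta>\<^sup>2)" using \<eta> by (intro \<theta>_pos) auto
  moreover have "0 < 2 * cX * \<rho> + 1" using cX \<rho> by (simp add: add_pos_pos)
  ultimately have A: "0 < A" "A * \<theta> (\<eta>\<^sup>2) = 2 * cX * \<rho> + 1" by (auto simp: A_def)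
  \<comment> \<open>Doubling against the smooth \<open>Q\<close>: at a maximum with \<open>x' \<noteq> y\<close> the penalty has a nonzero gradient,
    and for \<open>x' = y\<close> it is a flat test function.\<close>
  define D where "D = (cball x \<rho> \<times> cball t \<rho>) \<times> cball x \<rho>"
  define \<Phi> where "\<Phi> = (\<lambda>((x', t'), y). perron (x', t') - (Q (y - x) (t' - t) + A * \<theta> ((norm (x' - y))\<^sup>2)))"
  have inD: "((x', t'), y) \<in> D \<longleftrightarrow> norm (x' - x) \<le> \<rho> \<and> \<bar>t' - t\<bar> \<le> \<rho> \<and> norm (y - x) \<le> \<rho>" for x' t' y
    by (auto simp: D_def dist_norm norm_minus_commute abs_minus_commute)
  have "compact D" unfolding D_def by (intro compact_Times compact_cball)
  have D_time: "snd (fst z) \<in> {0..<T}" if "z \<in> D" for z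
    using that time inD[of "fst (fst z)" "snd (fst z)" "snd z"] by (auto intro: less_imp_le)
  have "continuous_on D \<Phi>"
  proof -
    have "fst ` D \<subseteq> UNIV \<times> {0..<T}" using D_time by (intro image_subsetI) (simp only: mem_Times_iff, simp)
    then have 1: "continuous_on D (\<lambda>z. perron (fst z))"
      by (intro continuous_on_compose2[OF continuous_on_perron] continuous_intros)
    have 2: "continuous_on D (\<lambda>z. Q (snd z - x) (snd (fst z) - t))"
      unfolding Q_def poly2_def
      by (intro continuous_intros linear_continuous_on_compose[where g = "(*v) X"] matrix_vector_mul_linear) simp
    have 3: "continuous_on D (\<lambda>z. A * \<theta> ((norm (fst (fst z) - snd z))\<^sup>2))"
      by (intro continuous_intros continuous_on_\<theta>_compose) auto
    show ?thesis
      unfolding \<Phi>_def case_prod_unfold prod.collapse by (intro continuous_on_diff continuous_on_add 1 2 3)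
  qed
  moreover have base: "((x, t), x) \<in> D" using \<rho> by (simp add: inD)
  ultimately obtain z where z: "z \<in> D" "\<And>z'. z' \<in> D \<Longrightarrow> \<Phi> z' \<le> \<Phi> z"
    using continuous_attains_sup[OF \<open>compact D\<close>, of \<Phi>] by blast
  obtain x' t' y where zz: "z = ((x', t'), y)" by (metis prod.collapse)
  have zD: "norm (x' - x) \<le> \<rho>" "\<bar>t' - t\<bar> \<le> \<rho>" "norm (y - x) \<le> \<rho>" using z(1) by (auto simp: zz inD)
  have max: "perron (x'', t'') - (Q (y' - x) (t'' - t) + A * \<theta> ((norm (x'' - y'))\<^sup>2)) \<le>
      perron (x', t') - (Q (y - x) (t' - t) + A * \<theta> ((norm (x' - y))\<^sup>2))"
    if "norm (x'' - x) \<le> \<rho>" "\<bar>t'' - t\<bar> \<le> \<rho>" "norm (y' - x) \<le> \<rho>" for x'' t'' y'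
    using z(2)[of "((x'', t''), y')"] that by (simp add: inD zz \<Phi>_def)
  have max0: "perron (x, t) + Q (y - x) (t' - t) + A * \<theta> ((norm (x' - y))\<^sup>2) \<le> perron (x', t')"
    using max[of x t x] \<rho> by (simp add: \<theta>_zero Q_def)
  \<comment> \<open>The maximum is compared with the unseparated contact point, and the strict
    contact is inserted: displacement and penalty together are paid for by the change of
    \<open>Q\<close> between \<open>y\<close> and \<open>x'\<close>.\<close>
  have loc: "\<epsilon> * ((norm (x' - x))\<^sup>2 + (t' - t)\<^sup>2) + A * \<theta> ((norm (x' - y))\<^sup>2) \<le> cX * norm (x' - y)"
    using max0 near[OF zD(1,2)] Qdiff[OF zD(1,3), of "t' - t"] by simp
  have sq: "0 \<le> \<epsilon> * ((norm (x' - x))\<^sup>2 + (t' - t)\<^sup>2)" using \<open>0 < \<epsilon>\<close> by simp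
  have xy: "norm (x' - y) < \<eta>"
  proof (rule ccontr)
    assume "\<not> norm (x' - y) < \<eta>"
    then have "\<theta> (\<eta>\<^sup>2) \<le> \<theta> ((norm (x' - y))\<^sup>2)" using \<eta> by (intro \<theta>_mono power_mono) auto
    then have "A * \<theta> (\<eta>\<^sup>2) \<le> A * \<theta> ((norm (x' - y))\<^sup>2)" using A by (intro mult_left_mono) auto
    moreover have "norm (x' - y) \<le> 2 * \<rho>" using norm_triangle_ineq4[of "x' - x" "y - x"] zD by simp
    then have "cX * norm (x' - y) \<le> cX * (2 * \<rho>)" using cX by (intro mult_left_mono) auto
    ultimately show False using loc sq A(2) by (simp add: mult_ac)
  qed
  have small: "(norm (x' - x))\<^sup>2 + (t' - t)\<^sup>2 < \<sigma>\<^sup>2"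
  proof -
    have "0 \<le> A * \<theta> ((norm (x' - y))\<^sup>2)" using A \<theta>_nonneg by simp
    moreover have "cX * norm (x' - y) \<le> cX * \<eta>" using xy cX by (intro mult_left_mono) auto
    ultimately have "\<epsilon> * ((norm (x' - x))\<^sup>2 + (t' - t)\<^sup>2) < \<epsilon> * \<sigma>\<^sup>2" using loc \<eta>(3) by linarith
    then show ?thesis using \<open>0 < \<epsilon>\<close> by simp
  qed
  have "(norm (x' - x))\<^sup>2 < \<sigma>\<^sup>2" "\<bar>t' - t\<bar>\<^sup>2 < \<sigma>\<^sup>2"
    using small zero_le_power2[of "norm (x' - x)"] zero_le_power2[of "t' - t"] unfolding power2_abs by linarith+
  then have x's: "norm (x' - x) < \<sigma>" and t's: "\<bar>t' - t\<bar> < \<sigma>"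
    using \<sigma>(1) power_less_imp_less_base[of "norm (x' - x)" 2 \<sigma>] power_less_imp_less_base[of "\<bar>t' - t\<bar>" 2 \<sigma>] by simp_all
  have ys: "norm (y - x) < 2 * \<sigma>"
    using norm_triangle_ineq4[of "x' - x" "x' - y"] x's xy \<eta>(2) by simp
  have tT: "0 < t'" "t' < T" using time zD(2) by auto
  have "um x' t' < perron (x', t')"
  proof -
    have d1: "dist (x', t') (x, t) < \<rho>1"
    proof -
      have "dist (x', t') (x, t) \<le> norm (x' - x) + \<bar>t' - t\<bar>"
        using dist_Pair_le[of x' t' x t] by (simp add: dist_norm)
      then show ?thesis using x's t's \<sigma>(3) \<rho>1(1) by linarith
    qed
    have d2: "dist (y, t') (x, t) < \<rho>1"
    proof -
      have "dist (y, t') (x, t) \<le> norm (y - x) + \<bar>t' - t\<bar>"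
        using dist_Pair_le[of y t' x t] by (simp add: dist_norm)
      then show ?thesis using ys t's \<sigma>(3) \<rho>1(1) by linarith
    qed
    have "0 \<le> A * \<theta> ((norm (x' - y))\<^sup>2)" using A \<theta>_nonneg by simp
    moreover have "perron (x, t) = um x t + 2 * \<eta>0" by (simp add: \<eta>0_def field_simps)
    ultimately show ?thesis using \<rho>1(2)[OF d1] \<rho>1(2)[OF d2] max0 by linarith
  qed
  then have sub: "sub_at perron x' t'" using subsolD(5)[OF subsol_perron tT] by simp
  define p where "p = X *v (y - x)"
  define a' where "a' = a + 2 * K * (t' - t)"
  have Qshift: "Q (y - x + h) (t' - t + \<tau>) = Q (y - x) (t' - t) + poly2 a' p X K h \<tau>" for h \<tau>
    using poly2_shift[OF X, of a 0 K h "y - x" \<tau> "t' - t"] by (simp add: Q_def p_def a'_def add.commute)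
  have in_ball: "\<forall>\<^sub>F (h :: real^'n, \<tau> :: real) in nhds 0. norm (x' + h - x) \<le> \<rho> \<and> \<bar>t' + \<tau> - t\<bar> \<le> \<rho> \<and> norm (y + h - x) \<le> \<rho>"
  proof (rule eventually_mono[OF eventually_nhds_0_norm_less[OF \<sigma>(1)]], clarify)
    fix h :: "real^'n" and \<tau> :: real assume "norm h < \<sigma>" "\<bar>\<tau>\<bar> < \<sigma>"
    then show "norm (x' + h - x) \<le> \<rho> \<and> \<bar>t' + \<tau> - t\<bar> \<le> \<rho> \<and> norm (y + h - x) \<le> \<rho>"
      using norm_triangle_ineq[of "x' - x" h] norm_triangle_ineq[of "y - x" h] x's ys t's \<sigma>(2)
      by (auto simp: algebra_simps)
  qed
  have K_small: "- (2 * K * (t' - t)) \<le> 2 * \<bar>K\<bar> * \<sigma>"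
  proof -
    have "- (2 * K * (t' - t)) \<le> \<bar>2 * K\<bar> * \<bar>t' - t\<bar>" by (metis abs_ge_minus_self abs_mult)
    also have "\<dots> \<le> 2 * \<bar>K\<bar> * \<sigma>" using t's by (intro mult_mono) auto
    finally show ?thesis .
  qed
  have p_small: "norm p \<le> 2 * cX * \<sigma>"
  proof -
    have "norm p \<le> cX * norm (y - x)" unfolding p_def by (rule cX)
    also have "\<dots> \<le> cX * (2 * \<sigma>)" using cX ys by (intro mult_left_mono) auto
    finally show ?thesis by simp
  qed
  have M\<sigma>': "2 * \<bar>K\<bar> * \<sigma> + 2 * cX * \<sigma> + 2 * K0 * cX * \<sigma> + \<sigma> < \<delta>" using M\<sigma> by (simp add: M_def distrib_right)
  have nn: "0 \<le> 2 * \<bar>K\<bar> * \<sigma>" "0 \<le> 2 * cX * \<sigma>" "0 \<le> 2 * K0 * cX * \<sigma>" using \<sigma> cX K0 by auto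
  \<comment> \<open>Varying \<open>y\<close> alone: polynomial plus penalty is minimal there, which
    ties the gradient \<open>p\<close> of the polynomial to that of the penalty.\<close>
  have opt: "\<forall>\<^sub>F (h :: real^'n, \<tau> :: real) in nhds 0. 0 \<le> poly2 0 p X 0 h 0 + A * (\<theta> ((norm (y - x' + h))\<^sup>2) - \<theta> ((norm (y - x'))\<^sup>2))"
    using in_ball
  proof (eventually_elim, clarify)
    fix h :: "real^'n" and \<tau> :: real assume "norm (y + h - x) \<le> \<rho>"
    from max[OF zD(1,2) this]
    have "Q (y - x) (t' - t) + A * \<theta> ((norm (x' - y))\<^sup>2) \<le> Q (y + h - x) (t' - t) + A * \<theta> ((norm (x' - (y + h)))\<^sup>2)" by simp
    moreover have "Q (y + h - x) (t' - t) = Q (y - x) (t' - t) + poly2 0 p X 0 h 0"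
      using Qshift[of h 0] by (simp add: poly2_def algebra_simps)
    moreover have "norm (x' - (y + h)) = norm (y - x' + h)" "norm (x' - y) = norm (y - x')"
      using norm_minus_commute[of x' "y + h"] norm_minus_commute[of x' y] by (simp_all add: algebra_simps)
    ultimately show "0 \<le> poly2 0 p X 0 h 0 + A * (\<theta> ((norm (y - x' + h))\<^sup>2) - \<theta> ((norm (y - x'))\<^sup>2))"
      by (simp add: right_diff_distrib)
  qed
  show ?thesis
  proof (cases "x' = y")
    \<comment> \<open>Without separation, optimality in \<open>y\<close> makes \<open>X\<close>
      positive semidefinite, and varying \<open>x'\<close> alone gives a flat test function for
      \<open>perron\<close>.\<close>
    case True
    have "\<forall>\<^sub>F (h, \<tau>) in nhds 0. poly2 0 (- p) (- X) 0 h \<tau> \<le> 0 * \<tau> + 0 * \<tau>\<^sup>2 + A * \<theta> (1 * (norm h)\<^sup>2)"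
      using opt by eventually_elim (auto simp: True poly2_def minus_matrix_vector \<theta>_zero)
    from poly2_le_flat_imp(3)[OF this A(1) zero_less_one] have "loewner_le 0 X"
      by (simp add: loewner_le_def minus_matrix_vector)
    then have "F 0 X \<le> 0" by (rule F_zero_nonpos[OF X])
    have "\<forall>\<^sub>F (h, \<tau>) in nhds 0. perron (x' + h, t' + \<tau>) \<le> perron (x', t') + a' * \<tau> + K * \<tau>\<^sup>2 + A * \<theta> (1 * (norm h)\<^sup>2)"
      using in_ball
    proof (eventually_elim, clarify)
      fix h :: "real^'n" and \<tau> :: real assume "norm (x' + h - x) \<le> \<rho>" "\<bar>t' + \<tau> - t\<bar> \<le> \<rho>"
      from max[OF this zD(3)] Qshift[of 0 \<tau>]
      show "perron (x' + h, t' + \<tau>) \<le> perron (x', t') + a' * \<tau> + K * \<tau>\<^sup>2 + A * \<theta> (1 * (norm h)\<^sup>2)"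
        by (simp add: True \<theta>_zero poly2_def algebra_simps)
    qed
    from sub_at_flatD[OF sub A(1) zero_less_one this] have "a' \<le> 0" .
    then have "F 0 X \<le> - a + \<delta>" using \<open>F 0 X \<le> 0\<close> K_small M\<sigma>' nn \<sigma>(1) unfolding a'_def by linarith
    then show ?thesis using \<open>0 < \<delta>\<close> by (intro exI[of _ 0]) simp
  next
    case False
    define d where "d = y - x'"
    have d: "d \<noteq> 0" using False by (simp add: d_def)
    define G where "G = g (1 * (norm d)\<^sup>2)"
    have G: "0 < G" unfolding G_def using d by (intro g_pos) auto
    define X1 where "X1 = (2 * A * 1 * G) *\<^sub>R mat 2 + (16 * A * 1\<^sup>2) *\<^sub>R outer_prod d d"
    have "\<forall>\<^sub>F (h, \<tau>) in nhds 0. poly2 0 (- p) (- X) 0 h \<tau> \<le> poly2 0 ((2 * A * 1 * G) *\<^sub>R d) X1 0 h \<tau>"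
      using opt \<theta>_expansion_poly2[OF d zero_less_one less_imp_le[OF A(1)]]
      unfolding G_def[symmetric] X1_def[symmetric]
      by eventually_elim (auto simp: poly2_def minus_matrix_vector d_def)
    from poly2_le_imp(2)[OF this] have "- p = (2 * A * G) *\<^sub>R d" by simp
    then have "p \<noteq> 0" using A G d by auto
    \<comment> \<open>Varying both space variables by the same \<open>h\<close> leaves the penalty
      constant, so the polynomial itself touches \<open>perron\<close> at
      \<open>(x', t')\<close>.\<close>
    have "\<forall>\<^sub>F (h, \<tau>) in nhds 0. perron (x' + h, t' + \<tau>) \<le> perron (x', t') + poly2 a' p X K h \<tau>"
      using in_ball
    proof (eventually_elim, clarify)
      fix h :: "real^'n" and \<tau> :: real assume "norm (x' + h - x) \<le> \<rho>" "\<bar>t' + \<tau> - t\<bar> \<le> \<rho>" "norm (y + h - x) \<le> \<rho>"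
      from max[OF this] Qshift[of h \<tau>]
      show "perron (x' + h, t' + \<tau>) \<le> perron (x', t') + poly2 a' p X K h \<tau>"
        by (simp add: algebra_simps)
    qed
    from sub_at_poly2D[OF sub X \<open>p \<noteq> 0\<close> this] have "F p X \<le> - a - 2 * K * (t' - t) - k x' t' * norm p" by (simp add: a'_def)
    also have "- (k x' t' * norm p) \<le> K0 * (2 * cX * \<sigma>)"
    proof -
      have "- (k x' t' * norm p) \<le> \<bar>k x' t'\<bar> * norm p" by (metis abs_ge_minus_self abs_mult abs_norm_cancel)
      also have "\<dots> \<le> K0 * (2 * cX * \<sigma>)" using K0 zD(1) \<rho>(2) tT p_small by (intro mult_mono) auto
      finally show ?thesis .
    qed
    then have "- a - 2 * K * (t' - t) - k x' t' * norm p \<le> - a + (2 * \<bar>K\<bar> * \<sigma> + K0 * (2 * cX * \<sigma>))" using K_small by linarith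
    also have "\<dots> \<le> - a + \<delta>" using M\<sigma>' nn \<sigma>(1) by (simp add: mult_ac)
    finally have "F p X \<le> - a + \<delta>" .
    moreover have "norm p < \<delta>" using p_small M\<sigma>' nn \<sigma>(1) by linarith
    ultimately show ?thesis by blast
  qed
qed

text \<open>\<open>F_lower\<close> is bounded by values of \<open>F\<close> at nearby jets. A
  nonzero gradient is kept and only the matrix perturbed; at zero gradient the nearby jets are those
  of \<open>perron_touch_small_gradient\<close>.\<close>

lemma viscosity_subsolution_perron: "viscosity_subsolution T F k um up u0 (\<lambda>x t. perron (x, t))"
  unfolding viscosity_subsolution_def
proof (intro conjI allI ballI impI; (elim conjE)?)
  show "usc_on (UNIV \<times> {0..<T}) (\<lambda>(x, t). perron (x, t))" using usc_on_perron by (simp add: case_prod_unfold)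
  show "um x t \<le> perron (x, t)" "perron (x, t) \<le> up x t" if "t \<in> {0..<T}" for x t
    using subsolD(2,3)[OF subsol_perron, of t x] that by auto
  show "perron (x, 0) \<le> u0 x" for x by (simp add: perron_initial)
  fix \<phi> :: "real^'n \<Rightarrow> real \<Rightarrow> real" and x t
  assume "t \<in> {0<..<T}" and C2: "C2 (\<lambda>(y, s). \<phi> y s)" and gt: "um x t < perron (x, t)"
    and max: "\<forall>y. \<forall>s\<in>{0..<T}. perron (y, s) - \<phi> y s \<le> perron (x, t) - \<phi> x t"
  then have t: "0 < t" "t < T" by auto
  define a where "a = deriv (\<lambda>s. \<phi> x s) t"
  define p where "p = grad (\<lambda>y. \<phi> y t) x"
  define X where "X = hessian (\<lambda>y. \<phi> y t) x"
  have X: "X \<in> sym_matrices" unfolding X_def by (rule C2_expansion(1)[OF C2])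
  have touch: "\<exists>K. \<forall>\<^sub>F (h, \<tau>) in nhds 0. perron (x + h, t + \<tau>) \<le> perron (x, t) + poly2 a p (X + mat (2 * \<epsilon>)) K h \<tau>"
    if \<epsilon>: "0 < \<epsilon>" for \<epsilon>
  proof -
    obtain K where K: "\<forall>\<^sub>F (h, \<tau>) in nhds 0.
      \<bar>\<phi> (x + h) (t + \<tau>) - \<phi> x t - poly2 a p X 0 h \<tau>\<bar> \<le> \<epsilon> * (norm h)\<^sup>2 + K * \<tau>\<^sup>2"
      using C2_expansion(2)[OF C2 \<epsilon>, of x t] unfolding a_def p_def X_def by blast
    have "0 < min t (T - t)" using t by simp
    from eventually_nhds_0_norm_less[OF this] K
    have "\<forall>\<^sub>F (h, \<tau>) in nhds 0. perron (x + h, t + \<tau>) \<le> perron (x, t) + poly2 a p (X + mat (2 * \<epsilon>)) K h \<tau>"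
    proof (eventually_elim, clarify)
      fix h :: "real^'n" and \<tau> :: real assume "\<bar>\<tau>\<bar> < min t (T - t)"
        and 1: "\<bar>\<phi> (x + h) (t + \<tau>) - \<phi> x t - poly2 a p X 0 h \<tau>\<bar> \<le> \<epsilon> * (norm h)\<^sup>2 + K * \<tau>\<^sup>2"
      then have "t + \<tau> \<in> {0..<T}" by auto
      with max have "perron (x + h, t + \<tau>) - \<phi> (x + h) (t + \<tau>) \<le> perron (x, t) - \<phi> x t" by blast
      moreover have "poly2 a p (X + mat (2 * \<epsilon>)) K h \<tau> = poly2 a p X 0 h \<tau> + \<epsilon> * (norm h)\<^sup>2 + K * \<tau>\<^sup>2"
        unfolding poly2_add_mat by (simp add: poly2_def)
      ultimately show "perron (x + h, t + \<tau>) \<le> perron (x, t) + poly2 a p (X + mat (2 * \<epsilon>)) K h \<tau>"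
        using 1 unfolding abs_le_iff by linarith
    qed
    then show ?thesis by blast
  qed
  have "F_lower F p X \<le> ereal (- (a + k x t * norm p))"
  proof (rule F_lower_leI)
    fix r \<delta> :: real assume r: "0 < r" and \<delta>: "0 < \<delta>"
    have r2: "0 < r / 2" using r by simp
    obtain e where e: "0 < e" "\<And>\<epsilon>. \<bar>\<epsilon>\<bar> < e \<Longrightarrow> dist (X + mat \<epsilon>) X < r / 2"
      using dist_add_mat_small[OF r2, of X] by blast
    \<comment> \<open>Leaves room for \<open>mat (4 * \<epsilon>)\<close>, that is for two terms
      \<open>\<epsilon> * (norm h)\<^sup>2\<close>: one covers the Taylor error, the other makes the
      contact strict.\<close>
    define \<epsilon> where "\<epsilon> = e / 8"
    have \<epsilon>: "0 < \<epsilon>" "\<bar>2 * \<epsilon>\<bar> < e" "\<bar>4 * \<epsilon>\<bar> < e" using e(1) by (auto simp: \<epsilon>_def)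
    obtain K where K: "\<forall>\<^sub>F (h, \<tau>) in nhds 0. perron (x + h, t + \<tau>) \<le> perron (x, t) + poly2 a p (X + mat (2 * \<epsilon>)) K h \<tau>"
      using touch[OF \<epsilon>(1)] by blast
    show "\<exists>q Y. Y \<in> sym_matrices \<and> dist (q, Y) (p, X) < r \<and> F q Y \<le> - (a + k x t * norm p) + \<delta>"
    proof (cases "p = 0")
      case False
      have Y: "X + mat (2 * \<epsilon>) \<in> sym_matrices" by (intro sym_matrices_intros X)
      have "a + F p (X + mat (2 * \<epsilon>)) + k x t * norm p \<le> 0"
        by (rule sub_at_perron_nonzero[OF t gt Y False K])
      moreover have "dist (p, X + mat (2 * \<epsilon>)) (p, X) < r"
        using dist_Pair_le[of p "X + mat (2 * \<epsilon>)" p X] e(2)[OF \<epsilon>(2)] r by simp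
      ultimately show ?thesis using Y \<delta> by (intro exI[of _ p] exI[of _ "X + mat (2 * \<epsilon>)"]) auto
    next
      case True
      have Y: "X + mat (4 * \<epsilon>) \<in> sym_matrices" by (intro sym_matrices_intros X)
      have "\<forall>\<^sub>F (h, \<tau>) in nhds 0. perron (x + h, t + \<tau>) \<le> perron (x, t) + poly2 a 0 (X + mat (4 * \<epsilon>)) (K + \<epsilon>) h \<tau>
          - \<epsilon> * ((norm h)\<^sup>2 + \<tau>\<^sup>2)"
        using K unfolding poly2_add_mat by eventually_elim (auto simp: True poly2_def algebra_simps)
      from perron_touch_small_gradient[OF t gt Y \<epsilon>(1) this, of "min \<delta> (r / 2)"] \<delta> r
      obtain q where q: "norm q < min \<delta> (r / 2)" "F q (X + mat (4 * \<epsilon>)) \<le> - a + min \<delta> (r / 2)" by auto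
      have "dist (q, X + mat (4 * \<epsilon>)) (p, X) < r"
        using dist_Pair_le[of q "X + mat (4 * \<epsilon>)" p X] e(2)[OF \<epsilon>(3)] q(1) by (simp add: True)
      then show ?thesis using Y q(2) by (intro exI[of _ q] exI[of _ "X + mat (4 * \<epsilon>)"]) (auto simp: True)
    qed
  qed
  then have "ereal a + F_lower F p X + ereal (k x t * norm p) \<le> ereal a + ereal (- (a + k x t * norm p)) + ereal (k x t * norm p)"
    by (intro add_mono order_refl)
  then show "ereal (deriv (\<lambda>s. \<phi> x s) t) + F_lower F (grad (\<lambda>y. \<phi> y t) x) (hessian (\<lambda>y. \<phi> y t) x)
      + ereal (k x t * norm (grad (\<lambda>y. \<phi> y t) x)) \<le> 0"
    by (simp add: a_def p_def X_def zero_ereal_def)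
qed

text \<open>If the inequality failed, the test polynomial, lowered in second order and lifted by a
  small constant, would satisfy the subsolution inequality near the contact point, stay below the
  upper obstacle, and lie below \<open>perron\<close> away from the centre. Gluing it in contradicts
  maximality.\<close>

lemma viscosity_supersolution_perron: "viscosity_supersolution T F k um up u0 (\<lambda>x t. perron (x, t))"
  unfolding viscosity_supersolution_def
proof (intro conjI allI ballI impI; (elim conjE)?)
  show "lsc_on (UNIV \<times> {0..<T}) (\<lambda>(x, t). perron (x, t))"
    using continuous_on_imp_lsc_on[OF continuous_on_perron] by (simp add: case_prod_unfold)
  show "um x t \<le> perron (x, t)" "perron (x, t) \<le> up x t" if "t \<in> {0..<T}" for x t
    using subsolD(2,3)[OF subsol_perron, of t x] that by auto
  show "u0 x \<le> perron (x, 0)" for x by (simp add: perron_initial)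
  fix \<phi> :: "real^'n \<Rightarrow> real \<Rightarrow> real" and x t
  assume "t \<in> {0<..<T}" and C2: "C2 (\<lambda>(y, s). \<phi> y s)" and lt: "perron (x, t) < up x t"
    and min: "\<forall>y. \<forall>s\<in>{0..<T}. perron (x, t) - \<phi> x t \<le> perron (y, s) - \<phi> y s"
  then have t: "0 < t" "t < T" by auto
  define a where "a = deriv (\<lambda>s. \<phi> x s) t"
  define p where "p = grad (\<lambda>y. \<phi> y t) x"
  define X where "X = hessian (\<lambda>y. \<phi> y t) x"
  have X: "X \<in> sym_matrices" unfolding X_def by (rule C2_expansion(1)[OF C2])
  have "0 \<le> ereal a + F_upper F p X + ereal (k x t * norm p)"
  proof (rule ccontr)
    assume "\<not> ?thesis"
    then have "F_upper F p X < ereal (- (a + k x t * norm p))"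
      by (cases "F_upper F p X") (auto simp: not_le zero_ereal_def)
    from F_upper_lessD[OF this] obtain r c where r: "0 < r" and c: "c < - (a + k x t * norm p)"
      "\<And>q Y. Y \<in> sym_matrices \<Longrightarrow> dist (q, Y) (p, X) < r \<Longrightarrow> F q Y \<le> c" by blast
    have r2: "0 < r / 2" using r by simp
    obtain e where e: "0 < e" "\<And>\<epsilon>. \<bar>\<epsilon>\<bar> < e \<Longrightarrow> dist (X + mat \<epsilon>) X < r / 2"
      using dist_add_mat_small[OF r2, of X] by blast
    define \<epsilon> where "\<epsilon> = e / 8"
    have \<epsilon>: "0 < \<epsilon>" "\<bar>- 4 * \<epsilon>\<bar> < e" using e(1) by (auto simp: \<epsilon>_def)
    obtain K0 where K0: "\<forall>\<^sub>F (h, \<tau>) in nhds 0.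
      \<bar>\<phi> (x + h) (t + \<tau>) - \<phi> x t - poly2 a p X 0 h \<tau>\<bar> \<le> \<epsilon> * (norm h)\<^sup>2 + K0 * \<tau>\<^sup>2"
      using C2_expansion(2)[OF C2 \<epsilon>(1), of x t] unfolding a_def p_def X_def by blast
    \<comment> \<open>Lowers the polynomial by \<open>2 * \<epsilon> * (norm h)\<^sup>2\<close>:
      half for the Taylor error, half for a strict gap to \<open>perron\<close> away from the
      centre.\<close>
    define Y where "Y = X + mat (- 4 * \<epsilon>)"
    define K where "K = - (K0 + \<epsilon>)"
    have Y: "Y \<in> sym_matrices" unfolding Y_def by (intro sym_matrices_intros X)
    have YX: "dist Y X < r / 2" unfolding Y_def by (rule e(2)[OF \<epsilon>(2)])
    define P where "P z = poly2 a p Y K (fst z - x) (snd z - t)" for z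
    define q where "q z = p + Y *v (fst z - x)" for z :: "(real^'n) \<times> real"
    define H where "H z = a + 2 * K * (snd z - t) + c + k (fst z) (snd z) * norm (q z)" for z
    define \<eta>1 where "\<eta>1 = (up x t - perron (x, t)) / 2"
    have \<eta>1: "0 < \<eta>1" using lt by (simp add: \<eta>1_def)
    have P: "continuous_on UNIV P" unfolding P_def by (rule continuous_on_poly2)
    have below: "\<forall>\<^sub>F (y, s) in nhds (x, t). perron (x, t) + poly2 a p Y K (y - x) (s - t) + \<epsilon> * ((norm (y - x))\<^sup>2 + (s - t)\<^sup>2) \<le> perron (y, s)"
    proof -
      have "0 < min t (T - t)" using t by simp
      from eventually_nhds_0_norm_less[OF this] K0
      have "\<forall>\<^sub>F (h, \<tau>) in nhds 0. perron (x, t) + poly2 a p Y K h \<tau> + \<epsilon> * ((norm h)\<^sup>2 + \<tau>\<^sup>2) \<le> perron (x + h, t + \<tau>)"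
      proof (eventually_elim, clarify)
        fix h :: "real^'n" and \<tau> :: real assume "\<bar>\<tau>\<bar> < min t (T - t)"
          and 1: "\<bar>\<phi> (x + h) (t + \<tau>) - \<phi> x t - poly2 a p X 0 h \<tau>\<bar> \<le> \<epsilon> * (norm h)\<^sup>2 + K0 * \<tau>\<^sup>2"
        then have "t + \<tau> \<in> {0..<T}" by auto
        with min have "perron (x, t) - \<phi> x t \<le> perron (x + h, t + \<tau>) - \<phi> (x + h) (t + \<tau>)" by blast
        moreover have "poly2 a p Y K h \<tau> + \<epsilon> * ((norm h)\<^sup>2 + \<tau>\<^sup>2) = poly2 a p X 0 h \<tau> - (\<epsilon> * (norm h)\<^sup>2 + K0 * \<tau>\<^sup>2)"
          unfolding Y_def poly2_add_mat by (simp add: poly2_def K_def algebra_simps)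
        ultimately show "perron (x, t) + poly2 a p Y K h \<tau> + \<epsilon> * ((norm h)\<^sup>2 + \<tau>\<^sup>2) \<le> perron (x + h, t + \<tau>)"
          using 1 unfolding abs_le_iff by linarith
      qed
      then show ?thesis by (subst eventually_nhds_0_Pair_iff_shift[symmetric]) simp
    qed
    have "(q \<longlongrightarrow> p + Y *v (fst (x, t) - x)) (nhds (x, t))"
      unfolding q_def
      by (intro tendsto_intros bounded_linear.tendsto[OF matrix_vector_mul_bounded_linear] tendsto_fst filterlim_ident)
    then have q_lim: "(q \<longlongrightarrow> p) (nhds (x, t))" by simp
    have "(H \<longlongrightarrow> a + 2 * K * (snd (x, t) - t) + c + k x t * norm p) (nhds (x, t))"
      unfolding H_def by (intro tendsto_intros q_lim k_tendsto t tendsto_snd filterlim_ident)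
    then have ev_H: "\<forall>\<^sub>F z in nhds (x, t). H z < 0" using c(1) by (intro order_tendstoD(2)) auto
    have ev_q: "\<forall>\<^sub>F z in nhds (x, t). dist (q z) p < r / 2" by (rule tendstoD[OF q_lim r2])
    have "continuous_on (UNIV \<times> {0<..}) (\<lambda>z. up (fst z) (snd z) - P z)"
      by (intro continuous_on_diff continuous_on_subset[OF continuous_on_up] continuous_on_subset[OF P]) auto
    from continuous_on_tendsto_compose[OF this filterlim_ident, of "(x, t)"]
    have "((\<lambda>z. up (fst z) (snd z) - P z) \<longlongrightarrow> up x t) (nhds (x, t))"
      using t eventually_nhds_in_open[of "UNIV \<times> {0<..}" "(x, t)"] by (simp add: open_Times P_def)
    then have ev_up: "\<forall>\<^sub>F z in nhds (x, t). perron (x, t) + \<eta>1 < up (fst z) (snd z) - P z"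
      using lt by (intro order_tendstoD(1)) (auto simp: \<eta>1_def field_simps)
    have "\<forall>\<^sub>F z in nhds (x, t). H z < 0 \<and> dist (q z) p < r / 2 \<and> perron (x, t) + \<eta>1 < up (fst z) (snd z) - P z \<and>
      perron (x, t) + P z + \<epsilon> * ((norm (fst z - x))\<^sup>2 + (snd z - t)\<^sup>2) \<le> perron z"
      using ev_H ev_q ev_up below by eventually_elim (auto simp: P_def)
    then obtain \<rho>0 where \<rho>0: "\<rho>0 > 0" "\<And>z. dist z (x, t) < \<rho>0 \<Longrightarrow> H z < 0 \<and> dist (q z) p < r / 2 \<and>
      perron (x, t) + \<eta>1 < up (fst z) (snd z) - P z \<and>
      perron (x, t) + P z + \<epsilon> * ((norm (fst z - x))\<^sup>2 + (snd z - t)\<^sup>2) \<le> perron z"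
      unfolding eventually_nhds_metric by blast
    define \<rho> where "\<rho> = min \<rho>0 t"
    have \<rho>: "0 < \<rho>" "\<rho> \<le> \<rho>0" "\<rho> \<le> t" using \<rho>0(1) t by (auto simp: \<rho>_def)
    \<comment> \<open>Height of the bump: it respects the distance to \<open>up\<close> and does not
      exceed the gap at distance \<open>\<rho> / 2\<close>, so the bump can rise above
      \<open>perron\<close> only inside the half ball.\<close>
    define \<eta> where "\<eta> = min \<eta>1 (\<epsilon> * (\<rho> / 2)\<^sup>2)"
    have \<eta>: "0 < \<eta>" "\<eta> \<le> \<eta>1" "\<eta> \<le> \<epsilon> * (\<rho> / 2)\<^sup>2" using \<eta>1 \<epsilon> \<rho> by (auto simp: \<eta>_def)
    define \<psi> where "\<psi> z = perron (x, t) + \<eta> + P z" for z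
    have "\<psi> (x, t) \<le> perron (x, t)"
    proof (rule le_perron_if_sub_at[where U = "ball (x, t) \<rho>"])
      show "continuous_on UNIV \<psi>" unfolding \<psi>_def by (intro continuous_intros P)
      show "\<forall>\<^sub>F y in nhds z. y \<in> ball (x, t) \<rho> \<longrightarrow> \<psi> y \<le> perron y" if "z \<notin> ball (x, t) \<rho>" for z
      proof -
        have "\<forall>\<^sub>F y in nhds z. y \<in> - cball (x, t) (\<rho> / 2)"
          using that \<rho> by (intro eventually_nhds_in_open) auto
        then show ?thesis
        proof (rule eventually_mono, intro impI)
          fix y :: "(real^'n) \<times> real" assume "y \<in> - cball (x, t) (\<rho> / 2)" "y \<in> ball (x, t) \<rho>"
          then have y: "\<rho> / 2 \<le> dist y (x, t)" "dist y (x, t) < \<rho>0" using \<rho>(2) by (auto simp: dist_commute)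
          have "(\<rho> / 2)\<^sup>2 \<le> (dist y (x, t))\<^sup>2" using y(1) \<rho>(1) by (intro power_mono) auto
          also have "(dist y (x, t))\<^sup>2 = (norm (fst y - x))\<^sup>2 + (snd y - t)\<^sup>2"
            by (cases y) (simp add: dist_norm norm_Pair)
          finally have "\<epsilon> * (\<rho> / 2)\<^sup>2 \<le> \<epsilon> * ((norm (fst y - x))\<^sup>2 + (snd y - t)\<^sup>2)" using \<epsilon>(1) by (intro mult_left_mono) auto
          then show "\<psi> y \<le> perron y" using \<rho>0(2)[OF y(2)] \<eta>(3) unfolding \<psi>_def by linarith
        qed
      qed
      show "\<psi> (y, s) \<le> up y s" if "(y, s) \<in> ball (x, t) \<rho>" for y s
        using \<rho>0(2)[of "(y, s)"] that \<rho>(2) \<eta>(2) by (simp add: \<psi>_def dist_commute)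
      show "\<psi> (y, 0) \<le> u0 y" if "(y, 0) \<in> ball (x, t) \<rho>" for y
      proof -
        have "dist t 0 < \<rho>" using le_less_trans[OF dist_snd_le[of "(x, t)" "(y, 0)"]] that by simp
        then show ?thesis using t \<rho>(3) by simp
      qed
      show "sub_at \<psi> y s \<and> (\<forall>\<^sub>F z in nhds (y, s). z \<in> ball (x, t) \<rho>)" if "(y, s) \<in> ball (x, t) \<rho>" for y s
      proof
        show "\<forall>\<^sub>F z in nhds (y, s). z \<in> ball (x, t) \<rho>" using that by (intro eventually_nhds_in_open) auto
        have ys: "dist (y, s) (x, t) < \<rho>0" using that \<rho>(2) by (simp add: dist_commute)
        let ?a = "a + 2 * K * (s - t)"
        have H: "?a + c + k y s * norm (q (y, s)) < 0" using \<rho>0(2)[OF ys] by (simp add: H_def)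
        have "dist (q (y, s), Y) (p, X) < r"
          using dist_Pair_le[of "q (y, s)" Y p X] \<rho>0(2)[OF ys] YX by linarith
        from c(2)[OF Y this] have Fc: "F (q (y, s)) Y \<le> c" .
        show "sub_at \<psi> y s"
        proof (rule sub_at_if_poly2_below[OF _ Y])
          have "\<psi> (y + h, s + \<tau>) = \<psi> (y, s) + poly2 ?a (q (y, s)) Y K h \<tau>" for h \<tau>
            using poly2_shift[OF Y, of a p K h "y - x" \<tau> "s - t"]
            by (simp add: \<psi>_def P_def q_def add_diff_eq add.commute)
          then show "\<forall>\<^sub>F (h, \<tau>) in nhds 0. \<psi> (y, s) + poly2 ?a (q (y, s)) Y K h \<tau> \<le> \<psi> (y + h, s + \<tau>)"
            by (intro always_eventually) auto
          show "?a + F (q (y, s)) Y + k y s * norm (q (y, s)) \<le> 0" using Fc H by linarith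
          \<comment> \<open>At a critical point of the bump with \<open>Y\<close> negative
            semidefinite, \<open>F 0 Y\<close> is nonnegative, so the inequality forces the sign of
            the time slope although \<open>F\<close> may be discontinuous there.\<close>
          show "?a \<le> 0" if "q (y, s) = 0" "loewner_le Y 0"
            using Fc H F_zero_nonneg[OF Y that(2)] that(1) by simp
        qed
      qed
    qed (use \<rho> t in auto)
    then show False using \<eta>(1) by (simp add: \<psi>_def P_def)
  qed
  then show "0 \<le> ereal (deriv (\<lambda>s. \<phi> x s) t) + F_upper F (grad (\<lambda>y. \<phi> y t) x) (hessian (\<lambda>y. \<phi> y t) x)
      + ereal (k x t * norm (grad (\<lambda>y. \<phi> y t) x))"
    by (simp add: a_def p_def X_def)
qed

end

theorem proposition4:
  fixes T L :: real
    and F :: "real^'n \<Rightarrow> real^'n^'n \<Rightarrow> real"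
    and k um up u :: "real^'n \<Rightarrow> real \<Rightarrow> real"
    and u0 :: "real^'n \<Rightarrow> real"
    and \<omega> :: "real \<Rightarrow> real"
  assumes T_pos: "0 < T"
    and F_cont: "continuous_on ((UNIV - {0}) \<times> sym_matrices) (\<lambda>(p, X). F p X)"
    and F_geometric: "\<And>p X c \<sigma>. X \<in> sym_matrices \<Longrightarrow> 0 < c \<Longrightarrow>
          F (c *\<^sub>R p) (c *\<^sub>R X + \<sigma> *\<^sub>R outer_prod p p) = c * F p X"
    and F_elliptic: "\<And>p X Y. X \<in> sym_matrices \<Longrightarrow> Y \<in> sym_matrices \<Longrightarrow> loewner_le X Y \<Longrightarrow>
          F p Y \<le> F p X"
    and k_lipschitz: "L-lipschitz_on (UNIV \<times> {0..}) (\<lambda>(x, t). k x t)"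
    and obstacles_le: "\<And>x t. 0 \<le> t \<Longrightarrow> um x t \<le> up x t"
    and um_bounded: "bounded ((\<lambda>(x, t). um x t) ` (UNIV \<times> {0..}))"
    and up_bounded: "bounded ((\<lambda>(x, t). up x t) ` (UNIV \<times> {0..}))"
    and um_ucont: "uniformly_continuous_on (UNIV \<times> {0..}) (\<lambda>(x, t). um x t)"
    and up_ucont: "uniformly_continuous_on (UNIV \<times> {0..}) (\<lambda>(x, t). up x t)"
    and u0_ucont: "uniformly_continuous_on UNIV u0"
    and u0_between: "\<And>x. um x 0 \<le> u0 x \<and> u0 x \<le> up x 0"
    and u0_modulus: "modulus_of_continuity_on UNIV u0 \<omega>"
    and um_modulus: "modulus_of_continuity_on (UNIV \<times> {0..}) (\<lambda>(x, t). um x t) \<omega>"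
    and up_modulus: "modulus_of_continuity_on (UNIV \<times> {0..}) (\<lambda>(x, t). up x t) \<omega>"
    and u_solution: "unique_viscosity_solution T F k um up u0 u"
  shows "(\<forall>\<epsilon>>0. \<exists>\<delta>>0. \<forall>t\<in>{0..<T}. \<forall>x y. dist x y < \<delta> \<longrightarrow> dist (u x t) (u y t) < \<epsilon>) \<and>
         (\<forall>x y. \<forall>t\<in>{0..<T}. \<bar>u x t - u y t\<bar> \<le> \<omega> (exp (L * t) * dist x y))"
proof -
  \<comment> \<open>The two values belong to flat functions used as test functions from above and as
    barriers from below. Continuity of \<open>F\<close> bounds them only on compact sets avoiding
    \<open>d = 0\<close>, which is all that the construction of the profile asks for.\<close>
  define m where "m d = \<bar>F d (mat 2)\<bar> + \<bar>F (- d) (mat (- 2))\<bar>" for d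
  have m: "bounded (m ` {d. r \<le> norm d \<and> norm d \<le> 1})" if "0 < r" for r
  proof -
    let ?S = "{d :: real^'n. r \<le> norm d \<and> norm d \<le> 1}"
    have "?S = cball 0 1 \<inter> {d. r \<le> norm d}" by auto
    moreover have "closed {d :: real^'n. r \<le> norm d}" by (intro closed_Collect_le continuous_intros)
    ultimately have S: "compact ?S" by (simp add: compact_Int_closed)
    have "continuous_on ?S (\<lambda>d. (\<lambda>(p, X). F p X) (d, mat 2))"
      using that by (intro continuous_on_compose2[OF F_cont] continuous_intros) (auto simp: sym_matrices_mat)
    moreover have "continuous_on ?S (\<lambda>d. (\<lambda>(p, X). F p X) (- d, mat (- 2)))"
      using that by (intro continuous_on_compose2[OF F_cont] continuous_intros) (auto simp: sym_matrices_mat)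
    ultimately have "continuous_on ?S m" unfolding m_def by (intro continuous_intros) simp_all
    then show ?thesis using S by (intro compact_imp_bounded compact_continuous_image)
  qed
  obtain \<theta> g :: "real \<Rightarrow> real" where flat: "\<theta> 0 = 0"
    "\<And>s t. 0 \<le> s \<Longrightarrow> s \<le> t \<Longrightarrow> \<theta> s \<le> \<theta> t"
    "\<And>s. 0 < s \<Longrightarrow> 0 < \<theta> s" "\<And>s. 0 < s \<Longrightarrow> 0 < g s" "\<And>s. 0 \<le> s \<Longrightarrow> g s \<le> s"
    "\<And>s s1. 0 \<le> s \<Longrightarrow> 0 \<le> s1 \<Longrightarrow> \<theta> s \<le> \<theta> s1 + g s1 * (s - s1) + (s - s1)\<^sup>2"
    "\<And>c d. 0 < c \<Longrightarrow> d \<noteq> 0 \<Longrightarrow> norm d \<le> 1 \<Longrightarrow> c * norm d \<le> 1 \<Longrightarrow>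
      g (c * (norm d)\<^sup>2) * \<bar>m d\<bar> \<le> c * (norm d)\<^sup>2"
    using flat_function_exists[of m, OF m] by blast
  interpret obstacle_problem T L F k um up u0 \<omega> \<theta> g
    by unfold_locales (fact assms flat[unfolded m_def])+
  have "viscosity_solution T F k um up u0 (\<lambda>x t. perron (x, t))"
    unfolding viscosity_solution_def
    using viscosity_subsolution_perron viscosity_supersolution_perron by blast
  with u_solution have u: "perron (x, t) = u x t" if "t \<in> {0..<T}" for x t
    unfolding unique_viscosity_solution_def using that by blast
  have modulus: "\<bar>u x t - u y t\<bar> \<le> \<omega> (exp (L * t) * dist x y)" if "t \<in> {0..<T}" for x y t
    using perron_modulus[of t x y] u[OF that] that by (simp add: dist_norm)
  have "\<exists>\<delta>>0. \<forall>t\<in>{0..<T}. \<forall>x y. dist x y < \<delta> \<longrightarrow> dist (u x t) (u y t) < \<epsilon>" if \<epsilon>: "0 < \<epsilon>" for \<epsilon>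
  proof -
    obtain \<delta> where \<delta>: "\<delta> > 0" "\<And>r t. 0 \<le> r \<Longrightarrow> r < \<delta> \<Longrightarrow> t \<le> T \<Longrightarrow> \<omega> (exp (L * t) * r) < \<epsilon>"
      using \<omega>_exp_small[OF \<epsilon>] by blast
    have "dist (u x t) (u y t) < \<epsilon>" if "t \<in> {0..<T}" "dist x y < \<delta>" for x y t
      using modulus[OF that(1), of x y] \<delta>(2)[OF zero_le_dist that(2), of t] that(1) by (simp add: dist_real_def)
    with \<delta>(1) show ?thesis by blast
  qed
  with modulus show ?thesis by blast
qed

end
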